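(* Let $K$ be a field complete with respect to a discrete non-archimedean valuation, with residue field $k$. Let $\mathcal{A}=\{\alpha_1<\alpha_2<\cdots<\alpha_t\}\subseteq\mathbb{Z}$ be finite with $t\ge2$. Assume that $\mathrm{char}(k)=0$ or that $\mathrm{char}(k)$ is coprime to $\alpha-\beta$ for any $\alpha,\beta\in\mathcal{A}$ with $\alpha\ne\beta$. Let $D_1$ be a probability distribution on $k^\ast$. Then $$E(\mathcal{A},D_1,K)=\sum_{\{\alpha_1,\alpha_t\}\subseteq\mathcal{B}\subseteq\mathcal{A}}P(\mathcal{B}/\mathcal{A})\sum_{i=1}^{|\mathcal{B}|-1}\frac{E_k(\beta_{i+1}-\beta_i,D_1)}{\beta_{i+1}-\beta_i},$$ where for each $\mathcal{B}$ we write $\mathcal{B}=\{\alpha_1=\beta_1<\beta_2<\cdots<\beta_{|\mathcal{B}|}=\alpha_t\}$. (That is, for every probability distribution $D_2$ on the tails, the limit defining $E(\mathcal{A},D_1,K)$ exists and equals the right-hand side.)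
   Context: Let $v:K\to\mathbb{R}\cup\{\infty\}$ be the discrete (nontrivial) valuation, $A$ its valuation ring, $\mathfrak{M}=\pi A$ its maximal ideal with a fixed generator $\pi$, $k=A/\mathfrak{M}$. The first digit of $x\in K^\ast$ is $\delta(x)=\pi^{-v(x)/v(\pi)}x\bmod\mathfrak{M}\in k^\ast$. Fix a set $\Delta\subseteq A\setminus\mathfrak{M}$ of representatives of $k^\ast$, and let $\Delta(x)\in\Delta$ be the representative of $\delta(x)$. Every $x\in K^\ast$ factors uniquely as $x=\pi^{v(x)/v(\pi)}\Delta(x)e(x)$ with $e(x)\in1+\mathfrak{M}$ (the tail), so $x\mapsto(v(x),\delta(x),e(x))$ is a bijection $K^\ast\to v(\pi)\mathbb{Z}\times k^\ast\times(1+\mathfrak{M})$. Random model: given a probability distribution $D_1$ on $k^\ast$, a probability distribution $D_2$ on $1+\mathfrak{M}$ and $M>0$, a random element of $K^\ast$ is obtained by choosing independently its valuation uniformly in $[-M,M]\cap v(\pi)\mathbb{Z}$, its first digit according to $D_1$ and its tail according to $D_2$. A random polynomial $f=\sum_{\alpha\in\mathcal{A}}a_\alpha X^\alpha$ with support exactly $\mathcal{A}$ has coefficients $a_\alpha\in K^\ast$ chosen independently in this way (root counts are assumed measurable so that expectations make sense). $E(\mathcal{A},D_1,D_2,M,K)$ is the expected number of roots of $f$ in $K^\ast$, and $E(\mathcal{A},D_1,K)=\lim_{M\to\infty}E(\mathcal{A},D_1,D_2,M,K)$, which does not depend on $D_2$. For a positive integer $\gamma$, $E_k(\gamma,D_1)$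 is the expected number of roots in $k^\ast$ of $aX^\gamma+b$ with $a,b\in k^\ast$ chosen independently according to $D_1$. For $\{\alpha_1,\alpha_t\}\subseteq\mathcal{B}\subseteq\mathcal{A}$, $S(\mathcal{B}/\mathcal{A})\subseteq\mathbb{R}^t$ is the set of $(v_1,\ldots,v_t)$ such that for every $i\in\{1,\ldots,t\}$: $\alpha_i\in\mathcal{B}$ if and only if $$v_i\le v_j\frac{\alpha_i-\alpha_k}{\alpha_j-\alpha_k}+v_k\frac{\alpha_j-\alpha_i}{\alpha_j-\alpha_k}\quad\text{for all }1\le j<i<k\le t$$ (i.e. $\mathcal{B}$ is exactly the set of $\alpha_i$ such that $(\alpha_i,v_i)$ lies on the lower hull of the points $(\alpha_1,v_1),\ldots,(\alpha_t,v_t)$). $P(\mathcal{B}/\mathcal{A})$ is the Lebesgue measure of $S(\mathcal{B}/\mathcal{A})\cap[0,1]^t$. *)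

theory Defs
  imports "HOL-Probability.Probability" "HOL-Algebra.QuotRing" "HOL-Algebra.Multiplicative_Group"
begin

definition discrete_valuation :: "('a::field \<Rightarrow> ereal) \<Rightarrow> bool" where
  "discrete_valuation v \<longleftrightarrow>
     (\<forall>x. v x \<noteq> -\<infinity>) \<and>
     (\<forall>x. v x = \<infinity> \<longleftrightarrow> x = 0) \<and>
     (\<forall>x y. v (x * y) = v x + v y) \<and>
     (\<forall>x y. min (v x) (v y) \<le> v (x + y)) \<and>
     (\<exists>c::real. c > 0 \<and> v ` (UNIV - {0}) = {ereal (c * of_int n) | n::int. True})"

definition complete_valuation :: "('a::field \<Rightarrow> ereal) \<Rightarrow> bool" where
  "complete_valuation v \<longleftrightarrow>
     (\<forall>x :: nat \<Rightarrow> 'a.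
        (\<forall>C::real. \<exists>N. \<forall>m\<ge>N. \<forall>n\<ge>N. ereal C \<le> v (x m - x n)) \<longrightarrow>
        (\<exists>l. \<forall>C::real. \<exists>N. \<forall>n\<ge>N. ereal C \<le> v (x n - l)))"

definition valuation_ring :: "('a::field \<Rightarrow> ereal) \<Rightarrow> 'a ring" where
  "valuation_ring v = \<lparr>carrier = {x. 0 \<le> v x}, mult = (*), one = 1, zero = 0, add = (+)\<rparr>"

definition valuation_ideal :: "('a::field \<Rightarrow> ereal) \<Rightarrow> 'a set" where
  "valuation_ideal v = {x. 0 < v x}"

text \<open>The elements of the residue field are the cosets of the maximal ideal, as subsets of \<open>'a\<close>;
  its unit group \<open>Units (residue_field v)\<close> consists of the nonzero ones.\<close>

definition residue_field :: "('a::field \<Rightarrow> ereal) \<Rightarrow> 'a set ring" where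
  "residue_field v = valuation_ring v Quot valuation_ideal v"

text \<open>The order function of the library gives \<open>0\<close> for elements of infinite order, so this is \<open>0\<close>
  in characteristic zero.\<close>

definition residue_char :: "('a::field \<Rightarrow> ereal) \<Rightarrow> nat" where
  "residue_char v = group.ord (add_monoid (residue_field v)) \<one>\<^bsub>residue_field v\<^esub>"

definition one_units :: "('a::field \<Rightarrow> ereal) \<Rightarrow> 'a set" where
  "one_units v = {1 + m | m. m \<in> valuation_ideal v}"

definition digit_representatives :: "('a::field \<Rightarrow> ereal) \<Rightarrow> 'a set \<Rightarrow> bool" where
  "digit_representatives v \<Delta> \<longleftrightarrow>
     \<Delta> \<subseteq> carrier (valuation_ring v) - valuation_ideal v \<and>
     (\<forall>d \<in> Units (residue_field v). \<exists>!r. r \<in> \<Delta> \<inter> d)"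

text \<open>The element with valuation \<open>w\<close>, first digit \<open>d\<close> (a coset) and tail \<open>e\<close>. The floor is exact
  for the valuations that occur, which are integer multiples of the valuation of \<open>\<pi>\<close>.\<close>

definition element_of ::
    "('a::field \<Rightarrow> ereal) \<Rightarrow> 'a \<Rightarrow> 'a set \<Rightarrow> real \<times> 'a set \<times> 'a \<Rightarrow> 'a" where
  "element_of v \<pi> \<Delta> = (\<lambda>(w, d, e).
     \<pi> powi \<lfloor>w / real_of_ereal (v \<pi>)\<rfloor> * (THE r. r \<in> \<Delta> \<inter> d) * e)"

definition valuations_upto :: "('a::field \<Rightarrow> ereal) \<Rightarrow> 'a \<Rightarrow> real \<Rightarrow> real set" where
  "valuations_upto v \<pi> M = {-M..M} \<inter> {real_of_ereal (v \<pi>) * of_int n | n::int. True}"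

definition coefficient_law ::
    "('a::field \<Rightarrow> ereal) \<Rightarrow> 'a \<Rightarrow> 'a set measure \<Rightarrow> 'a measure \<Rightarrow> real \<Rightarrow> (real \<times> 'a set \<times> 'a) measure" where
  "coefficient_law v \<pi> D1 D2 M =
     uniform_count_measure (valuations_upto v \<pi> M) \<Otimes>\<^sub>M (D1 \<Otimes>\<^sub>M D2)"

text \<open>A random polynomial with support \<open>A\<close> is an \<open>A\<close>-indexed family of independent triples
  (valuation, first digit, tail).\<close>

definition polynomial_law ::
    "('a::field \<Rightarrow> ereal) \<Rightarrow> 'a \<Rightarrow> int set \<Rightarrow> 'a set measure \<Rightarrow> 'a measure \<Rightarrow> real \<Rightarrow>
     (int \<Rightarrow> real \<times> 'a set \<times> 'a) measure" where
  "polynomial_law v \<pi> A D1 D2 M = (\<Pi>\<^sub>M \<alpha>\<in>A. coefficient_law v \<pi> D1 D2 M)"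

definition nonzero_roots :: "int set \<Rightarrow> (int \<Rightarrow> 'a::field) \<Rightarrow> 'a set" where
  "nonzero_roots A a = {x. x \<noteq> 0 \<and> (\<Sum>\<alpha>\<in>A. a \<alpha> * x powi \<alpha>) = 0}"

definition root_count ::
    "('a::field \<Rightarrow> ereal) \<Rightarrow> 'a \<Rightarrow> 'a set \<Rightarrow> int set \<Rightarrow> (int \<Rightarrow> real \<times> 'a set \<times> 'a) \<Rightarrow> real" where
  "root_count v \<pi> \<Delta> A f = real (card (nonzero_roots A (\<lambda>\<alpha>. element_of v \<pi> \<Delta> (f \<alpha>))))"

definition expected_roots ::
    "('a::field \<Rightarrow> ereal) \<Rightarrow> 'a \<Rightarrow> 'a set \<Rightarrow> int set \<Rightarrow> 'a set measure \<Rightarrow> 'a measure \<Rightarrow> real \<Rightarrow> real" where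
  "expected_roots v \<pi> \<Delta> A D1 D2 M =
     (\<integral>f. root_count v \<pi> \<Delta> A f \<partial>polynomial_law v \<pi> A D1 D2 M)"

definition residue_binomial_roots ::
    "('a::field \<Rightarrow> ereal) \<Rightarrow> nat \<Rightarrow> 'a set \<times> 'a set \<Rightarrow> 'a set set" where
  "residue_binomial_roots v \<gamma> = (\<lambda>(a, b).
     {x \<in> Units (residue_field v).
        a \<otimes>\<^bsub>residue_field v\<^esub> (x [^]\<^bsub>residue_field v\<^esub> \<gamma>) \<oplus>\<^bsub>residue_field v\<^esub> b = \<zero>\<^bsub>residue_field v\<^esub>})"

definition residue_root_count :: "('a::field \<Rightarrow> ereal) \<Rightarrow> nat \<Rightarrow> 'a set \<times> 'a set \<Rightarrow> real" where
  "residue_root_count v \<gamma> p = real (card (residue_binomial_roots v \<gamma> p))"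

definition expected_residue_roots ::
    "('a::field \<Rightarrow> ereal) \<Rightarrow> nat \<Rightarrow> 'a set measure \<Rightarrow> real" where
  "expected_residue_roots v \<gamma> D1 = (\<integral>p. residue_root_count v \<gamma> p \<partial>(D1 \<Otimes>\<^sub>M D1))"

text \<open>Heights on \<open>A = {\<alpha>\<^sub>1 < \<dots> < \<alpha>\<^sub>t}\<close> are indexed by the exponents themselves, so that
  \<open>w \<alpha>\<^sub>i\<close> is the \<open>i\<close>-th coordinate of a vector of \<open>\<real>\<^sup>t\<close>.\<close>

definition lower_hull_heights :: "int set \<Rightarrow> int set \<Rightarrow> (int \<Rightarrow> real) set" where
  "lower_hull_heights B A = {w \<in> A \<rightarrow>\<^sub>E UNIV. \<forall>\<alpha>\<in>A. \<alpha> \<in> B \<longleftrightarrow>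
     (\<forall>\<beta>\<in>A. \<forall>\<gamma>\<in>A. \<beta> < \<alpha> \<and> \<alpha> < \<gamma> \<longrightarrow>
        w \<alpha> \<le> w \<beta> * (of_int (\<alpha> - \<gamma>) / of_int (\<beta> - \<gamma>))
             + w \<gamma> * (of_int (\<beta> - \<alpha>) / of_int (\<beta> - \<gamma>)))}"

definition lower_hull_prob :: "int set \<Rightarrow> int set \<Rightarrow> real" where
  "lower_hull_prob B A =
     measure (\<Pi>\<^sub>M \<alpha>\<in>A. lborel) (lower_hull_heights B A \<inter> (A \<rightarrow>\<^sub>E {0..1}))"

definition edge_sum :: "('a::field \<Rightarrow> ereal) \<Rightarrow> 'a set measure \<Rightarrow> int set \<Rightarrow> real" where
  "edge_sum v D1 B = (let \<beta> = sorted_list_of_set B in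
     \<Sum>i<card B - 1. expected_residue_roots v (nat (\<beta> ! (i + 1) - \<beta> ! i)) D1
                      / of_int (\<beta> ! (i + 1) - \<beta> ! i))"

end

theory Submission
  imports Defs "HOL-Real_Asymp.Real_Asymp"
begin

text \<open>The roots of \<open>f = \<Sum> a\<^sub>\<alpha> X\<^sup>\<alpha>\<close> are controlled by its Newton polygon, the lower hull of the
points \<open>(\<alpha>, v(a\<^sub>\<alpha>))\<close>. If \<open>x\<close> is a nonzero root, at least two of the terms \<open>a\<^sub>\<alpha> x\<^sup>\<alpha>\<close> have the
smallest valuation. If no three of the points are collinear, exactly two terms do, and their
exponents \<open>\<beta> < \<beta>'\<close> form an edge of the polygon with slope \<open>-v(x)\<close>. Conversely, take an edge
whose slope lies in the value group. After rescaling the variable and dividing by a power of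
\<open>\<pi>\<close>, \<open>f\<close> reduces modulo the maximal ideal to a monomial times a binomial of degree \<open>\<beta>' - \<beta>\<close>
whose coefficients are the first digits of \<open>a\<^sub>\<beta>\<^sub>'\<close> and \<open>a\<^sub>\<beta>\<close>. By the hypothesis on the residue
characteristic the nonzero roots of this binomial are simple, and Hensel's lemma matches them
with the roots of \<open>f\<close> of that valuation. Thus the number of roots is a sum over the edges
(\<open>card_nonzero_roots_generic\<close>).

The digits are independent of the valuations. The expected number of roots is therefore the sum,
over all pairs \<open>\<beta> < \<beta>'\<close> of exponents, of \<open>E\<^sub>k(\<beta>' - \<beta>)\<close> times the probability that the pair is an
edge with slope in the value group. The error comes from collinear points only, and is at most a
constant times their probability, since the number of roots is bounded in terms of the exponents
(\<open>expected_roots_approx\<close>).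

As \<open>M\<close> grows, the rescaled valuations become uniformly distributed in the unit cube, and the
residue of a difference of two valuations, in units of \<open>v(\<pi>)\<close>, modulo \<open>\<beta>' - \<beta>\<close> becomes uniform
and independent of the rescaled position. Hence collinear points become negligible, and the
probability attached to \<open>(\<beta>, \<beta>')\<close> tends to the volume of the heights for which the pair is an
edge, divided by \<open>\<beta>' - \<beta>\<close> (\<open>lattice_count_tendsto\<close>). Outside a null set the edges are the pairs
of neighbouring exponents on the lower hull (\<open>consecutive_hull_iff_edge\<close>), so grouping the
heights by their lower hull \<open>B\<close> turns the sum over edges into the sum over \<open>B\<close>
(\<open>edge_sum_lower_hull_average\<close>).\<close>

section \<open>Chords and lower hulls\<close>

text \<open>The affine function through the points over \<open>\<beta>\<close> and \<open>\<gamma>\<close>; it is evaluated also outside the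
interval between them.\<close>

definition chord :: "(int \<Rightarrow> real) \<Rightarrow> int \<Rightarrow> int \<Rightarrow> int \<Rightarrow> real" where
  "chord w \<beta> \<gamma> \<alpha> = w \<beta> + (w \<gamma> - w \<beta>) * (of_int (\<alpha> - \<beta>) / of_int (\<gamma> - \<beta>))"

text \<open>The strict inequality makes this a condition that survives small perturbations of the
heights. Without three collinear points it says that \<open>\<beta>\<close> and \<open>\<beta>'\<close> are neighbouring vertices of
the lower hull.\<close>

definition is_edge :: "int set \<Rightarrow> (int \<Rightarrow> real) \<Rightarrow> int \<Rightarrow> int \<Rightarrow> bool" where
  "is_edge A w \<beta> \<beta>' \<longleftrightarrow> (\<forall>\<alpha>\<in>A - {\<beta>, \<beta>'}. chord w \<beta> \<beta>' \<alpha> < w \<alpha>)"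

text \<open>General position: no three of the points are collinear.\<close>

definition generic :: "int set \<Rightarrow> (int \<Rightarrow> real) \<Rightarrow> bool" where
  "generic A w \<longleftrightarrow> (\<forall>\<beta>\<in>A. \<forall>\<beta>'\<in>A. \<forall>\<alpha>\<in>A - {\<beta>, \<beta>'}. \<beta> \<noteq> \<beta>' \<longrightarrow> chord w \<beta> \<beta>' \<alpha> \<noteq> w \<alpha>)"

definition lower_hull :: "int set \<Rightarrow> (int \<Rightarrow> real) \<Rightarrow> int set" where
  "lower_hull A w = {\<alpha> \<in> A. \<forall>\<beta>\<in>A. \<forall>\<gamma>\<in>A. \<beta> < \<alpha> \<and> \<alpha> < \<gamma> \<longrightarrow> w \<alpha> \<le> chord w \<beta> \<gamma> \<alpha>}"

definition consecutive :: "int set \<Rightarrow> int \<Rightarrow> int \<Rightarrow> bool" where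
  "consecutive B \<beta> \<beta>' \<longleftrightarrow> \<beta> \<in> B \<and> \<beta>' \<in> B \<and> \<beta> < \<beta>' \<and> B \<inter> {\<beta><..<\<beta>'} = {}"

lemma chord_affine: "chord (\<lambda>\<alpha>. a * w \<alpha> + b) \<beta> \<gamma> \<alpha> = a * chord w \<beta> \<gamma> \<alpha> + b"
  by (simp add: chord_def algebra_simps)

lemma chord_add_linear:
  assumes "\<beta> \<noteq> \<gamma>" shows "chord (\<lambda>\<alpha>. w \<alpha> + (s * of_int \<alpha> + t)) \<beta> \<gamma> \<alpha> = chord w \<beta> \<gamma> \<alpha> + (s * of_int \<alpha> + t)"
proof -
  have "of_int (\<gamma> - \<beta>) \<noteq> (0::real)" using assms by simp
  then show ?thesis unfolding chord_def by (simp add: field_simps)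
qed

lemma lower_hull_heights_eq:
  assumes "B \<subseteq> A" shows "lower_hull_heights B A = {w \<in> A \<rightarrow>\<^sub>E UNIV. lower_hull A w = B}"
proof -
  have eq: "w \<beta> * (of_int (\<alpha> - \<gamma>) / of_int (\<beta> - \<gamma>)) + w \<gamma> * (of_int (\<beta> - \<alpha>) / of_int (\<beta> - \<gamma>)) =
      chord w \<beta> \<gamma> \<alpha>"
    if "\<beta> < \<alpha>" "\<alpha> < \<gamma>" for w :: "int \<Rightarrow> real" and \<alpha> \<beta> \<gamma>
  proof -
    have "real_of_int \<beta> - real_of_int \<gamma> \<noteq> 0" "real_of_int \<gamma> - real_of_int \<beta> \<noteq> 0" using that by auto
    then show ?thesis unfolding chord_def of_int_diff by (simp add: divide_simps) (simp add: algebra_simps)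
  qed
  have "lower_hull A w = B \<longleftrightarrow> (\<forall>\<alpha>\<in>A. \<alpha> \<in> B \<longleftrightarrow> (\<forall>\<beta>\<in>A. \<forall>\<gamma>\<in>A. \<beta> < \<alpha> \<and> \<alpha> < \<gamma> \<longrightarrow> w \<alpha> \<le> chord w \<beta> \<gamma> \<alpha>))" for w
    using assms unfolding lower_hull_def by blast
  then show ?thesis unfolding lower_hull_heights_def using eq by auto
qed

text \<open>Both sides are invariant under adding an affine function to the heights, so the chord
through the two points may be taken to be zero. A point below it to the right of \<open>\<beta>'\<close> would push
\<open>\<beta>'\<close> off the hull, a point below it to the left of \<open>\<beta>\<close> would push \<open>\<beta>\<close> off, and the lowest of the
points below it in between would lie on the hull itself. General position excludes further
points on the chord.\<close>

lemma consecutive_hull_iff_edge: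
  assumes fin: "finite A" and gen: "generic A w" and mem: "\<beta> \<in> A" "\<beta>' \<in> A" and less: "\<beta> < \<beta>'"
  shows "consecutive (lower_hull A w) \<beta> \<beta>' \<longleftrightarrow> is_edge A w \<beta> \<beta>'"
proof -
  define s where "s = - (w \<beta>' - w \<beta>) / of_int (\<beta>' - \<beta>)"
  define t where "t = - w \<beta> - s * of_int \<beta>"
  define h where "h \<alpha> = w \<alpha> + (s * of_int \<alpha> + t)" for \<alpha>
  have heq: "h = (\<lambda>\<alpha>. w \<alpha> + (s * of_int \<alpha> + t))" by (rule ext) (rule h_def)
  have pos: "real_of_int \<beta>' - of_int \<beta> > 0" using less by simp
  have h0: "h \<beta> = 0" by (simp add: h_def t_def)
  have "h \<beta>' = w \<beta>' - w \<beta> + s * (of_int \<beta>' - of_int \<beta>)" by (simp add: h_def t_def algebra_simps)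
  then have h0': "h \<beta>' = 0" using pos by (simp add: s_def)
  have tilt: "chord h a c b < h b \<longleftrightarrow> chord w a c b < w b" "h b \<le> chord h a c b \<longleftrightarrow> w b \<le> chord w a c b"
    "chord h a c b = h b \<longleftrightarrow> chord w a c b = w b" if "a \<noteq> c" for a b c
    using chord_add_linear[OF that, of w s t b] unfolding heq by auto
  have chord0: "chord h \<beta> \<beta>' b = 0" for b by (simp add: chord_def h0 h0')
  have edge: "is_edge A w \<beta> \<beta>' \<longleftrightarrow> (\<forall>\<alpha>\<in>A - {\<beta>, \<beta>'}. 0 < h \<alpha>)"
    unfolding is_edge_def using tilt(1)[of \<beta> \<beta>'] less by (auto simp: chord0)
  have lhull: "lower_hull A w = {\<alpha> \<in> A. \<forall>\<beta>\<in>A. \<forall>\<gamma>\<in>A. \<beta> < \<alpha> \<and> \<alpha> < \<gamma> \<longrightarrow> h \<alpha> \<le> chord h \<beta> \<gamma> \<alpha>}"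
    unfolding lower_hull_def using tilt(2) by auto
  have ne: "h \<alpha> \<noteq> 0" if "\<alpha> \<in> A - {\<beta>, \<beta>'}" for \<alpha>
    using gen mem that less tilt(3)[of \<beta> \<beta>' \<alpha>] unfolding generic_def by (auto simp: chord0)
  have conv: "chord h a c b = h a * ((of_int c - of_int b) / (of_int c - of_int a)) + h c * ((of_int b -
      of_int a) / (of_int c - of_int a))"
     "(of_int c - of_int b) / (of_int c - of_int a) > (0::real)"
         "(of_int b - of_int a) / (of_int c - of_int a) > (0::real)"
     "(of_int c - of_int b) / (of_int c - of_int a) + (of_int b - of_int a) / (of_int c - of_int a) =
         (1::real)"
    if "a < b" "b < c" for a b c
  proof -
    let ?p = "(of_int c - of_int b) / (of_int c - of_int a) :: real" and ?q =
        "(of_int b - of_int a) / (of_int c - of_int a) :: real"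
    have d: "real_of_int c - of_int a > 0" using that by simp
    show "?p > 0" "?q > 0" using that by auto
    show sum: "?p + ?q = 1" using d by (simp add: add_divide_distrib[symmetric])
    have p: "?p = 1 - ?q" using sum by linarith
    have "x + (y - x) * q = x * (1 - q) + y * q" for x y q :: real by (simp add: algebra_simps)
    then show "chord h a c b = h a * ?p + h c * ?q" unfolding p chord_def of_int_diff .
  qed
  show ?thesis
  proof
    assume e: "is_edge A w \<beta> \<beta>'"
    have nonneg: "h \<alpha> \<ge> 0" if "\<alpha> \<in> A" for \<alpha> using e that h0 h0' unfolding edge
      by (cases "\<alpha> = \<beta> \<or> \<alpha> = \<beta>'") (auto simp: less_imp_le)
    have low: "\<alpha> \<in> lower_hull A w" if "\<alpha> \<in> A" "h \<alpha> = 0" for \<alpha>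
      unfolding lhull using that nonneg conv
          by (auto intro!: add_nonneg_nonneg mult_nonneg_nonneg simp: less_imp_le)
    have "\<alpha> \<notin> lower_hull A w" if "\<beta> < \<alpha>" "\<alpha> < \<beta>'" for \<alpha>
      using e that mem unfolding lhull edge by (force simp: chord0)
    then show "consecutive (lower_hull A w) \<beta> \<beta>'"
      unfolding consecutive_def using low mem h0 h0' less by auto
  next
    assume c: "consecutive (lower_hull A w) \<beta> \<beta>'"
    have right: "h \<alpha> \<ge> 0" if "\<alpha> \<in> A" "\<beta>' < \<alpha>" for \<alpha>
    proof -
      have "h \<beta>' \<le> chord h \<beta> \<alpha> \<beta>'" using c that mem less unfolding consecutive_def lhull by blast
      then show ?thesis using conv(3)[OF less that(2)]
        unfolding conv(1)[OF less that(2)] h0 h0' mult_zero_left add_0_left zero_le_mult_iff by linarith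
    qed
    have left: "h \<alpha> \<ge> 0" if "\<alpha> \<in> A" "\<alpha> < \<beta>" for \<alpha>
    proof -
      have "h \<beta> \<le> chord h \<alpha> \<beta>' \<beta>" using c that mem less unfolding consecutive_def lhull by blast
      then show ?thesis using conv(2)[OF that(2) less]
        unfolding conv(1)[OF that(2) less] h0 h0' mult_zero_left add_0_right zero_le_mult_iff by linarith
    qed
    have mid: "h \<alpha> \<ge> 0" if "\<alpha> \<in> A" "\<beta> < \<alpha>" "\<alpha> < \<beta>'" for \<alpha>
    proof (rule ccontr)
      assume neg: "\<not> h \<alpha> \<ge> 0"
      define S where "S = A \<inter> {\<beta><..<\<beta>'}"
      have S: "finite S" "\<alpha> \<in> S" using fin that by (auto simp: S_def)
      have "Min (h ` S) \<in> h ` S" using S by (intro Min_in) auto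
      then obtain \<mu> where \<mu>: "\<mu> \<in> S" "h \<mu> = Min (h ` S)" by auto
      have min: "h \<mu> \<le> h a" if "a \<in> S" for a using S that \<mu>(2) by simp
      have neg\<mu>: "h \<mu> < 0" using min[OF S(2)] neg by simp
      have all: "h \<mu> \<le> h a" if "a \<in> A" for a
      proof (cases "a \<in> S")
        case False
        then have "a \<le> \<beta> \<or> \<beta>' \<le> a" using that by (auto simp: S_def)
        then have "h a \<ge> 0" using left right h0 h0' that by (metis order.order_iff_strict order_refl)
        then show ?thesis using neg\<mu> by simp
      qed (rule min)
      have "h \<mu> \<le> chord h a c \<mu>" if "a \<in> A" "c \<in> A" "a < \<mu>" "\<mu> < c" for a c
      proof -
        let ?p = "(of_int c - of_int \<mu>) / (of_int c - of_int a) :: real" and ?q =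
            "(of_int \<mu> - of_int a) / (of_int c - of_int a) :: real"
        have "h \<mu> * ?p \<le> h a * ?p" "h \<mu> * ?q \<le> h c * ?q"
          using mult_right_mono[OF all[OF that(1)] less_imp_le[OF conv(2)[OF that(3,4)]]]
            mult_right_mono[OF all[OF that(2)] less_imp_le[OF conv(3)[OF that(3,4)]]] by auto
        moreover have "h \<mu> * ?p + h \<mu> * ?q = h \<mu>"
          using conv(4)[OF that(3,4)] by (metis distrib_left mult.right_neutral)
        ultimately show ?thesis using conv(1)[OF that(3,4)] by linarith
      qed
      then have "\<mu> \<in> lower_hull A w" unfolding lhull using \<mu>(1) by (auto simp: S_def)
      then show False using c \<mu>(1) by (auto simp: consecutive_def S_def)
    qed
    show "is_edge A w \<beta> \<beta>'"
      unfolding edge using left right mid ne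
          by (metis Diff_iff insertCI linorder_neqE order.not_eq_order_implies_strict)
  qed
qed

lemma sum_sorted_list_consecutive:
  fixes g :: "int \<Rightarrow> int \<Rightarrow> real"
  assumes "finite B"
  shows "(\<Sum>i<card B - 1. g (sorted_list_of_set B ! i) (sorted_list_of_set B ! (i + 1))) =
    (\<Sum>(\<beta>, \<beta>') \<in> {(\<beta>, \<beta>'). consecutive B \<beta> \<beta>'}. g \<beta> \<beta>')"
proof -
  define l where "l = sorted_list_of_set B"
  have l: "sorted_wrt (<) l" "set l = B" "length l = card B" using assms by (simp_all add: l_def)
  have mono: "l ! i < l ! j \<longleftrightarrow> i < j" if "i < length l" "j < length l" for i j
    using sorted_wrt_nth_less[OF l(1)] that
        by (metis linorder_neqE_nat order_less_imp_not_less order_less_irrefl)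
  have "bij_betw (\<lambda>i. (l ! i, l ! (i + 1))) {..<card B - 1} {(\<beta>, \<beta>'). consecutive B \<beta> \<beta>'}"
    unfolding bij_betw_def
  proof
    show "inj_on (\<lambda>i. (l ! i, l ! (i + 1))) {..<card B - 1}"
      using mono l(3) by (intro inj_onI) (metis Pair_inject diff_le_self lessThan_iff linorder_neqE_nat
          order_less_irrefl order_less_le_trans)
    show "(\<lambda>i. (l ! i, l ! (i + 1))) ` {..<card B - 1} = {(\<beta>, \<beta>'). consecutive B \<beta> \<beta>'}"
    proof (intro equalityI subsetI; clarify)
      fix i assume i: "i < card B - 1"
      have "b \<notin> {l ! i<..<l ! (i + 1)}" if "b \<in> B" for b
      proof -
        obtain j where j: "j < length l" "b = l ! j" using \<open>b \<in> B\<close> l(2) by (metis in_set_conv_nth)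
        then show ?thesis using mono[of i j] mono[of j "i + 1"] i l(3) by auto
      qed
      then show "consecutive B (l ! i) (l ! (i + 1))"
        unfolding consecutive_def using i l mono[of i "i + 1"] nth_mem[of i l] nth_mem[of "i+1" l] by auto
    next
      fix \<beta> \<beta>' assume c: "consecutive B \<beta> \<beta>'"
      then obtain i j where ij: "i < length l" "j < length l" "\<beta> = l ! i" "\<beta>' = l ! j"
        unfolding consecutive_def l(2)[symmetric] by (metis in_set_conv_nth)
      have "i < j" using c ij mono by (simp add: consecutive_def)
      moreover have "\<not> i + 1 < j"
      proof
        assume "i + 1 < j"
        then have "l ! (i + 1) \<in> B \<inter> {\<beta><..<\<beta>'}" using ij mono[of i "i+1"] mono[of "i+1" j] nth_mem[of
            "i+1" l] l(2) by auto
        then show False using c by (auto simp: consecutive_def)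
      qed
      ultimately have "j = i + 1" by simp
      then show "(\<beta>, \<beta>') \<in> (\<lambda>i. (l ! i, l ! (i + 1))) ` {..<card B - 1}" using ij l(3) by auto
    qed
  qed
  from sum.reindex_bij_betw[OF this, of "\<lambda>(\<beta>, \<beta>'). g \<beta> \<beta>'"] show ?thesis by (simp add: l_def)
qed

section \<open>General position is stable and has full measure\<close>

lemma tendsto_chord:
  assumes "((\<lambda>n. X n \<beta>) \<longlongrightarrow> u \<beta>) F" "((\<lambda>n. X n \<gamma>) \<longlongrightarrow> u \<gamma>) F"
  shows "((\<lambda>n. chord (X n) \<beta> \<gamma> \<alpha>) \<longlongrightarrow> chord u \<beta> \<gamma> \<alpha>) F"
  unfolding chord_def by (intro tendsto_intros assms)

lemma eventually_generic:
  assumes fin: "finite A" and gen: "generic A u" and X: "\<And>\<alpha>. \<alpha> \<in> A \<Longrightarrow> ((\<lambda>n. X n \<alpha>) \<longlongrightarrow> u \<alpha>) F"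
  shows "eventually (\<lambda>n. generic A (X n)) F"
  unfolding generic_def
proof (intro eventually_ball_finite fin finite_Diff ballI)
  fix \<beta> \<beta>' \<alpha> assume mem: "\<beta> \<in> A" "\<beta>' \<in> A" "\<alpha> \<in> A - {\<beta>, \<beta>'}"
  show "eventually (\<lambda>n. \<beta> \<noteq> \<beta>' \<longrightarrow> chord (X n) \<beta> \<beta>' \<alpha> \<noteq> X n \<alpha>) F"
  proof (cases "\<beta> = \<beta>'")
    case False
    have "((\<lambda>n. chord (X n) \<beta> \<beta>' \<alpha> - X n \<alpha>) \<longlongrightarrow> chord u \<beta> \<beta>' \<alpha> - u \<alpha>) F"
      using mem by (intro tendsto_diff tendsto_chord X) auto
    moreover have "chord u \<beta> \<beta>' \<alpha> - u \<alpha> \<noteq> 0" using gen mem False by (auto simp: generic_def)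
    ultimately have "eventually (\<lambda>n. chord (X n) \<beta> \<beta>' \<alpha> - X n \<alpha> \<noteq> 0) F"
      by (rule tendsto_imp_eventually_ne)
    then show ?thesis by eventually_elim simp
  qed simp
qed

text \<open>In general position every comparison of a height with a chord is strict, and there are
finitely many of them.\<close>

lemma eventually_is_edge:
  assumes fin: "finite A" and gen: "generic A u" and X: "\<And>\<alpha>. \<alpha> \<in> A \<Longrightarrow> ((\<lambda>n. X n \<alpha>) \<longlongrightarrow> u \<alpha>) F"
    and mem: "\<beta> \<in> A" "\<beta>' \<in> A" "\<beta> \<noteq> \<beta>'"
  shows "eventually (\<lambda>n. is_edge A (X n) \<beta> \<beta>' \<longleftrightarrow> is_edge A u \<beta> \<beta>') F"
proof -
  have "eventually (\<lambda>n. \<forall>\<alpha>\<in>A - {\<beta>, \<beta>'}. chord (X n) \<beta> \<beta>' \<alpha> < X n \<alpha> \<longleftrightarrow> chord u \<beta> \<beta>' \<alpha> < u \<alpha>) F"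
  proof (intro eventually_ball_finite finite_Diff fin ballI)
    fix \<alpha> assume \<alpha>: "\<alpha> \<in> A - {\<beta>, \<beta>'}"
    have lim: "((\<lambda>n. chord (X n) \<beta> \<beta>' \<alpha> - X n \<alpha>) \<longlongrightarrow> chord u \<beta> \<beta>' \<alpha> - u \<alpha>) F"
      using mem \<alpha> by (intro tendsto_diff tendsto_chord X) auto
    have "chord u \<beta> \<beta>' \<alpha> \<noteq> u \<alpha>" using gen mem \<alpha> by (auto simp: generic_def)
    then consider "chord u \<beta> \<beta>' \<alpha> - u \<alpha> < 0" | "chord u \<beta> \<beta>' \<alpha> - u \<alpha> > 0" by linarith
    then show "eventually (\<lambda>n. chord (X n) \<beta> \<beta>' \<alpha> < X n \<alpha> \<longleftrightarrow> chord u \<beta> \<beta>' \<alpha> < u \<alpha>) F"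
    proof cases
      case 1
      from order_tendstoD(2)[OF lim 1] show ?thesis by eventually_elim (use 1 in simp)
    next
      case 2
      from order_tendstoD(1)[OF lim 2] show ?thesis by eventually_elim (use 2 in simp)
    qed
  qed
  then show ?thesis by eventually_elim (simp add: is_edge_def)
qed

lemma is_edge_affine: "a > 0 \<Longrightarrow> is_edge A (\<lambda>\<alpha>. a * w \<alpha> + b) \<beta> \<beta>' \<longleftrightarrow> is_edge A w \<beta> \<beta>'"
  by (simp add: is_edge_def chord_affine)

lemma generic_affine: "a > 0 \<Longrightarrow> generic A (\<lambda>\<alpha>. a * w \<alpha> + b) \<longleftrightarrow> generic A w"
  by (simp add: generic_def chord_affine)

lemma is_edge_cong:
  "\<beta> \<in> A \<Longrightarrow> \<beta>' \<in> A \<Longrightarrow> (\<And>\<alpha>. \<alpha> \<in> A \<Longrightarrow> w \<alpha> = w' \<alpha>) \<Longrightarrow> is_edge A w \<beta> \<beta>' \<longleftrightarrow> is_edge A w' \<beta> \<beta>'"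
  by (simp add: is_edge_def chord_def)

lemma generic_cong: "(\<And>\<alpha>. \<alpha> \<in> A \<Longrightarrow> w \<alpha> = w' \<alpha>) \<Longrightarrow> generic A w \<longleftrightarrow> generic A w'"
  by (simp add: generic_def chord_def)

abbreviation lebesgue_on_heights :: "int set \<Rightarrow> (int \<Rightarrow> real) measure" where
  "lebesgue_on_heights A \<equiv> \<Pi>\<^sub>M \<alpha>\<in>A. lborel"

interpretation lborel_heights: product_sigma_finite "\<lambda>_::int. lborel :: real measure"
  by standard

text \<open>By Fubini: once the other coordinates are chosen, one value of the coordinate \<open>\<alpha>\<close> is
excluded.\<close>

lemma AE_height_ne:
  assumes fin: "finite A" and \<alpha>: "\<alpha> \<in> A" and f: "f \<in> borel_measurable (lebesgue_on_heights A)"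
    and indep: "\<And>u x. f (u(\<alpha> := x)) = f u"
  shows "AE u in lebesgue_on_heights A. u \<alpha> \<noteq> f u"
proof -
  define J where "J = A - {\<alpha>}"
  have J: "finite J" "\<alpha> \<notin> J" "A = insert \<alpha> J" using fin \<alpha> by (auto simp: J_def)
  let ?Z = "{u \<in> space (lebesgue_on_heights A). u \<alpha> = f u}"
  have Z: "?Z \<in> sets (lebesgue_on_heights A)" using \<alpha> f by measurable
  have ZJ: "indicator ?Z \<in> borel_measurable (lebesgue_on_heights (insert \<alpha> J))"
    using Z unfolding J(3) by (rule borel_measurable_indicator)
  have "emeasure (lebesgue_on_heights A) ?Z = (\<integral>\<^sup>+u. indicator ?Z u \<partial>lebesgue_on_heights A)"
    using Z by simp
  also have "\<dots> = (\<integral>\<^sup>+u. (\<integral>\<^sup>+x. indicator ?Z (u(\<alpha> := x)) \<partial>lborel) \<partial>lebesgue_on_heights J)"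
    unfolding J(3) using lborel_heights.product_nn_integral_insert[OF J(1,2) ZJ] J(3) by simp
  also have "\<dots> = (\<integral>\<^sup>+u. 0 \<partial>lebesgue_on_heights J)"
  proof (rule nn_integral_cong)
    fix u assume "u \<in> space (lebesgue_on_heights J)"
    have "(\<integral>\<^sup>+x. indicator ?Z (u(\<alpha> := x)) \<partial>lborel) \<le> (\<integral>\<^sup>+x. indicator {f u} x \<partial>lborel)"
      by (intro nn_integral_mono) (auto simp: indep split: split_indicator)
    also have "\<dots> = 0" by simp
    finally show "(\<integral>\<^sup>+x. indicator ?Z (u(\<alpha> := x)) \<partial>lborel) = 0" by simp
  qed
  finally have "emeasure (lebesgue_on_heights A) ?Z = 0" by simp
  then show ?thesis using Z by (intro AE_I[where N = ?Z]) auto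
qed

lemma measurable_chord [measurable]:
  assumes "\<beta> \<in> A" "\<gamma> \<in> A"
  shows "(\<lambda>w. chord w \<beta> \<gamma> \<alpha>) \<in> borel_measurable (lebesgue_on_heights A)"
  unfolding chord_def using assms by measurable

lemma AE_generic:
  assumes fin: "finite A"
  shows "AE u in lebesgue_on_heights A. generic A u"
proof -
  have "AE u in lebesgue_on_heights A. \<beta> \<noteq> \<beta>' \<longrightarrow> chord u \<beta> \<beta>' \<alpha> \<noteq> u \<alpha>"
    if "\<beta> \<in> A" "\<beta>' \<in> A" "\<alpha> \<in> A - {\<beta>, \<beta>'}" for \<beta> \<beta>' \<alpha>
  proof -
    have "AE u in lebesgue_on_heights A. u \<alpha> \<noteq> chord u \<beta> \<beta>' \<alpha>"
      using that by (intro AE_height_ne fin measurable_chord) (auto simp: chord_def)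
    then show ?thesis by eventually_elim simp
  qed
  then show ?thesis unfolding generic_def
    by (intro AE_finite_allI fin finite_Diff)
qed

lemma AE_not_boundary:
  assumes fin: "finite A"
  shows "AE u in lebesgue_on_heights A. \<forall>\<alpha>\<in>A. u \<alpha> \<noteq> c"
  by (intro AE_finite_allI fin AE_height_ne) auto

section \<open>Equidistribution of lattice heights\<close>

definition height_box :: "int set \<Rightarrow> nat \<Rightarrow> (int \<Rightarrow> int) set" where
  "height_box A N = A \<rightarrow>\<^sub>E {- int N..int N}"

lemma finite_height_box: "finite A \<Longrightarrow> finite (height_box A N)"
  unfolding height_box_def by (intro finite_PiE) auto

text \<open>Rescale the box of integral height vectors to the unit cube and attach to each admissible
vector \<open>n\<close> a cell with lower corner at the rescaled \<open>n\<close>, of side \<open>1 / K\<close> in all directions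
except \<open>\<beta>\<close>, where the side is \<open>\<gamma> / K\<close>. Because the congruence selects one residue class for the
coordinate \<open>\<beta>\<close>, these cells are disjoint and tile the cube up to a neighbourhood of its boundary
that shrinks with \<open>N\<close>, so \<open>\<gamma>\<close> times the number of admissible vectors is, after scaling, the
volume of the union of their cells. The indicator functions of these unions converge almost
everywhere to that of \<open>Q\<close> in the cube, since \<open>Q\<close> is locally constant in general position, and
dominated convergence applies.\<close>

lemma lattice_count_tendsto:
  fixes \<gamma> :: int
  assumes fin: "finite A" and mem: "\<beta> \<in> A" "\<beta>' \<in> A" and ne: "\<beta> \<noteq> \<beta>'" and \<gamma>: "\<gamma> \<ge> 1"
    and meas: "Measurable.pred (lebesgue_on_heights A) Q"
    and affine: "\<And>w a b. a > 0 \<Longrightarrow> Q (\<lambda>\<alpha>. a * w \<alpha> + b) \<longleftrightarrow> Q w"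
    and cong: "\<And>w w'. (\<And>\<alpha>. \<alpha> \<in> A \<Longrightarrow> w \<alpha> = w' \<alpha>) \<Longrightarrow> Q w \<longleftrightarrow> Q w'"
    and loc: "\<And>u X. generic A u \<Longrightarrow> (\<And>\<alpha>. \<alpha> \<in> A \<Longrightarrow> ((\<lambda>N. X N \<alpha>) \<longlonglongrightarrow> u \<alpha>)) \<Longrightarrow>
        eventually (\<lambda>N. Q (X N) \<longleftrightarrow> Q u) sequentially"
  shows "(\<lambda>N. real (card {n \<in> height_box A N. Q (\<lambda>\<alpha>. of_int (n \<alpha>)) \<and>
      \<gamma> dvd n \<beta>' - n \<beta>}) / (2 * real N + 1) ^ card A)
     \<longlonglongrightarrow> measure (lebesgue_on_heights A) {w \<in> A \<rightarrow>\<^sub>E {0..1}. Q w} / of_int \<gamma>"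
proof -
  let ?L = "lebesgue_on_heights A"
  define K where "K N = 2 * real N + 1" for N
  have K: "K N > 0" for N by (simp add: K_def)
  define width where "width \<alpha> = (if \<alpha> = \<beta> then \<gamma> else 1)" for \<alpha>
  have width: "1 \<le> width \<alpha>" "width \<alpha> \<le> \<gamma>" for \<alpha> using \<gamma> by (auto simp: width_def)
  define S where "S N = {n \<in> height_box A N. Q (\<lambda>\<alpha>. of_int (n \<alpha>)) \<and> \<gamma> dvd n \<beta>' - n \<beta>}" for N
  have finS: "finite (S N)" for N unfolding S_def using finite_height_box[OF fin] by simp
  define cell where "cell N n = (\<Pi>\<^sub>E \<alpha>\<in>A. {(of_int (n \<alpha>) + real N) / K N ..< (of_int (n \<alpha>) + real N +
      of_int (width \<alpha>)) / K N})"
    for N and n :: "int \<Rightarrow> int"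
  define pos where "pos N u \<alpha> = \<lfloor>u \<alpha> * K N\<rfloor> - int N" for N u and \<alpha> :: int
  \<comment> \<open>The lower corner of the cell that contains \<open>u\<close>, before rescaling by \<open>X\<close>.\<close>
  define corner where "corner N u \<alpha> =
      (if \<alpha> \<in> A then if \<alpha> =
          \<beta> then pos N u \<beta> - (pos N u \<beta> - pos N u \<beta>') mod \<gamma> else pos N u \<alpha> else undefined)" for N u \<alpha>
  define X where "X N u \<alpha> = (of_int (corner N u \<alpha>) + real N) / K N" for N u \<alpha>
  have corner_dvd: "\<gamma> dvd corner N u \<beta>' - corner N u \<beta>" for N u
  proof -
    have "corner N u \<beta>' - corner N u \<beta> = - ((pos N u \<beta> - pos N u \<beta>') - (pos N u \<beta> - pos N u \<beta>') mod \<gamma>)"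
      using mem ne by (simp add: corner_def)
    then show ?thesis by (simp only: dvd_minus_iff dvd_minus_mod)
  qed
  have corner_bounds: "corner N u \<alpha> \<le> pos N u \<alpha>" "pos N u \<alpha> < corner N u \<alpha> + width \<alpha>" if "\<alpha> \<in> A" for N u \<alpha>
    using that \<gamma> pos_mod_bound[of \<gamma> "pos N u \<beta> - pos N u \<beta>'"] pos_mod_sign[of \<gamma> "pos N u \<beta> - pos N u \<beta>'"]
    by (auto simp: corner_def width_def)
  have cell_iff: "u \<in> cell N n \<longleftrightarrow> u \<in> A \<rightarrow>\<^sub>E UNIV \<and> (\<forall>\<alpha>\<in>A. n \<alpha> \<le> pos N u \<alpha> \<and> pos N u \<alpha> < n \<alpha> + width \<alpha>)"
      for u N n
  proof -
    have "(of_int (n \<alpha>) + real N) / K N \<le> u \<alpha> \<and> u \<alpha> < (of_int (n \<alpha>) + real N + of_int (width \<alpha>)) / K N \<longleftrightarrow>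
      n \<alpha> \<le> pos N u \<alpha> \<and> pos N u \<alpha> < n \<alpha> + width \<alpha>" for \<alpha>
    proof -
      have "(of_int (n \<alpha>) + real N) / K N \<le> u \<alpha> \<longleftrightarrow> of_int (n \<alpha> + int N) \<le> u \<alpha> * K N"
        using K[of N] by (simp add: field_simps)
      also have "\<dots> \<longleftrightarrow> n \<alpha> \<le> pos N u \<alpha>" unfolding pos_def le_floor_iff[symmetric] by linarith
      moreover have "u \<alpha> < (of_int (n \<alpha>) + real N + of_int (width \<alpha>)) / K N \<longleftrightarrow>
          u \<alpha> * K N < of_int (n \<alpha> + int N + width \<alpha>)"
        using K[of N] by (simp add: field_simps)
      moreover have "\<dots> \<longleftrightarrow> pos N u \<alpha> < n \<alpha> + width \<alpha>" unfolding pos_def floor_less_iff[symmetric] by linarith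
      ultimately show ?thesis by simp
    qed
    then show ?thesis unfolding cell_def PiE_iff by auto
  qed
  have in_cell: "u \<in> cell N n \<longleftrightarrow> n = corner N u"
    if u: "u \<in> A \<rightarrow>\<^sub>E UNIV" and n: "n \<in> extensional A" "\<gamma> dvd n \<beta>' - n \<beta>" for u N n
  proof
    assume "n = corner N u"
    then show "u \<in> cell N n" using cell_iff u corner_bounds by blast
  next
    assume "u \<in> cell N n"
    then have b: "n \<alpha> \<le> pos N u \<alpha>" "pos N u \<alpha> < n \<alpha> + width \<alpha>" if "\<alpha> \<in> A" for \<alpha>
      using cell_iff that by blast+
    show "n = corner N u"
    proof
      fix \<alpha>
      consider "\<alpha> \<notin> A" | "\<alpha> \<in> A" "\<alpha> \<noteq> \<beta>" | "\<alpha> = \<beta>" by blast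
      then show "n \<alpha> = corner N u \<alpha>"
      proof cases
        case 1
        then show ?thesis using n(1) by (simp add: corner_def extensional_def)
      next
        case 2
        then show ?thesis using b[of \<alpha>] by (simp add: corner_def width_def)
      next
        case 3
        have n': "n \<beta>' = pos N u \<beta>'" using b[of \<beta>'] mem ne by (simp add: width_def)
        have r: "0 \<le> pos N u \<beta> - n \<beta>" "pos N u \<beta> - n \<beta> < \<gamma>" using b[of \<beta>] mem by (auto simp: width_def)
        have "(pos N u \<beta> - pos N u \<beta>') mod \<gamma> = (pos N u \<beta> - n \<beta>) mod \<gamma>"
          unfolding mod_eq_dvd_iff using n(2) by (simp add: n' dvd_diff_commute)
        also have "\<dots> = pos N u \<beta> - n \<beta>" using r by (rule mod_pos_pos_trivial)
        finally show ?thesis using 3 mem by (simp add: corner_def)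
      qed
    qed
  qed
  \<comment> \<open>The indicator function of the union of the cells; its integral is the scaled count.\<close>
  define F where "F N u = (\<Sum>n\<in>S N. indicator (cell N n) u :: real)" for N u
  have F_eq: "F N u = (if corner N u \<in> S N then 1 else 0)" if "u \<in> A \<rightarrow>\<^sub>E UNIV" for N u
  proof -
    have "F N u = (\<Sum>n\<in>S N. if n = corner N u then 1 else 0)"
      unfolding F_def
    proof (rule sum.cong[OF refl])
      fix n assume "n \<in> S N"
      then have "n \<in> extensional A" "\<gamma> dvd n \<beta>' - n \<beta>" by (auto simp: S_def height_box_def PiE_def)
      from in_cell[OF that this, of N] show
          "indicator (cell N n) u = (if n = corner N u then 1 else 0 :: real)"
        by (auto simp: indicator_def)
    qed
    then show ?thesis using finS by simp
  qed
  have X_bounds: "X N u \<alpha> \<le> u \<alpha>" "u \<alpha> < X N u \<alpha> + of_int \<gamma> / K N" if "\<alpha> \<in> A" for N u \<alpha>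
  proof -
    have "corner N u \<alpha> + int N \<le> \<lfloor>u \<alpha> * K N\<rfloor>" using corner_bounds(1)[OF that, of N u] by (simp add: pos_def)
    then have "of_int (corner N u \<alpha>) + real N \<le> u \<alpha> * K N" unfolding le_floor_iff by simp
    then show "X N u \<alpha> \<le> u \<alpha>" using K[of N] by (simp add: X_def field_simps)
    have "\<lfloor>u \<alpha> * K N\<rfloor> + 1 \<le> corner N u \<alpha> + int N + \<gamma>"
      using corner_bounds(2)[OF that, of N u] width(2)[of \<alpha>] by (simp add: pos_def)
    then have "u \<alpha> * K N < of_int (corner N u \<alpha> + int N + \<gamma>)" by linarith
    then show "u \<alpha> < X N u \<alpha> + of_int \<gamma> / K N" using K[of N] by (simp add: X_def field_simps)
  qed
  have inS: "corner N u \<in> S N \<longleftrightarrow> (\<forall>\<alpha>\<in>A. 0 \<le> X N u \<alpha> \<and> X N u \<alpha> < 1) \<and> Q (X N u)" for N u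
  proof -
    have "0 \<le> X N u \<alpha> \<and> X N u \<alpha> < 1 \<longleftrightarrow> corner N u \<alpha> \<in> {- int N..int N}" for \<alpha>
    proof -
      have "0 \<le> X N u \<alpha> \<longleftrightarrow> 0 \<le> real_of_int (corner N u \<alpha> + int N)" using K[of N]
          by (simp add: X_def zero_le_divide_iff)
      moreover have "X N u \<alpha> < 1 \<longleftrightarrow> real_of_int (corner N u \<alpha> + int N) < of_int (2 * int N + 1)"
        using K[of N] by (simp add: X_def K_def)
      ultimately show ?thesis unfolding of_int_0_le_iff of_int_less_iff by auto
    qed
    then have box: "corner N u \<in> height_box A N \<longleftrightarrow> (\<forall>\<alpha>\<in>A. 0 \<le> X N u \<alpha> \<and> X N u \<alpha> < 1)"
      by (auto simp: height_box_def PiE_iff corner_def extensional_def)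
    have "Q (X N u) \<longleftrightarrow> Q (\<lambda>\<alpha>. of_int (corner N u \<alpha>))"
      using affine[of "1 / K N" "\<lambda>\<alpha>. of_int (corner N u \<alpha>)" "real N / K N"] K[of N]
      by (simp add: X_def[abs_def] add_divide_distrib)
    then show ?thesis unfolding S_def using box corner_dvd[of N u] by simp
  qed
  have X_lim: "(\<lambda>N. X N u \<alpha>) \<longlonglongrightarrow> u \<alpha>" if "\<alpha> \<in> A" for u \<alpha>
  proof (rule tendsto_sandwich[where f = "\<lambda>N. u \<alpha> - of_int \<gamma> / K N" and h = "\<lambda>_. u \<alpha>"])
    have "(\<lambda>N. of_int \<gamma> / K N) \<longlonglongrightarrow> 0" unfolding K_def by real_asymp
    then show "(\<lambda>N. u \<alpha> - of_int \<gamma> / K N) \<longlonglongrightarrow> u \<alpha>" using tendsto_diff[OF tendsto_const] by fastforce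
    show "eventually (\<lambda>N. u \<alpha> - of_int \<gamma> / K N \<le> X N u \<alpha>) sequentially"
      using X_bounds(2)[OF that, of u] by (auto simp: algebra_simps intro!: always_eventually less_imp_le)
    show "eventually (\<lambda>N. X N u \<alpha> \<le> u \<alpha>) sequentially"
      using X_bounds(1)[OF that, of _ u] by simp
  qed simp
  let ?T = "{w \<in> A \<rightarrow>\<^sub>E {0..1}. Q w}"
  have spaceL: "space ?L = A \<rightarrow>\<^sub>E UNIV" by (simp add: space_PiM)
  have Tset: "?T \<in> sets ?L"
  proof -
    have "?T = {w \<in> space ?L. Q w} \<inter> (A \<rightarrow>\<^sub>E {0..1})" unfolding spaceL
        by (auto simp: PiE_iff extensional_def)
    also have "\<dots> \<in> sets ?L" using meas fin by (intro sets.Int sets_PiM_I_finite) auto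
    finally show ?thesis .
  qed
  have cellset: "cell N n \<in> sets ?L" for N n unfolding cell_def using fin by (intro sets_PiM_I_finite) auto
  have cellmeas: "emeasure ?L (cell N n) = ennreal (of_int \<gamma> / K N ^ card A)" for N n
  proof -
    have "emeasure ?L (cell N n) = (\<Prod>\<alpha>\<in>A. ennreal (of_int (width \<alpha>) / K N))"
      unfolding cell_def
    proof (subst lborel_heights.emeasure_PiM[OF fin])
      show "(\<Prod>\<alpha>\<in>A. emeasure lborel {(of_int (n \<alpha>) + real N) / K N ..< (of_int (n \<alpha>) + real N + of_int
          (width \<alpha>)) / K N}) =
          (\<Prod>\<alpha>\<in>A. ennreal (of_int (width \<alpha>) / K N))"
      proof (rule prod.cong[OF refl])
        fix \<alpha>
        have "(of_int (n \<alpha>) + real N) / K N \<le> (of_int (n \<alpha>) + real N + of_int (width \<alpha>)) / K N"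
          using K[of N] width(1)[of \<alpha>] by (intro divide_right_mono) auto
        then show "emeasure lborel {(of_int (n \<alpha>) + real N) / K N ..< (of_int (n \<alpha>) + real N + of_int
            (width \<alpha>)) / K N} =
            ennreal (of_int (width \<alpha>) / K N)"
          by (simp add: diff_divide_distrib[symmetric])
      qed
    qed auto
    also have "\<dots> = ennreal (\<Prod>\<alpha>\<in>A. of_int (width \<alpha>) / K N)"
      using K[of N] width(1) by (intro prod_ennreal) (simp add: order_trans[of 0 1])
    also have "(\<Prod>\<alpha>\<in>A. of_int (width \<alpha>) / K N) = of_int \<gamma> / K N ^ card A"
    proof -
      have "(\<Prod>\<alpha>\<in>A. real_of_int (width \<alpha>)) = (\<Prod>\<alpha>\<in>A. if \<alpha> = \<beta> then of_int \<gamma> else 1)"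
        by (intro prod.cong) (auto simp: width_def)
      also have "\<dots> = of_int \<gamma>" using fin mem by simp
      finally show ?thesis by (simp add: prod_dividef)
    qed
    finally show ?thesis .
  qed
  have cellfin: "emeasure ?L (cell N n) < \<infinity>" for N n unfolding cellmeas by simp
  have intF: "(\<integral>u. F N u \<partial>?L) = of_int \<gamma> * (real (card (S N)) / K N ^ card A)" for N
  proof -
    have "(\<integral>u. F N u \<partial>?L) = (\<Sum>n\<in>S N. measure ?L (cell N n))"
      unfolding F_def using cellset cellfin
      by (subst Bochner_Integration.integral_sum) (auto intro!: integrable_real_indicator sum.cong)
    also have "\<dots> = (\<Sum>n\<in>S N. of_int \<gamma> / K N ^ card A)"
      using K[of N] \<gamma> by (intro sum.cong refl) (simp add: measure_def cellmeas enn2real_ennreal)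
    finally show ?thesis by simp
  qed
  have lim: "(\<lambda>N. \<integral>u. F N u \<partial>?L) \<longlonglongrightarrow> (\<integral>u. indicator ?T u \<partial>?L)"
  proof (rule integral_dominated_convergence)
    \<comment> \<open>A cell may stick out of the unit cube in the direction \<open>\<beta>\<close>, by less than \<open>\<gamma> / K N\<close>.\<close>
    let ?W = "A \<rightarrow>\<^sub>E {0..1 + of_int \<gamma> :: real}"
    show "(\<lambda>u. indicator ?T u :: real) \<in> borel_measurable ?L" using Tset by simp
    show "F N \<in> borel_measurable ?L" for N unfolding F_def[abs_def] using cellset by measurable
    have "emeasure ?L ?W < \<infinity>"
      using fin \<gamma> by (subst lborel_heights.emeasure_PiM) (auto simp: power_eq_top_ennreal
          less_top[symmetric])
    then show "integrable ?L (\<lambda>u. indicator ?W u :: real)"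
      using fin by (intro integrable_real_indicator sets_PiM_I_finite) auto
    show "AE u in ?L. norm (F N u) \<le> indicator ?W u" for N
    proof (rule AE_I2)
      fix u assume "u \<in> space ?L"
      then have u: "u \<in> A \<rightarrow>\<^sub>E UNIV" by (simp add: spaceL)
      have "u \<in> ?W" if "corner N u \<in> S N"
      proof -
        have "0 \<le> u \<alpha> \<and> u \<alpha> \<le> 1 + of_int \<gamma>" if "\<alpha> \<in> A" for \<alpha>
        proof -
          have "of_int \<gamma> / K N \<le> of_int \<gamma>" using \<gamma> by (simp add: K_def divide_le_eq mult_le_cancel_left1)
          then show ?thesis using X_bounds[OF that, where N = N and u = u] \<open>corner N u \<in> S N\<close> that
              unfolding inS by fastforce
        qed
        then show ?thesis using u by (auto simp: PiE_iff)
      qed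
      then show "norm (F N u) \<le> indicator ?W u" using F_eq[OF u] by (auto simp: indicator_def)
    qed
    show "AE u in ?L. (\<lambda>N. F N u) \<longlonglongrightarrow> indicator ?T u"
      using AE_generic[OF fin] AE_not_boundary[OF fin, of 0] AE_not_boundary[OF fin, of 1] AE_space
    proof eventually_elim
      case (elim u)
      then have u: "u \<in> A \<rightarrow>\<^sub>E UNIV" by (simp add: spaceL)
      have "eventually (\<lambda>N. corner N u \<in> S N \<longleftrightarrow> u \<in> ?T) sequentially"
      proof (cases "\<forall>\<alpha>\<in>A. 0 < u \<alpha> \<and> u \<alpha> < 1")
        case True
        have "eventually (\<lambda>N. \<forall>\<alpha>\<in>A. 0 < X N u \<alpha> \<and> X N u \<alpha> < 1) sequentially"
          using True order_tendstoD(1)[OF X_lim, of _ 0 u] order_tendstoD(2)[OF X_lim, of _ u 1]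
          by (intro eventually_ball_finite fin ballI eventually_conj) auto
        moreover have "eventually (\<lambda>N. Q (X N u) \<longleftrightarrow> Q u) sequentially"
          using loc[where u = u and X = "\<lambda>N. X N u"] elim X_lim by blast
        ultimately show ?thesis
          by eventually_elim (use True u in \<open>auto simp: inS PiE_iff less_imp_le\<close>)
      next
        case False
        then obtain \<alpha> where \<alpha>: "\<alpha> \<in> A" "u \<alpha> < 0 \<or> u \<alpha> > 1" using elim
            by (metis linorder_neqE_linordered_idom)
        then have "eventually (\<lambda>N. X N u \<alpha> < 0 \<or> X N u \<alpha> > 1) sequentially"
          using order_tendstoD(1)[OF X_lim[OF \<alpha>(1), of u], of 1] order_tendstoD(2)[OF X_lim[OF \<alpha>(1),
              of u], of 0]
          by (auto elim: eventually_mono)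
        then have out: "eventually (\<lambda>N. corner N u \<notin> S N) sequentially"
        proof eventually_elim
          case (elim N)
          then show ?case unfolding inS using \<alpha>(1) by force
        qed
        have notT: "u \<notin> ?T"
        proof
          assume "u \<in> ?T"
          then have "0 \<le> u \<alpha>" "u \<alpha> \<le> 1" using \<alpha>(1) by auto
          then show False using \<alpha>(2) by auto
        qed
        show ?thesis by (rule eventually_mono[OF out]) (use notT in blast)
      qed
      then have "eventually (\<lambda>N. F N u = indicator ?T u) sequentially"
        by eventually_elim (simp add: F_eq[OF u] indicator_def)
      then show ?case by (rule tendsto_eventually)
    qed
  qed
  have "(\<lambda>N. of_int \<gamma> * (real (card (S N)) / K N ^ card A) / of_int \<gamma>) \<longlonglongrightarrow> measure ?L ?T / of_int \<gamma>"
  proof (intro tendsto_divide tendsto_const)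
    show "(\<lambda>N. of_int \<gamma> * (real (card (S N)) / K N ^ card A)) \<longlonglongrightarrow> measure ?L ?T"
      using lim Tset unfolding intF by (simp add: spaceL Int_absorb2[OF sets.sets_into_space[OF Tset,
          unfolded spaceL]])
  qed (use \<gamma> in simp)
  then show ?thesis using \<gamma> by (simp add: S_def K_def)
qed

lemma measurable_pred_is_edge:
  assumes "finite A" "\<beta> \<in> A" "\<beta>' \<in> A"
  shows "Measurable.pred (lebesgue_on_heights A) (\<lambda>w. is_edge A w \<beta> \<beta>')"
  unfolding is_edge_def using assms
  by (intro pred_intros_finite finite_Diff borel_measurable_pred_less measurable_chord) auto

lemma measurable_pred_generic:
  assumes "finite A"
  shows "Measurable.pred (lebesgue_on_heights A) (generic A)"
  unfolding generic_def[abs_def]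
proof (intro pred_intros_finite finite_Diff assms)
  fix \<beta> \<beta>' \<alpha> assume "\<beta> \<in> A" "\<beta>' \<in> A" "\<alpha> \<in> A - {\<beta>, \<beta>'}"
  then have "Measurable.pred (lebesgue_on_heights A) (\<lambda>w. chord w \<beta> \<beta>' \<alpha> \<noteq> w \<alpha>)"
    unfolding Measurable.pred_def by (intro borel_measurable_neq measurable_chord) auto
  then show "Measurable.pred (lebesgue_on_heights A) (\<lambda>w. \<beta> \<noteq> \<beta>' \<longrightarrow> chord w \<beta> \<beta>' \<alpha> \<noteq> w \<alpha>)"
    by (cases "\<beta> = \<beta>'") auto
qed

definition edge_volume :: "int set \<Rightarrow> int \<Rightarrow> int \<Rightarrow> real" where
  "edge_volume A \<beta> \<beta>' = measure (lebesgue_on_heights A) {w \<in> A \<rightarrow>\<^sub>E {0..1}. is_edge A w \<beta> \<beta>'}"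

lemma edge_lattice_count_tendsto:
  assumes fin: "finite A" and mem: "\<beta> \<in> A" "\<beta>' \<in> A" and less: "\<beta> < \<beta>'"
  shows "(\<lambda>N. real (card {n \<in> height_box A N. is_edge A (\<lambda>\<alpha>. of_int (n \<alpha>)) \<beta> \<beta>' \<and>
      \<beta>' - \<beta> dvd n \<beta>' - n \<beta>}) / (2 * real N + 1) ^ card A)
     \<longlonglongrightarrow> edge_volume A \<beta> \<beta>' / of_int (\<beta>' - \<beta>)"
  unfolding edge_volume_def
proof (rule lattice_count_tendsto[where Q = "\<lambda>w. is_edge A w \<beta> \<beta>'"])
  show "is_edge A w \<beta> \<beta>' \<longleftrightarrow> is_edge A w' \<beta> \<beta>'" if "\<And>\<alpha>. \<alpha> \<in> A \<Longrightarrow> w \<alpha> = w' \<alpha>" for w w'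
    by (rule is_edge_cong[OF mem that])
qed (use assms in \<open>auto intro: measurable_pred_is_edge eventually_is_edge simp: is_edge_affine\<close>)

text \<open>The case of modulus 1: the set of collinear configurations has volume zero.\<close>

lemma nongeneric_lattice_count_tendsto:
  assumes fin: "finite A" and mem: "\<beta> \<in> A" "\<beta>' \<in> A" and less: "\<beta> < \<beta>'"
  shows "(\<lambda>N. real (card {n \<in> height_box A N. \<not> generic A (\<lambda>\<alpha>. of_int (n \<alpha>))}) / (2 * real N + 1) ^ card A)
     \<longlonglongrightarrow> 0"
proof -
  have "AE w in lebesgue_on_heights A. \<not> (w \<in> (A \<rightarrow>\<^sub>E {0..1}) \<and> \<not> generic A w)"
    using AE_generic[OF fin] by eventually_elim simp
  from emeasure_eq_0_AE[OF this]
  have "emeasure (lebesgue_on_heights A) {w \<in> space (lebesgue_on_heights A). w \<in> A \<rightarrow>\<^sub>E {0..1} \<and>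
      \<not> generic A w} = 0" .
  moreover have "{w \<in> space (lebesgue_on_heights A). w \<in> A \<rightarrow>\<^sub>E {0..1} \<and> \<not> generic A w} =
      {w \<in> A \<rightarrow>\<^sub>E {0..1}. \<not> generic A w}"
    by (auto simp: space_PiM PiE_iff)
  ultimately have "measure (lebesgue_on_heights A) {w \<in> A \<rightarrow>\<^sub>E {0..1}. \<not> generic A w} = 0"
    by (simp add: measure_def)
  moreover have "(\<lambda>N. real (card {n \<in> height_box A N. \<not> generic A (\<lambda>\<alpha>. of_int (n \<alpha>)) \<and>
      1 dvd n \<beta>' - n \<beta>}) / (2 * real N + 1) ^ card A)
     \<longlonglongrightarrow> measure (lebesgue_on_heights A) {w \<in> A \<rightarrow>\<^sub>E {0..1}. \<not> generic A w} / of_int 1"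
  proof (rule lattice_count_tendsto[where Q = "\<lambda>w. \<not> generic A w"])
    show "\<not> generic A w \<longleftrightarrow> \<not> generic A w'" if "\<And>\<alpha>. \<alpha> \<in> A \<Longrightarrow> w \<alpha> = w' \<alpha>" for w w'
      using generic_cong[of A w w'] that by blast
    show "\<forall>\<^sub>F N in sequentially. (\<not> generic A (X N)) = (\<not> generic A u)"
      if "generic A u" "\<And>\<alpha>. \<alpha> \<in> A \<Longrightarrow> (\<lambda>N. X N \<alpha>) \<longlonglongrightarrow> u \<alpha>" for u and X :: "nat \<Rightarrow> int \<Rightarrow> real"
      using eventually_generic[OF fin that(1), of X sequentially] that by (auto elim: eventually_mono)
    show "Measurable.pred (lebesgue_on_heights A) (\<lambda>w. \<not> generic A w)"
      by (intro pred_intros_logic measurable_pred_generic fin)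
  qed (use assms in \<open>auto simp: generic_affine\<close>)
  ultimately show ?thesis by simp
qed

section \<open>Volumes of edges and of lower hulls\<close>

text \<open>Exchanging the two sums, the coefficient of \<open>g \<beta> \<beta>'\<close> is the total volume of those hull
types in which \<open>\<beta>\<close> and \<open>\<beta>'\<close> are neighbours. The hull types partition the cube, so this is the
volume of all heights for which the two are neighbours on the hull, that is, up to a null set,
form an edge.\<close>

lemma lower_hull_volume_sum:
  fixes g :: "int \<Rightarrow> int \<Rightarrow> real"
  assumes fin: "finite A" and ne: "A \<noteq> {}"
  shows "(\<Sum>B | {Min A, Max A} \<subseteq> B \<and> B \<subseteq> A. lower_hull_prob B A *
            (\<Sum>(\<beta>, \<beta>') \<in> {(\<beta>, \<beta>'). consecutive B \<beta> \<beta>'}. g \<beta> \<beta>')) =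
         (\<Sum>(\<beta>, \<beta>') \<in> {(\<beta>, \<beta>'). \<beta> \<in> A \<and> \<beta>' \<in> A \<and> \<beta> < \<beta>'}. g \<beta> \<beta>' * edge_volume A \<beta> \<beta>')"
proof -
  let ?L = "lebesgue_on_heights A"
  let ?P = "{(\<beta>, \<beta>'). \<beta> \<in> A \<and> \<beta>' \<in> A \<and> \<beta> < \<beta>'}"
  let ?BB = "{B. {Min A, Max A} \<subseteq> B \<and> B \<subseteq> A}"
  have spaceL: "space ?L = A \<rightarrow>\<^sub>E UNIV" by (simp add: space_PiM)
  have finP: "finite ?P" by (rule finite_subset[of _ "A \<times> A"]) (use fin in auto)
  have finB: "finite ?BB" by (rule finite_subset[of _ "Pow A"]) (use fin in auto)
  define T where "T B = {w \<in> A \<rightarrow>\<^sub>E {0..1}. lower_hull A w = B}" for B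
  have prob: "lower_hull_prob B A = measure ?L (T B)" if "B \<in> ?BB" for B
  proof -
    have "lower_hull_heights B A \<inter> (A \<rightarrow>\<^sub>E {0..1}) = T B"
      using that lower_hull_heights_eq[of B A] by (auto simp: T_def PiE_iff extensional_def)
    then show ?thesis by (simp add: lower_hull_prob_def)
  qed
  have cube: "(A \<rightarrow>\<^sub>E {0..1::real}) \<in> sets ?L" using fin by (intro sets_PiM_I_finite) auto
  have cubefin: "emeasure ?L (A \<rightarrow>\<^sub>E {0..1::real}) = 1" using fin by (subst lborel_heights.emeasure_PiM) auto
  have Tset: "T B \<in> sets ?L" if "B \<subseteq> A" for B
  proof -
    have "lower_hull A w = B \<longleftrightarrow> (\<forall>\<alpha>\<in>A. (\<alpha> \<in> B) = (\<forall>\<beta>\<in>A. \<forall>\<gamma>\<in>A. \<beta> < \<alpha> \<and> \<alpha> < \<gamma> \<longrightarrow> w \<alpha> \<le> chord w \<beta> \<gamma> \<alpha>))" for w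
      using that unfolding lower_hull_def by blast
    moreover have "Measurable.pred ?L (\<lambda>w. \<forall>\<alpha>\<in>A. (\<alpha> \<in> B) = (\<forall>\<beta>\<in>A. \<forall>\<gamma>\<in>A. \<beta> < \<alpha> \<and> \<alpha> < \<gamma> \<longrightarrow>
        w \<alpha> \<le> chord w \<beta> \<gamma> \<alpha>))"
    proof (intro pred_intros_finite fin pred_intros_logic)
      fix \<alpha> \<beta> \<gamma> assume "\<alpha> \<in> A" "\<beta> \<in> A" "\<gamma> \<in> A"
      then show "Measurable.pred ?L (\<lambda>w. w \<alpha> \<le> chord w \<beta> \<gamma> \<alpha>)"
        unfolding Measurable.pred_def by (intro borel_measurable_le measurable_chord) auto
    qed auto
    ultimately have "Measurable.pred ?L (\<lambda>w. lower_hull A w = B)" by simp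
    moreover have "T B = {w \<in> space ?L. lower_hull A w = B} \<inter> (A \<rightarrow>\<^sub>E {0..1})"
      unfolding T_def spaceL by (auto simp: PiE_iff extensional_def)
    ultimately show ?thesis using cube by auto
  qed
  have Tfin: "emeasure ?L (T B) \<noteq> \<infinity>" for B
  proof -
    have "emeasure ?L (T B) \<le> emeasure ?L (A \<rightarrow>\<^sub>E {0..1})"
      by (rule emeasure_mono[OF _ cube]) (auto simp: T_def)
    then show ?thesis unfolding cubefin by (auto simp: top_unique)
  qed
  have hullBB: "lower_hull A w \<in> ?BB" for w
    using fin ne unfolding lower_hull_def by (auto simp: not_less[symmetric])
  have vol: "(\<Sum>B\<in>?BB. measure ?L (T B) * of_bool (consecutive B \<beta> \<beta>')) = edge_volume A \<beta> \<beta>'"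
    if p: "\<beta> \<in> A" "\<beta>' \<in> A" "\<beta> < \<beta>'" for \<beta> \<beta>'
  proof -
    let ?C = "{B \<in> ?BB. consecutive B \<beta> \<beta>'}"
    have finC: "finite ?C" by (rule finite_subset[OF _ finB]) auto
    have "(\<Sum>B\<in>?BB. measure ?L (T B) * of_bool (consecutive B \<beta> \<beta>')) = (\<Sum>B\<in>?C. measure ?L (T B))"
      using finB by (intro sum.mono_neutral_cong_right) auto
    also have "\<dots> = measure ?L (\<Union>B\<in>?C. T B)"
      using finC Tset Tfin by (intro measure_finite_Union[symmetric]) (auto simp: disjoint_family_on_def
          T_def)
    also have "(\<Union>B\<in>?C. T B) = {w \<in> A \<rightarrow>\<^sub>E {0..1}. consecutive (lower_hull A w) \<beta> \<beta>'}"
      using hullBB by (auto simp: T_def)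
    also have "measure ?L \<dots> = edge_volume A \<beta> \<beta>'"
      unfolding edge_volume_def
    proof (rule measure_eq_AE)
      show "AE w in ?L. w \<in> {w \<in> A \<rightarrow>\<^sub>E {0..1}. consecutive (lower_hull A w) \<beta> \<beta>'} \<longleftrightarrow>
          w \<in> {w \<in> A \<rightarrow>\<^sub>E {0..1}. is_edge A w \<beta> \<beta>'}"
        using AE_generic[OF fin] by eventually_elim (use consecutive_hull_iff_edge[OF fin _ p] in auto)
      have "{w \<in> A \<rightarrow>\<^sub>E {0..1}. consecutive (lower_hull A w) \<beta> \<beta>'} = (\<Union>B\<in>?C. T B)"
        using hullBB by (auto simp: T_def)
      also have "\<dots> \<in> sets ?L" using finC Tset by (intro sets.finite_UN) auto
      finally show "{w \<in> A \<rightarrow>\<^sub>E {0..1}. consecutive (lower_hull A w) \<beta> \<beta>'} \<in> sets ?L" .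
      have "{w \<in> A \<rightarrow>\<^sub>E {0..1}. is_edge A w \<beta> \<beta>'} = {w \<in> space ?L. is_edge A w \<beta> \<beta>'} \<inter> (A \<rightarrow>\<^sub>E {0..1})"
        unfolding spaceL by (auto simp: PiE_iff extensional_def)
      also have "\<dots> \<in> sets ?L" using cube measurable_pred_is_edge[OF fin p(1,2)] by auto
      finally show "{w \<in> A \<rightarrow>\<^sub>E {0..1}. is_edge A w \<beta> \<beta>'} \<in> sets ?L" .
    qed
    finally show ?thesis .
  qed
  have cons: "(\<Sum>(\<beta>, \<beta>') \<in> {(\<beta>, \<beta>'). consecutive B \<beta> \<beta>'}. g \<beta> \<beta>') = (\<Sum>(\<beta>,
      \<beta>') \<in> ?P. g \<beta> \<beta>' * of_bool (consecutive B \<beta> \<beta>'))"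
    if "B \<subseteq> A" for B
  proof -
    have "\<beta> \<in> A \<and> \<beta>' \<in> A \<and> \<beta> < \<beta>'" if "consecutive B \<beta> \<beta>'" for \<beta> \<beta>'
      using that \<open>B \<subseteq> A\<close> by (auto simp: consecutive_def)
    then show ?thesis using finP by (intro sum.mono_neutral_cong_left) auto
  qed
  have "(\<Sum>B\<in>?BB. lower_hull_prob B A * (\<Sum>(\<beta>, \<beta>') \<in> {(\<beta>, \<beta>'). consecutive B \<beta> \<beta>'}. g \<beta> \<beta>')) =
      (\<Sum>B\<in>?BB. \<Sum>(\<beta>, \<beta>') \<in> ?P. g \<beta> \<beta>' * (measure ?L (T B) * of_bool (consecutive B \<beta> \<beta>')))"
  proof (rule sum.cong[OF refl])
    fix B assume B: "B \<in> ?BB"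
    then have "B \<subseteq> A" by simp
    show "lower_hull_prob B A * (\<Sum>(\<beta>, \<beta>') \<in> {(\<beta>, \<beta>'). consecutive B \<beta> \<beta>'}. g \<beta> \<beta>') =
        (\<Sum>(\<beta>, \<beta>') \<in> ?P. g \<beta> \<beta>' * (measure ?L (T B) * of_bool (consecutive B \<beta> \<beta>')))"
      unfolding prob[OF B] cons[OF \<open>B \<subseteq> A\<close>] sum_distrib_left
      by (intro sum.cong refl) (auto simp: algebra_simps)
  qed
  also have "\<dots> = (\<Sum>(\<beta>, \<beta>') \<in> ?P. g \<beta> \<beta>' * (\<Sum>B\<in>?BB. measure ?L (T B) * of_bool (consecutive B \<beta> \<beta>')))"
    by (subst sum.swap) (simp add: sum_distrib_left case_prod_unfold)
  also have "\<dots> = (\<Sum>(\<beta>, \<beta>') \<in> ?P. g \<beta> \<beta>' * edge_volume A \<beta> \<beta>')"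
    by (intro sum.cong refl) (use vol in auto)
  finally show ?thesis .
qed

lemma edge_sum_lower_hull_average:
  assumes fin: "finite A" and ne: "A \<noteq> {}"
  shows "(\<Sum>B | {Min A, Max A} \<subseteq> B \<and> B \<subseteq> A. lower_hull_prob B A * edge_sum v D1 B) =
    (\<Sum>(\<beta>, \<beta>') \<in> {(\<beta>, \<beta>'). \<beta> \<in> A \<and> \<beta>' \<in> A \<and> \<beta> < \<beta>'}.
       expected_residue_roots v (nat (\<beta>' - \<beta>)) D1 / of_int (\<beta>' - \<beta>) * edge_volume A \<beta> \<beta>')"
proof -
  have "edge_sum v D1 B = (\<Sum>(\<beta>, \<beta>') \<in> {(\<beta>, \<beta>'). consecutive B \<beta> \<beta>'}.
      expected_residue_roots v (nat (\<beta>' - \<beta>)) D1 / of_int (\<beta>' - \<beta>))" if "B \<subseteq> A" for B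
    unfolding edge_sum_def Let_def
    by (rule sum_sorted_list_consecutive[OF finite_subset[OF that fin]])
  then show ?thesis by (subst lower_hull_volume_sum[OF assms, symmetric]) (auto intro!: sum.cong)
qed

section \<open>Counting nonzero roots\<close>

lemma powi_shift:
  fixes x :: "'b::field"
  assumes "x \<noteq> 0" "m \<le> \<alpha>" shows "x powi \<alpha> = x powi m * x ^ nat (\<alpha> - m)"
proof -
  have "x powi \<alpha> = x powi (m + int (nat (\<alpha> - m)))" using assms by simp
  also have "\<dots> = x powi m * x ^ nat (\<alpha> - m)" using assms(1)
      by (subst power_int_add) (use assms in \<open>auto simp: power_int_def\<close>)
  finally show ?thesis .
qed

text \<open>Dividing by the lowest power turns the Laurent polynomial into a polynomial of degree at
most \<open>Max A - Min A\<close>.\<close>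

lemma
  fixes a :: "int \<Rightarrow> 'a::field"
  assumes fin: "finite A" and ne: "A \<noteq> {}" and nz: "\<And>\<alpha>. \<alpha> \<in> A \<Longrightarrow> a \<alpha> \<noteq> 0"
  shows finite_nonzero_roots: "finite (nonzero_roots A a)" and card_nonzero_roots_le:
      "card (nonzero_roots A a) \<le> nat (Max A - Min A)"
proof -
  define p where "p = (\<Sum>\<alpha>\<in>A. Polynomial.monom (a \<alpha>) (nat (\<alpha> - Min A)))"
  have mem: "Min A \<in> A" using fin ne by simp
  have "Polynomial.coeff p 0 = (\<Sum>\<alpha>\<in>A. if \<alpha> = Min A then a \<alpha> else 0)"
    unfolding p_def Polynomial.coeff_sum
  proof (rule sum.cong[OF refl])
    fix \<alpha> assume "\<alpha> \<in> A"
    then have "Min A \<le> \<alpha>" using fin by simp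
    then show "Polynomial.coeff (Polynomial.monom (a \<alpha>) (nat (\<alpha> - Min A))) 0 = (if \<alpha> =
        Min A then a \<alpha> else 0)" by auto
  qed
  then have "Polynomial.coeff p 0 \<noteq> 0" using fin mem nz by simp
  then have p0: "p \<noteq> 0" by auto
  have deg: "Polynomial.degree p \<le> nat (Max A - Min A)"
    unfolding p_def
  proof (rule degree_sum_le[OF fin])
    fix \<alpha> assume "\<alpha> \<in> A"
    then have "\<alpha> \<le> Max A" using fin by simp
    then show "Polynomial.degree (Polynomial.monom (a \<alpha>) (nat (\<alpha> - Min A))) \<le> nat (Max A - Min A)"
      by (intro order_trans[OF degree_monom_le]) auto
  qed
  have "nonzero_roots A a \<subseteq> {x. poly p x = 0}"
  proof
    fix x assume x: "x \<in> nonzero_roots A a"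
    then have x0: "x \<noteq> 0" by (simp add: nonzero_roots_def)
    have "(\<Sum>\<alpha>\<in>A. a \<alpha> * x powi \<alpha>) = x powi Min A * poly p x"
      unfolding p_def poly_sum sum_distrib_left
    proof (rule sum.cong[OF refl])
      fix \<alpha> assume "\<alpha> \<in> A"
      then have "Min A \<le> \<alpha>" using fin by simp
      show "a \<alpha> * x powi \<alpha> = x powi Min A * poly (Polynomial.monom (a \<alpha>) (nat (\<alpha> - Min A))) x"
        unfolding powi_shift[OF x0 \<open>Min A \<le> \<alpha>\<close>] by (simp add: poly_monom)
    qed
    then show "x \<in> {x. poly p x = 0}" using x x0 by (auto simp: nonzero_roots_def power_int_eq_0_iff)
  qed
  note sub = this
  show "finite (nonzero_roots A a)"
    by (rule finite_subset[OF sub poly_roots_finite[OF p0]])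
  show "card (nonzero_roots A a) \<le> nat (Max A - Min A)"
    using card_mono[OF poly_roots_finite[OF p0] sub] card_poly_roots_bound[OF p0] deg by linarith
qed

section \<open>Complete discretely valued fields\<close>

locale complete_discretely_valued_field =
  fixes v :: "'a::field \<Rightarrow> ereal" and \<pi> :: 'a
  assumes discrete: "discrete_valuation v"
    and complete: "complete_valuation v"
    and uniformizer_ideal: "valuation_ideal v = PIdl\<^bsub>valuation_ring v\<^esub> \<pi>"
    and uniformizer_carrier: "\<pi> \<in> carrier (valuation_ring v)"
begin

text \<open>The positive generator of the value group; \<open>ord\<close> is the valuation normalised to take
integral values. The floor is exact on nonzero elements, and \<open>ord 0\<close> is an arbitrary value that
the definition of \<open>frac_ideal\<close> bypasses.\<close>

definition step :: real where "step = real_of_ereal (v \<pi>)"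

definition ord :: "'a \<Rightarrow> int" where "ord x = \<lfloor>real_of_ereal (v x) / step\<rfloor>"

text \<open>The fractional ideal \<open>\<pi>\<^sup>kR\<close> of the valuation ring \<open>R\<close>. Congruences and estimates of
valuations are all expressed as membership in such ideals.\<close>

definition frac_ideal :: "int \<Rightarrow> 'a set" where "frac_ideal k = {x. x = 0 \<or> k \<le> ord x}"

lemma v_zero_iff: "v x = \<infinity> \<longleftrightarrow> x = 0"
  and v_not_minf: "v x \<noteq> -\<infinity>"
  and v_mult: "v (x * y) = v x + v y"
  and v_add: "min (v x) (v y) \<le> v (x + y)"
  using discrete unfolding discrete_valuation_def by auto

text \<open>The generator \<open>\<pi>\<close> of the maximal ideal has the smallest positive value, since it divides
an element of that value.\<close>

lemma
  shows step_pos: "step > 0" and v_eq: "x \<noteq> 0 \<Longrightarrow> v x = ereal (step * of_int (ord x))"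
    and v_pi: "v \<pi> = ereal step"
proof -
  obtain c :: real where c: "c > 0" and im: "v ` (UNIV - {0}) = {ereal (c * of_int n) | n::int. True}"
    using discrete unfolding discrete_valuation_def by blast
  have ex: "\<exists>n::int. v x = ereal (c * of_int n)" if "x \<noteq> 0" for x
  proof -
    have "v x \<in> v ` (UNIV - {0})" using that by blast
    then show ?thesis unfolding im by auto
  qed
  have "ereal (c * of_int 1) \<in> v ` (UNIV - {0})" unfolding im by blast
  then obtain z where z: "v z = ereal c" by (metis imageE mult.right_neutral of_int_1)
  have "z \<in> valuation_ideal v" using z c by (simp add: valuation_ideal_def)
  then obtain a where a: "0 \<le> v a" "z = a * \<pi>"
    unfolding uniformizer_ideal cgenideal_def valuation_ring_def by auto
  have vz: "ereal c = v a + v \<pi>" using a z v_mult by metis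
  have pi0: "\<pi> \<noteq> 0" using a z v_zero_iff[of z] by auto
  have one: "v 1 = 0"
    using v_mult[of 1 1] v_not_minf[of 1] v_zero_iff[of 1] by (cases "v 1") auto
  have "\<pi> = 1 * \<pi>" by simp
  then have "\<pi> \<in> valuation_ideal v"
    unfolding uniformizer_ideal cgenideal_def valuation_ring_def using one by force
  then have pos: "0 < v \<pi>" by (simp add: valuation_ideal_def)
  obtain n :: int where n: "v \<pi> = ereal (c * of_int n)" using ex[OF pi0] by blast
  have "0 < c * of_int n" using pos n by simp
  then have "n \<ge> 1" using c by (simp add: zero_less_mult_iff)
  moreover have "v \<pi> \<le> ereal c" using vz a(1) by (metis add_increasing order_refl)
  then have "c * of_int n \<le> c * 1" using n by simp
  then have "n \<le> 1" using c by (simp add: mult_le_cancel_left)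
  ultimately have "n = 1" by simp
  then have vp: "v \<pi> = ereal c" using n by simp
  then have s: "step = c" by (simp add: step_def)
  show "step > 0" "v \<pi> = ereal step" using s c vp by auto
  show "v x = ereal (step * of_int (ord x))" if "x \<noteq> 0"
  proof -
    obtain m :: int where "v x = ereal (c * of_int m)" using ex[OF \<open>x \<noteq> 0\<close>] by blast
    then show ?thesis unfolding ord_def s using c by simp
  qed
qed

lemma pi_nonzero: "\<pi> \<noteq> 0"
  using v_pi v_zero_iff[of \<pi>] by auto

lemma ord_eqI: "v x = ereal (step * of_int n) \<Longrightarrow> ord x = n"
  unfolding ord_def using step_pos by simp

lemma ord_pi [simp]: "ord \<pi> = 1"
  by (rule ord_eqI) (simp add: v_pi)

lemma ord_mult: "x \<noteq> 0 \<Longrightarrow> y \<noteq> 0 \<Longrightarrow> ord (x * y) = ord x + ord y"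
  by (rule ord_eqI) (simp add: v_mult v_eq algebra_simps)

lemma ord_one [simp]: "ord 1 = 0"
  using ord_mult[of 1 1] by simp

lemma ord_inverse: "x \<noteq> 0 \<Longrightarrow> ord (inverse x) = - ord x"
  using ord_mult[of x "inverse x"] by simp

lemma ord_minus [simp]: "ord (- x) = ord x"
proof (cases "x = 0")
  case False
  have "ord (-1) + ord (-1) = 0" using ord_mult[of "-1" "-1"] by simp
  then have "ord (-1) = 0" by simp
  then show ?thesis using ord_mult[of "-1" x] False by simp
qed simp

lemma ord_power: "x \<noteq> 0 \<Longrightarrow> ord (x ^ n) = int n * ord x"
  by (induction n) (auto simp: ord_mult algebra_simps)

lemma ord_powi: "x \<noteq> 0 \<Longrightarrow> ord (x powi n) = n * ord x"
  by (cases "n \<ge> 0") (auto simp: power_int_def ord_power ord_inverse)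

lemma ord_add: "x \<noteq> 0 \<Longrightarrow> y \<noteq> 0 \<Longrightarrow> x + y \<noteq> 0 \<Longrightarrow> min (ord x) (ord y) \<le> ord (x + y)"
  using v_add[of x y] step_pos by (auto simp: v_eq min_def split: if_splits)

lemma frac_ideal_zero [simp]: "0 \<in> frac_ideal k"
  by (simp add: frac_ideal_def)

lemma frac_ideal_add: "x \<in> frac_ideal k \<Longrightarrow> y \<in> frac_ideal k \<Longrightarrow> x + y \<in> frac_ideal k"
  using ord_add[of x y] unfolding frac_ideal_def by force

lemma frac_ideal_minus: "x \<in> frac_ideal k \<Longrightarrow> - x \<in> frac_ideal k"
  by (simp add: frac_ideal_def)

lemma frac_ideal_diff: "x \<in> frac_ideal k \<Longrightarrow> y \<in> frac_ideal k \<Longrightarrow> x - y \<in> frac_ideal k"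
  using frac_ideal_add[of x k "- y"] frac_ideal_minus by simp

lemma frac_ideal_mult: "x \<in> frac_ideal j \<Longrightarrow> y \<in> frac_ideal k \<Longrightarrow> x * y \<in> frac_ideal (j + k)"
  by (cases "x = 0"; cases "y = 0") (auto simp: frac_ideal_def ord_mult)

lemma frac_ideal_mono: "x \<in> frac_ideal k \<Longrightarrow> j \<le> k \<Longrightarrow> x \<in> frac_ideal j"
  by (auto simp: frac_ideal_def)

lemma frac_ideal_sum: "(\<And>i. i \<in> S \<Longrightarrow> f i \<in> frac_ideal k) \<Longrightarrow> sum f S \<in> frac_ideal k"
  by (induction S rule: infinite_finite_induct) (auto intro: frac_ideal_add)

lemma frac_ideal_eq_val: "x \<in> frac_ideal k \<longleftrightarrow> ereal (step * of_int k) \<le> v x"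
  using step_pos v_zero_iff[of 0] by (cases "x = 0") (auto simp: frac_ideal_def v_eq)

lemma valuation_ideal_eq: "valuation_ideal v = frac_ideal 1"
proof (rule Set.set_eqI)
  fix x show "x \<in> valuation_ideal v \<longleftrightarrow> x \<in> frac_ideal 1"
    using step_pos v_zero_iff[of 0]
    by (cases "x = 0") (auto simp: frac_ideal_def valuation_ideal_def v_eq zero_less_mult_iff)
qed

lemma carrier_valuation_ring: "carrier (valuation_ring v) = frac_ideal 0"
  by (auto simp: valuation_ring_def frac_ideal_eq_val zero_ereal_def)

definition unit_elements :: "'a set" where "unit_elements = frac_ideal 0 - frac_ideal 1"

lemma unit_elements_iff: "x \<in> unit_elements \<longleftrightarrow> x \<noteq> 0 \<and> ord x = 0"
  by (auto simp: unit_elements_def frac_ideal_def)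

lemma frac_ideal_unit_mult_iff:
  "u \<in> unit_elements \<Longrightarrow> u * x \<in> frac_ideal k \<longleftrightarrow> x \<in> frac_ideal k"
  by (cases "x = 0") (auto simp: frac_ideal_def unit_elements_iff ord_mult)

lemma unit_elements_mult: "x \<in> unit_elements \<Longrightarrow> y \<in> unit_elements \<Longrightarrow> x * y \<in> unit_elements"
  by (auto simp: unit_elements_iff ord_mult)

lemma unit_elements_power: "x \<in> unit_elements \<Longrightarrow> x ^ n \<in> unit_elements"
  by (auto simp: unit_elements_iff ord_power)

lemma unit_elements_cong:
  assumes "x \<in> unit_elements" "y - x \<in> frac_ideal 1" shows "y \<in> unit_elements"
proof -
  have "y \<in> frac_ideal 0"
    using frac_ideal_add[of x 0 "y - x"] assms frac_ideal_mono[of "y - x" 1 0]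
        by (auto simp: unit_elements_def)
  moreover have "y \<notin> frac_ideal 1"
    using frac_ideal_diff[of y 1 "y - x"] assms by (auto simp: unit_elements_def)
  ultimately show ?thesis by (simp add: unit_elements_def)
qed

lemma frac_ideal_all_zero:
  assumes "\<And>k. x \<in> frac_ideal k" shows "x = 0"
  using assms[of "ord x + 1"] by (simp add: frac_ideal_def)

lemma limit_exists:
  assumes "\<And>m n. n \<le> m \<Longrightarrow> x m - x n \<in> frac_ideal (int n)"
  obtains l where "\<And>k. \<exists>N. \<forall>n\<ge>N. x n - l \<in> frac_ideal k"
proof -
  have "\<exists>N. \<forall>m\<ge>N. \<forall>n\<ge>N. ereal C \<le> v (x m - x n)" for C
  proof -
    obtain N :: nat where N: "C / step < real N" using reals_Archimedean2 by blast
    have *: "ereal C \<le> v y" if "y \<in> frac_ideal (int N)" for y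
    proof -
      have "C \<le> step * real N" using N step_pos by (simp add: field_simps)
      then show ?thesis using that[unfolded frac_ideal_eq_val] by (simp add: order_trans[rotated])
    qed
    have "x m - x n \<in> frac_ideal (int N)" if "m \<ge> N" "n \<ge> N" for m n
    proof -
      have "(x m - x N) - (x n - x N) \<in> frac_ideal (int N)"
        using assms that frac_ideal_diff by blast
      then show ?thesis by simp
    qed
    then show ?thesis using * by blast
  qed
  then obtain l where l: "\<And>C::real. \<exists>N. \<forall>n\<ge>N. ereal C \<le> v (x n - l)"
    using complete[unfolded complete_valuation_def, rule_format, of x] by blast
  show ?thesis
  proof (rule that)
    show "\<exists>N. \<forall>n\<ge>N. x n - l \<in> frac_ideal k" for k
      unfolding frac_ideal_eq_val using l .
  qed
qed

section \<open>Hensel's lemma and monomials\<close>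

text \<open>Near \<open>y0\<close> the function \<open>F\<close> is approximated by its linear part with unit slope \<open>D\<close> to one
more digit than the arguments agree in. Hence the Newton step with constant slope gains a digit
each time, which gives existence by completeness, and two distinct roots in the same residue
class would contradict the approximation.\<close>

lemma hensel_unique_root:
  assumes D: "D \<in> unit_elements" and F0: "F y0 \<in> frac_ideal 1"
    and lin: "\<And>y y' k. y - y0 \<in> frac_ideal 1 \<Longrightarrow> y' - y0 \<in> frac_ideal 1 \<Longrightarrow> y - y' \<in> frac_ideal k
                \<Longrightarrow> F y - F y' - D * (y - y') \<in> frac_ideal (k + 1)"
  shows "\<exists>!y. y - y0 \<in> frac_ideal 1 \<and> F y = 0"
proof -
  have D0: "D \<noteq> 0" using D by (simp add: unit_elements_iff)
  have Dinv: "inverse D \<in> unit_elements" using D by (simp add: unit_elements_iff ord_inverse)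
  define Y where "Y = rec_nat y0 (\<lambda>_ y. y - inverse D * F y)"
  have Y0: "Y 0 = y0" and YS: "Y (Suc n) = Y n - inverse D * F (Y n)" for n
    by (simp_all add: Y_def)
  have inv: "Y n - y0 \<in> frac_ideal 1 \<and> F (Y n) \<in> frac_ideal (int n + 1)" for n
  proof (induction n)
    case 0
    then show ?case using F0 by (simp add: Y0)
  next
    case (Suc n)
    let ?d = "Y (Suc n) - Y n"
    have d: "?d \<in> frac_ideal (int n + 1)"
      using Suc frac_ideal_unit_mult_iff[OF Dinv] by (simp add: YS frac_ideal_minus)
    have y: "Y (Suc n) - y0 \<in> frac_ideal 1"
      using frac_ideal_add[OF frac_ideal_mono[OF d, of 1] conjunct1[OF Suc]] by simp
    have "F (Y (Suc n)) - F (Y n) - D * ?d \<in> frac_ideal (int n + 1 + 1)"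
      using lin[OF y conjunct1[OF Suc] d] .
    moreover have "D * ?d = - F (Y n)" using D0 by (simp add: YS)
    ultimately show ?case using y by (simp add: algebra_simps)
  qed
  have diff: "Y m - Y n \<in> frac_ideal (int n + 1)" if "n \<le> m" for m n
    using that
  proof (induction m rule: dec_induct)
    case (step m)
    have "Y (Suc m) - Y m \<in> frac_ideal (int m + 1)"
      using inv[of m] frac_ideal_unit_mult_iff[OF Dinv] by (simp add: YS frac_ideal_minus)
    then have "Y (Suc m) - Y m \<in> frac_ideal (int n + 1)"
      using frac_ideal_mono step by force
    from frac_ideal_add[OF this step.IH] show ?case by simp
  qed simp
  obtain l where l: "\<And>k. \<exists>N. \<forall>n\<ge>N. Y n - l \<in> frac_ideal k"
    using limit_exists[of Y] diff frac_ideal_mono by (metis add.commute le_add_same_cancel2 zero_le_one)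
  have l': "l - Y n \<in> frac_ideal k" if "Y n - l \<in> frac_ideal k" for n k
    using frac_ideal_minus[OF that] by simp
  have ly: "l - y0 \<in> frac_ideal 1"
  proof -
    obtain n where "Y n - l \<in> frac_ideal 1" using l by blast
    from frac_ideal_add[OF l'[OF this] conjunct1[OF inv[of n]]] show ?thesis by simp
  qed
  have "F l = 0"
  proof (rule frac_ideal_all_zero)
    fix k
    obtain N where N: "\<And>n. n \<ge> N \<Longrightarrow> Y n - l \<in> frac_ideal k" using l by blast
    define n where "n = max N (nat k)"
    have n: "l - Y n \<in> frac_ideal k" "k \<le> int n" using N l' by (auto simp: n_def)
    have 1: "F l - F (Y n) - D * (l - Y n) \<in> frac_ideal k"
      using lin[OF ly conjunct1[OF inv] n(1)] frac_ideal_mono by force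
    have 2: "F (Y n) \<in> frac_ideal k" using inv[of n] n(2) frac_ideal_mono by force
    have 3: "D * (l - Y n) \<in> frac_ideal k" using n frac_ideal_unit_mult_iff[OF D] by simp
    from frac_ideal_add[OF frac_ideal_add[OF 1 2] 3] show "F l \<in> frac_ideal k" by simp
  qed
  moreover have "y = y'" if y: "y - y0 \<in> frac_ideal 1" "F y = 0" and y': "y' - y0 \<in> frac_ideal 1"
      "F y' = 0" for y y'
  proof (rule ccontr)
    assume "y \<noteq> y'"
    then have "y - y' \<noteq> 0" by simp
    have "y - y' \<in> frac_ideal (ord (y - y'))" by (simp add: frac_ideal_def)
    from lin[OF y(1) y'(1) this] have "- (D * (y - y')) \<in> frac_ideal (ord (y - y') + 1)"
      using y y' by simp
    then have "D * (y - y') \<in> frac_ideal (ord (y - y') + 1)"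
      using frac_ideal_minus by fastforce
    then have "y - y' \<in> frac_ideal (ord (y - y') + 1)"
      using frac_ideal_unit_mult_iff[OF D] by blast
    then show False using \<open>y - y' \<noteq> 0\<close> by (simp add: frac_ideal_def)
  qed
  ultimately show ?thesis using ly by blast
qed

text \<open>Induction on the exponent with the product rule; each error term carries an extra factor
from \<open>frac_ideal 1\<close>.\<close>

lemma monomial_linearization:
  assumes y0: "y0 \<in> frac_ideal 0" and y: "y - y0 \<in> frac_ideal 1" and y': "y' - y0 \<in> frac_ideal 1"
    and d: "y - y' \<in> frac_ideal k"
  shows "y ^ n - y' ^ n - of_nat n * y0 ^ (n - 1) * (y - y') \<in> frac_ideal (k + 1)"
proof (induction n)
  case (Suc n)
  have fr: "z ^ m \<in> frac_ideal 0" if "z \<in> frac_ideal 0" for z m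
    using that by (induction m) (auto simp: frac_ideal_def ord_mult)
  let ?D = "of_nat n * y0 ^ (n - 1)"
  have y'0: "y' \<in> frac_ideal 0" using frac_ideal_add[OF y0 frac_ideal_mono[OF y']] by simp
  have y'n: "y' ^ m - y0 ^ m \<in> frac_ideal 1" for m
  proof (induction m)
    case (Suc m)
    have "y' * (y' ^ m - y0 ^ m) + (y' - y0) * y0 ^ m \<in> frac_ideal 1"
      using frac_ideal_mult[OF y'0 Suc] frac_ideal_mult[OF y' fr[OF y0]] by (auto intro: frac_ideal_add)
    then show ?case by (simp add: algebra_simps)
  qed simp
  have nat0: "of_nat j \<in> frac_ideal 0" for j
  proof (induction j)
    case (Suc j)
    have "1 \<in> frac_ideal 0" by (simp add: frac_ideal_def)
    from frac_ideal_add[OF this Suc] show ?case by simp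
  qed simp
  have yn0: "y0 * (of_nat n * y0 ^ (n - 1)) = of_nat n * y0 ^ n"
    by (cases n) auto
  have "y * (y ^ n - y' ^ n - ?D * (y - y')) \<in> frac_ideal (k + 1)"
    using frac_ideal_mult[OF frac_ideal_add[OF y0 frac_ideal_mono[OF y]] Suc] by simp
  moreover have "(y - y0) * (?D * (y - y')) \<in> frac_ideal (k + 1)"
    using frac_ideal_mult[OF y frac_ideal_mult[OF frac_ideal_mult[OF nat0 fr[OF y0]] d]]
        by (simp add: add.commute)
  moreover have "(y' ^ n - y0 ^ n) * (y - y') \<in> frac_ideal (k + 1)"
    using frac_ideal_mult[OF y'n d] by (simp add: add.commute)
  ultimately have "y * (y ^ n - y' ^ n - ?D * (y - y')) + (y - y0) * (?D * (y - y')) + (y' ^ n - y0 ^ n)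
      * (y - y') \<in> frac_ideal (k + 1)"
    by (intro frac_ideal_add)
  moreover have "y * (y ^ n - y' ^ n - ?D * (y - y')) + (y - y0) * (?D * (y - y')) + (y' ^ n - y0 ^ n) *
      (y - y')
     = y ^ Suc n - y' ^ Suc n - (y0 * ?D + y0 ^ n) * (y - y')"
    by (simp add: algebra_simps)
  ultimately have "y ^ Suc n - y' ^ Suc n - (of_nat n * y0 ^ n + y0 ^ n) * (y - y') \<in> frac_ideal (k + 1)"
    unfolding yn0 by simp
  then show ?case by (simp add: algebra_simps)
qed simp

section \<open>The residue field\<close>

lemma valuation_ring_operations [simp]:
  "mult (valuation_ring v) = (*)" "one (valuation_ring v) = 1"
  "add (valuation_ring v) = (+)" "zero (valuation_ring v) = 0"
  by (simp_all add: valuation_ring_def)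

lemma one_frac_ideal: "1 \<in> frac_ideal 0"
  by (simp add: frac_ideal_def)

lemma frac_ideal_0_mult: "x \<in> frac_ideal 0 \<Longrightarrow> y \<in> frac_ideal k \<Longrightarrow> x * y \<in> frac_ideal k"
  using frac_ideal_mult[of x 0 y k] by simp

lemma valuation_ring_cring: "cring (valuation_ring v)"
proof (rule cringI)
  show "abelian_group (valuation_ring v)"
    by (rule abelian_groupI)
      (auto simp: carrier_valuation_ring frac_ideal_add intro!: bexI[of _ "- x" for x] frac_ideal_minus)
  show "comm_monoid (valuation_ring v)"
    by (rule comm_monoidI) (auto simp: carrier_valuation_ring frac_ideal_0_mult one_frac_ideal)
qed (simp add: algebra_simps)

lemma valuation_ideal_ideal: "ideal (valuation_ideal v) (valuation_ring v)"
  unfolding uniformizer_ideal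
  by (rule cring.cgenideal_ideal[OF valuation_ring_cring uniformizer_carrier])

definition residue :: "'a \<Rightarrow> 'a set" where
  "residue y = valuation_ideal v +>\<^bsub>valuation_ring v\<^esub> y"

lemma residue_eq: "residue y = {x. x - y \<in> frac_ideal 1}"
  unfolding residue_def a_r_coset_def' valuation_ideal_eq
  by (auto simp: algebra_simps)

lemma residue_eq_iff: "residue x = residue y \<longleftrightarrow> x - y \<in> frac_ideal 1"
proof
  assume "residue x = residue y"
  moreover have "x \<in> residue x" by (simp add: residue_eq)
  ultimately show "x - y \<in> frac_ideal 1" by (simp add: residue_eq)
next
  assume *: "x - y \<in> frac_ideal 1"
  show "residue x = residue y"
    using frac_ideal_add[OF *] frac_ideal_diff[OF _ *] by (force simp: residue_eq)
qed

lemma residue_hom: "ring_hom_ring (valuation_ring v) (residue_field v) residue"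
  unfolding residue_field_def residue_def[abs_def]
  by (rule ideal.rcos_ring_hom_ring[OF valuation_ideal_ideal])

lemma residue_mult: "x \<in> frac_ideal 0 \<Longrightarrow> y \<in> frac_ideal 0 \<Longrightarrow>
    residue x \<otimes>\<^bsub>residue_field v\<^esub> residue y = residue (x * y)"
  using ring_hom_ring.homh[OF residue_hom] ring_hom_mult[of residue "valuation_ring v"
      "residue_field v" x y]
  by (simp add: carrier_valuation_ring)

lemma residue_add: "x \<in> frac_ideal 0 \<Longrightarrow> y \<in> frac_ideal 0 \<Longrightarrow>
    residue x \<oplus>\<^bsub>residue_field v\<^esub> residue y = residue (x + y)"
  using ring_hom_ring.homh[OF residue_hom] ring_hom_add[of residue "valuation_ring v" "residue_field v" x y]
  by (simp add: carrier_valuation_ring)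

lemma residue_one: "residue 1 = \<one>\<^bsub>residue_field v\<^esub>"
  using ring_hom_ring.homh[OF residue_hom] ring_hom_one[of residue "valuation_ring v" "residue_field v"]
  by simp

lemma residue_zero: "residue 0 = \<zero>\<^bsub>residue_field v\<^esub>"
  by (simp add: residue_eq residue_field_def FactRing_def valuation_ideal_eq)

lemma residue_eq_zero_iff: "residue x = \<zero>\<^bsub>residue_field v\<^esub> \<longleftrightarrow> x \<in> frac_ideal 1"
  using residue_eq_iff[of x 0] by (simp add: residue_zero)

lemma carrier_residue_field: "carrier (residue_field v) = residue ` frac_ideal 0"
  unfolding residue_field_def FactRing_simps residue_def
  by (auto simp: carrier_valuation_ring)

lemma residue_field_cring: "cring (residue_field v)"
  unfolding residue_field_def by (rule ideal.quotient_is_cring[OF valuation_ideal_ideal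
      valuation_ring_cring])

lemma frac_ideal_0_power: "x \<in> frac_ideal 0 \<Longrightarrow> x ^ n \<in> frac_ideal 0"
  by (induction n) (auto simp: one_frac_ideal frac_ideal_0_mult)

lemma frac_ideal_of_nat: "of_nat n \<in> frac_ideal 0"
  by (induction n) (auto intro: frac_ideal_add one_frac_ideal)

lemma residue_power: "x \<in> frac_ideal 0 \<Longrightarrow> residue x [^]\<^bsub>residue_field v\<^esub> (n::nat) = residue (x ^ n)"
proof (induction n)
  case 0
  then show ?case by (simp add: residue_one nat_pow_def)
next
  case (Suc n)
  interpret cring "residue_field v" by (rule residue_field_cring)
  show ?case using Suc by (simp add: residue_mult frac_ideal_0_power mult.commute)
qed

lemma residue_of_nat: "\<one>\<^bsub>residue_field v\<^esub> [^]\<^bsub>add_monoid (residue_field v)\<^esub> (n::nat) = residue (of_nat n)"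
proof (induction n)
  case 0
  then show ?case by (simp add: residue_zero nat_pow_def)
next
  case (Suc n)
  interpret cring "residue_field v" by (rule residue_field_cring)
  show ?case using Suc residue_add[OF frac_ideal_of_nat[of n] one_frac_ideal]
    by (simp add: residue_one[symmetric] add.commute)
qed

lemma unit_elements_frac_ideal: "x \<in> unit_elements \<Longrightarrow> x \<in> frac_ideal 0"
  by (simp add: unit_elements_def)

lemma Units_residue_field: "Units (residue_field v) = residue ` unit_elements"
proof (intro equalityI subsetI)
  fix d assume "d \<in> Units (residue_field v)"
  then obtain d' where d: "d \<in> carrier (residue_field v)" "d' \<in> carrier (residue_field v)"
     "d' \<otimes>\<^bsub>residue_field v\<^esub> d = \<one>\<^bsub>residue_field v\<^esub>"
    unfolding Units_def by blast
  then obtain x x' where x: "d = residue x" "d' = residue x'" "x \<in> frac_ideal 0" "x' \<in> frac_ideal 0"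
    unfolding carrier_residue_field by blast
  have "residue (x' * x) = residue 1" using d x by (simp add: residue_mult residue_one)
  then have xx: "x' * x - 1 \<in> frac_ideal 1" by (simp add: residue_eq_iff)
  have "x \<notin> frac_ideal 1"
  proof
    assume "x \<in> frac_ideal 1"
    from frac_ideal_diff[OF frac_ideal_0_mult[OF x(4) this] xx] show False by (simp add: frac_ideal_def)
  qed
  then show "d \<in> residue ` unit_elements" using x by (auto simp: unit_elements_def)
next
  fix d assume "d \<in> residue ` unit_elements"
  then obtain x where x: "d = residue x" "x \<in> unit_elements" by blast
  have i: "inverse x \<in> unit_elements" using x by (simp add: unit_elements_iff ord_inverse)
  have "residue x \<otimes>\<^bsub>residue_field v\<^esub> residue (inverse x) = \<one>\<^bsub>residue_field v\<^esub>"
       "residue (inverse x) \<otimes>\<^bsub>residue_field v\<^esub> residue x = \<one>\<^bsub>residue_field v\<^esub>"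
    using x i by (simp_all add: residue_mult unit_elements_frac_ideal residue_one) (simp_all add:
        unit_elements_iff residue_one)
  then show "d \<in> Units (residue_field v)"
    unfolding Units_def carrier_residue_field using x i by (auto simp: unit_elements_frac_ideal)
qed

text \<open>The residue characteristic is the additive order of 1 in the residue field, so it divides
\<open>n\<close> as soon as \<open>n\<close> reduces to 0; coprimality would then make it 1, and 1 would reduce to 0.\<close>

lemma coprime_residue_char_unit:
  assumes "n > 0" and "residue_char v = 0 \<or> coprime (residue_char v) n"
  shows "of_nat n \<in> unit_elements"
proof (rule ccontr)
  assume "of_nat n \<notin> unit_elements"
  then have n: "residue (of_nat n) = \<zero>\<^bsub>residue_field v\<^esub>"
    unfolding residue_eq_zero_iff using frac_ideal_of_nat[of n] by (auto simp: unit_elements_def)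
  interpret cring "residue_field v" by (rule residue_field_cring)
  have *: "residue (of_nat m) = \<zero>\<^bsub>residue_field v\<^esub> \<longleftrightarrow> residue_char v dvd m" for m
    using group.pow_eq_id[OF a_group, of "\<one>\<^bsub>residue_field v\<^esub>" m]
    unfolding residue_char_def residue_of_nat[symmetric] by simp
  have "residue_char v dvd n" using n * by simp
  then have "residue_char v = 1" using assms
      by (metis coprime_absorb_left dvd_0_left_iff gr_implies_not0 nat_dvd_1_iff_1)
  then have "residue 1 = \<zero>\<^bsub>residue_field v\<^esub>" using *[of 1] by simp
  then show False by (simp add: residue_eq_zero_iff frac_ideal_def)
qed

section \<open>Roots of prescribed valuation\<close>

text \<open>Modulo the maximal ideal only the two terms with unit coefficients survive, and what
remains is a monomial times a binomial of degree \<open>e \<beta>' - e \<beta>\<close>. This degree is a unit, so the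
nonzero roots of the binomial are simple, and each of them lifts to exactly one root.\<close>

lemma bij_betw_unit_roots_residue_roots:
  fixes e :: "'b \<Rightarrow> nat" and b :: "'b \<Rightarrow> 'a"
  assumes fin: "finite A" and \<beta>: "\<beta> \<in> A" "\<beta>' \<in> A" and less: "e \<beta> < e \<beta>'"
    and b: "b \<beta> \<in> unit_elements" "b \<beta>' \<in> unit_elements"
    and small: "\<And>\<alpha>. \<alpha> \<in> A \<Longrightarrow> \<alpha> \<noteq> \<beta> \<Longrightarrow> \<alpha> \<noteq> \<beta>' \<Longrightarrow> b \<alpha> \<in> frac_ideal 1"
    and unit: "of_nat (e \<beta>' - e \<beta>) \<in> unit_elements"
  shows "bij_betw residue {y \<in> unit_elements. (\<Sum>\<alpha>\<in>A. b \<alpha> * y ^ e \<alpha>) = 0}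
           (residue_binomial_roots v (e \<beta>' - e \<beta>) (residue (b \<beta>'), residue (b \<beta>)))"
proof -
  define \<gamma> where "\<gamma> = e \<beta>' - e \<beta>"
  define F where "F y = (\<Sum>\<alpha>\<in>A. b \<alpha> * y ^ e \<alpha>)" for y
  have ne: "\<beta> \<noteq> \<beta>'" using less by auto
  have split: "(\<Sum>\<alpha>\<in>A. g \<alpha>) = g \<beta>' + g \<beta> + (\<Sum>\<alpha>\<in>A - {\<beta>, \<beta>'}. g \<alpha>)" for g :: "'b \<Rightarrow> 'a"
  proof -
    have "(\<Sum>\<alpha>\<in>A. g \<alpha>) = (\<Sum>\<alpha>\<in>{\<beta>, \<beta>'}. g \<alpha>) + (\<Sum>\<alpha>\<in>A - {\<beta>, \<beta>'}. g \<alpha>)"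
      using sum.subset_diff[of "{\<beta>, \<beta>'}" A g] fin \<beta> by (simp add: add.commute)
    then show ?thesis using ne by simp
  qed
  have b0: "b \<alpha> \<in> frac_ideal 0" if "\<alpha> \<in> A" for \<alpha>
    using b small[OF that] frac_ideal_mono[of "b \<alpha>" 1 0] unit_elements_frac_ideal by auto
  have F_mod: "F y \<in> frac_ideal 1 \<longleftrightarrow>
      residue y \<in> residue_binomial_roots v \<gamma> (residue (b \<beta>'), residue (b \<beta>))" if y: "y \<in> unit_elements"
          for y
  proof -
    have y0: "y \<in> frac_ideal 0" using y by (rule unit_elements_frac_ideal)
    have rest: "(\<Sum>\<alpha>\<in>A - {\<beta>, \<beta>'}. b \<alpha> * y ^ e \<alpha>) \<in> frac_ideal 1"
      using small frac_ideal_0_mult[OF frac_ideal_0_power[OF y0]]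
      by (intro frac_ideal_sum) (auto simp: mult.commute)
    have "e \<beta>' = e \<beta> + \<gamma>" using less by (simp add: \<gamma>_def)
    then have F: "F y = y ^ e \<beta> * (b \<beta>' * y ^ \<gamma> + b \<beta>) + (\<Sum>\<alpha>\<in>A - {\<beta>, \<beta>'}. b \<alpha> * y ^ e \<alpha>)"
      unfolding F_def by (subst split) (simp add: algebra_simps power_add)
    have "F y \<in> frac_ideal 1 \<longleftrightarrow> y ^ e \<beta> * (b \<beta>' * y ^ \<gamma> + b \<beta>) \<in> frac_ideal 1"
      using frac_ideal_add[OF _ rest, of "y ^ e \<beta> * (b \<beta>' * y ^ \<gamma> + b \<beta>)"] frac_ideal_diff[OF _ rest, of
          "F y"]
      unfolding F by auto
    also have "\<dots> \<longleftrightarrow> b \<beta>' * y ^ \<gamma> + b \<beta> \<in> frac_ideal 1"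
      by (rule frac_ideal_unit_mult_iff[OF unit_elements_power[OF y]])
    also have "\<dots> \<longleftrightarrow> residue (b \<beta>' * y ^ \<gamma> + b \<beta>) = \<zero>\<^bsub>residue_field v\<^esub>"
      by (rule residue_eq_zero_iff[symmetric])
    also have "residue (b \<beta>' * y ^ \<gamma> + b \<beta>) =
      residue (b \<beta>') \<otimes>\<^bsub>residue_field v\<^esub> (residue y [^]\<^bsub>residue_field v\<^esub> \<gamma>) \<oplus>\<^bsub>residue_field v\<^esub> residue (b \<beta>)"
      using b0 \<beta> y0 by (simp add: residue_power residue_mult residue_add frac_ideal_0_power
          frac_ideal_0_mult)
    finally show ?thesis using y by (simp add: residue_binomial_roots_def Units_residue_field)
  qed
  have hensel: "\<exists>!y. y - y0 \<in> frac_ideal 1 \<and> F y = 0" if y0: "y0 \<in> unit_elements" and root: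
      "F y0 \<in> frac_ideal 1" for y0
  proof (rule hensel_unique_root)
    define D where "D = (\<Sum>\<alpha>\<in>A. b \<alpha> * (of_nat (e \<alpha>) * y0 ^ (e \<alpha> - 1)))"
    have y00: "y0 \<in> frac_ideal 0" using y0 by (rule unit_elements_frac_ideal)
    show "F y0 \<in> frac_ideal 1" by (rule root)
    show "F y - F y' - D * (y - y') \<in> frac_ideal (k + 1)"
      if "y - y0 \<in> frac_ideal 1" "y' - y0 \<in> frac_ideal 1" "y - y' \<in> frac_ideal k" for y y' k
    proof -
      have "F y - F y' - D * (y - y') =
          (\<Sum>\<alpha>\<in>A. b \<alpha> * (y ^ e \<alpha> - y' ^ e \<alpha> - of_nat (e \<alpha>) * y0 ^ (e \<alpha> - 1) * (y - y')))"
        unfolding F_def D_def sum_distrib_right sum_subtractf[symmetric]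
        by (intro sum.cong) (auto simp: algebra_simps)
      also have "\<dots> \<in> frac_ideal (k + 1)"
        by (intro frac_ideal_sum frac_ideal_0_mult b0 monomial_linearization[OF y00 that])
      finally show ?thesis .
    qed
    show "D \<in> unit_elements"
    proof -
      have pw: "y0 * (of_nat n * y0 ^ (n - 1)) = of_nat n * y0 ^ n" for n by (cases n) auto
      \<comment> \<open>Subtracting \<open>e \<beta>\<close> times \<open>F y0\<close> from \<open>y0 * D\<close> removes the term \<open>\<beta>\<close>; what is left is the term
          \<open>\<beta>'\<close>, a unit, up to small terms.\<close>
      have "y0 * D - of_nat (e \<beta>) * F y0 = (\<Sum>\<alpha>\<in>A. b \<alpha> * y0 ^ e \<alpha> * (of_nat (e \<alpha>) - of_nat (e \<beta>)))"
      proof -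
        have "y0 * D = (\<Sum>\<alpha>\<in>A. b \<alpha> * (y0 * (of_nat (e \<alpha>) * y0 ^ (e \<alpha> - 1))))"
          unfolding D_def sum_distrib_left by (intro sum.cong) (auto simp: algebra_simps)
        then show ?thesis unfolding pw F_def sum_distrib_left
          by (simp add: algebra_simps sum.distrib sum_subtractf)
      qed
      also have "\<dots> = b \<beta>' * y0 ^ e \<beta>' * of_nat \<gamma> +
          (\<Sum>\<alpha>\<in>A - {\<beta>, \<beta>'}. b \<alpha> * y0 ^ e \<alpha> * (of_nat (e \<alpha>) - of_nat (e \<beta>)))"
        using less by (subst split) (simp add: \<gamma>_def of_nat_diff)
      finally have eq: "y0 * D - b \<beta>' * y0 ^ e \<beta>' * of_nat \<gamma> = of_nat (e \<beta>) * F y0 +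
          (\<Sum>\<alpha>\<in>A - {\<beta>, \<beta>'}. b \<alpha> * y0 ^ e \<alpha> * (of_nat (e \<alpha>) - of_nat (e \<beta>)))"
        by (simp add: algebra_simps)
      have "b \<alpha> * y0 ^ e \<alpha> * (of_nat (e \<alpha>) - of_nat (e \<beta>)) \<in> frac_ideal 1" if "\<alpha> \<in> A - {\<beta>, \<beta>'}" for \<alpha>
      proof -
        have "y0 ^ e \<alpha> * (of_nat (e \<alpha>) - of_nat (e \<beta>)) \<in> frac_ideal 0"
          by (intro frac_ideal_0_mult frac_ideal_diff frac_ideal_0_power y00 frac_ideal_of_nat)
        from frac_ideal_0_mult[OF this small[of \<alpha>]] that show ?thesis by (simp add: algebra_simps)
      qed
      then have "y0 * D - b \<beta>' * y0 ^ e \<beta>' * of_nat \<gamma> \<in> frac_ideal 1"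
        unfolding eq using root
        by (intro frac_ideal_add[OF frac_ideal_0_mult[OF frac_ideal_of_nat]] frac_ideal_sum)
      moreover have "b \<beta>' * y0 ^ e \<beta>' * of_nat \<gamma> \<in> unit_elements"
        using b y0 unit by (simp add: \<gamma>_def unit_elements_mult unit_elements_power)
      ultimately have "y0 * D \<in> unit_elements" using unit_elements_cong by blast
      then show ?thesis using y0 by (auto simp: unit_elements_iff ord_mult)
    qed
  qed
  show ?thesis unfolding \<gamma>_def[symmetric] F_def[symmetric]
  proof (rule bij_betwI')
    fix x y assume x: "x \<in> {y \<in> unit_elements. F y = 0}" and y: "y \<in> {y \<in> unit_elements. F y = 0}"
    show "residue x = residue y \<longleftrightarrow> x = y"
    proof
      assume "residue x = residue y"
      then have "x - y \<in> frac_ideal 1" "y - y \<in> frac_ideal 1" by (simp_all add: residue_eq_iff)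
      then show "x = y" using hensel[of y] x y
          by (metis (mono_tags, lifting) frac_ideal_zero mem_Collect_eq)
    qed simp
  next
    fix x assume "x \<in> {y \<in> unit_elements. F y = 0}"
    then show "residue x \<in> residue_binomial_roots v \<gamma> (residue (b \<beta>'), residue (b \<beta>))"
      using F_mod[of x] by simp
  next
    fix d assume d: "d \<in> residue_binomial_roots v \<gamma> (residue (b \<beta>'), residue (b \<beta>))"
    then obtain y0 where y0: "d = residue y0" "y0 \<in> unit_elements"
      by (auto simp: residue_binomial_roots_def Units_residue_field)
    then obtain y where "y - y0 \<in> frac_ideal 1" "F y = 0" using hensel[of y0] F_mod[of y0] d by blast
    then show "\<exists>x\<in>{y \<in> unit_elements. F y = 0}. d = residue x"
      using y0 unit_elements_cong[of y0 y] residue_eq_iff[of y y0] by (intro bexI[of _ y]) auto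
  qed
qed

text \<open>Substituting \<open>x = \<pi>\<^sup>s y\<close> and dividing by \<open>\<pi>\<^sup>\<mu>\<close>, where \<open>\<mu>\<close> is the smallest valuation of a
term, gives, up to a power of \<open>y\<close>, a polynomial whose relevant roots \<open>y\<close> are units and whose
coefficients are integral, with exactly the two coefficients of the edge being units.\<close>

lemma card_roots_of_ord:
  assumes fin: "finite A" and \<beta>: "\<beta> \<in> A" "\<beta>' \<in> A" and less: "\<beta> < \<beta>'"
    and nz: "\<And>\<alpha>. \<alpha> \<in> A \<Longrightarrow> a \<alpha> \<noteq> 0"
    and eq: "ord (a \<beta>) + s * \<beta> = \<mu>" "ord (a \<beta>') + s * \<beta>' = \<mu>"
    and above: "\<And>\<alpha>. \<alpha> \<in> A \<Longrightarrow> \<alpha> \<noteq> \<beta> \<Longrightarrow> \<alpha> \<noteq> \<beta>' \<Longrightarrow> \<mu> < ord (a \<alpha>) + s * \<alpha>"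
    and unit: "of_nat (nat (\<beta>' - \<beta>)) \<in> unit_elements"
  shows "card {x \<in> nonzero_roots A a. ord x = s} = card (residue_binomial_roots v (nat (\<beta>' - \<beta>))
     (residue (a \<beta>' * \<pi> powi (- ord (a \<beta>'))), residue (a \<beta> * \<pi> powi (- ord (a \<beta>)))))"
proof -
  define m where "m = Min A"
  have m: "m \<le> \<alpha>" if "\<alpha> \<in> A" for \<alpha> using fin that by (simp add: m_def)
  define e where "e \<alpha> = nat (\<alpha> - m)" for \<alpha>
  define b where "b \<alpha> = a \<alpha> * \<pi> powi (s * \<alpha> - \<mu>)" for \<alpha>
  have ob: "b \<alpha> \<noteq> 0" "ord (b \<alpha>) = ord (a \<alpha>) + s * \<alpha> - \<mu>" if "\<alpha> \<in> A" for \<alpha>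
    using nz[OF that] pi_nonzero by (auto simp: b_def ord_mult ord_powi power_int_eq_0_iff)
  have ee: "e \<beta>' - e \<beta> = nat (\<beta>' - \<beta>)" using m[OF \<beta>(1)] m[OF \<beta>(2)] less by (simp add: e_def)
  have bij1: "bij_betw residue {y \<in> unit_elements. (\<Sum>\<alpha>\<in>A. b \<alpha> * y ^ e \<alpha>) = 0}
           (residue_binomial_roots v (e \<beta>' - e \<beta>) (residue (b \<beta>'), residue (b \<beta>)))"
  proof (rule bij_betw_unit_roots_residue_roots[OF fin \<beta>])
    show "e \<beta> < e \<beta>'" using m[OF \<beta>(1)] less by (simp add: e_def)
    show "b \<beta> \<in> unit_elements" "b \<beta>' \<in> unit_elements" using ob \<beta> eq by (auto simp: unit_elements_iff)
    show "b \<alpha> \<in> frac_ideal 1" if "\<alpha> \<in> A" "\<alpha> \<noteq> \<beta>" "\<alpha> \<noteq> \<beta>'" for \<alpha>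
      using ob[OF that(1)] above[OF that] by (simp add: frac_ideal_def)
    show "of_nat (e \<beta>' - e \<beta>) \<in> unit_elements" using unit ee by simp
  qed
  have scale: "(\<Sum>\<alpha>\<in>A. a \<alpha> * (\<pi> powi s * y) powi \<alpha>) = \<pi> powi \<mu> * y powi m * (\<Sum>\<alpha>\<in>A. b \<alpha> * y ^ e \<alpha>)"
    if "y \<noteq> 0" for y
    unfolding sum_distrib_left
  proof (rule sum.cong[OF refl])
    fix \<alpha> assume "\<alpha> \<in> A"
    have "\<pi> powi (s * \<alpha>) = \<pi> powi \<mu> * \<pi> powi (s * \<alpha> - \<mu>)"
      using pi_nonzero by (subst power_int_add[symmetric]) auto
    then show "a \<alpha> * (\<pi> powi s * y) powi \<alpha> = \<pi> powi \<mu> * y powi m * (b \<alpha> * y ^ e \<alpha>)"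
      using powi_shift[OF that m[OF \<open>\<alpha> \<in> A\<close>]]
      by (simp add: b_def e_def power_int_mult_distrib power_int_mult[symmetric])
  qed
  have pis: "\<pi> powi s \<noteq> 0" "ord (\<pi> powi s) = s" using pi_nonzero
      by (simp_all add: ord_powi power_int_eq_0_iff)
  have bij2: "bij_betw (\<lambda>y. \<pi> powi s * y) {y \<in> unit_elements. (\<Sum>\<alpha>\<in>A. b \<alpha> * y ^ e \<alpha>) = 0}
      {x \<in> nonzero_roots A a. ord x = s}"
  proof (rule bij_betw_byWitness[where f' = "\<lambda>x. x / \<pi> powi s"])
    show "(\<lambda>y. \<pi> powi s * y) ` {y \<in> unit_elements. (\<Sum>\<alpha>\<in>A. b \<alpha> * y ^ e \<alpha>) = 0}
        \<subseteq> {x \<in> nonzero_roots A a. ord x = s}"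
      using scale pis by (auto simp: nonzero_roots_def unit_elements_iff ord_mult)
    show "(\<lambda>x. x / \<pi> powi s) ` {x \<in> nonzero_roots A a. ord x = s}
       \<subseteq> {y \<in> unit_elements. (\<Sum>\<alpha>\<in>A. b \<alpha> * y ^ e \<alpha>) = 0}"
    proof clarify
      fix x assume x: "x \<in> nonzero_roots A a" "s = ord x"
      let ?y = "x / \<pi> powi ord x"
      have x0: "x \<noteq> 0" using x by (simp add: nonzero_roots_def)
      have xy: "\<pi> powi ord x * ?y = x" "?y \<noteq> 0" using pis x0 x by auto
      have "ord x + ord ?y = ord x" using ord_mult[OF _ xy(2), of "\<pi> powi ord x"] xy pis x(2) by simp
      moreover have "\<pi> powi \<mu> * ?y powi m * (\<Sum>\<alpha>\<in>A. b \<alpha> * ?y ^ e \<alpha>) = 0"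
        using scale[OF xy(2)] xy(1) x by (simp add: nonzero_roots_def)
      then have "(\<Sum>\<alpha>\<in>A. b \<alpha> * ?y ^ e \<alpha>) = 0"
        using pi_nonzero xy(2) by (simp add: power_int_eq_0_iff)
      ultimately show "?y \<in> unit_elements \<and> (\<Sum>\<alpha>\<in>A. b \<alpha> * ?y ^ e \<alpha>) = 0"
        using xy by (simp add: unit_elements_iff)
    qed
  qed (use pis in auto)
  have "s * \<beta> - \<mu> = - ord (a \<beta>)" "s * \<beta>' - \<mu> = - ord (a \<beta>')" using eq by auto
  then have "b \<beta> = a \<beta> * \<pi> powi (- ord (a \<beta>))" "b \<beta>' = a \<beta>' * \<pi> powi (- ord (a \<beta>'))"
    by (simp_all add: b_def)
  with bij_betw_same_card[OF bij1] bij_betw_same_card[OF bij2] show ?thesis by (simp add: ee)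
qed

text \<open>Lifting \<open>d\<close> and \<open>d'\<close> to the field turns the residue roots into roots of a binomial over
the field, of which there are at most \<open>\<gamma>\<close>.\<close>

lemma residue_binomial_root_count_le:
  assumes "\<gamma> > 0" and unit: "of_nat \<gamma> \<in> unit_elements" and "d \<in> Units (residue_field v)"
      "d' \<in> Units (residue_field v)"
  shows "residue_root_count v \<gamma> (d, d') \<le> real \<gamma>"
proof -
  obtain r r' where r: "d = residue r" "r \<in> unit_elements" "d' = residue r'" "r' \<in> unit_elements"
    using assms by (auto simp: Units_residue_field)
  define A where "A = {0, int \<gamma>}"
  define a where "a \<alpha> = (if \<alpha> = 0 then r' else r)" for \<alpha> :: int
  have rr: "r \<noteq> 0" "r' \<noteq> 0" "ord r = 0" "ord r' = 0" using r by (auto simp: unit_elements_iff)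
  have "card {x \<in> nonzero_roots A a. ord x = 0} = card (residue_binomial_roots v (nat (int \<gamma> - 0))
     (residue (a (int \<gamma>) * \<pi> powi (- ord (a (int \<gamma>)))), residue (a 0 * \<pi> powi (- ord (a 0)))))"
    by (rule card_roots_of_ord[where \<mu> = 0]) (use assms(1) unit rr in \<open>auto simp: A_def a_def\<close>)
  also have "\<dots> = card (residue_binomial_roots v \<gamma> (d, d'))"
    using r \<open>\<gamma> > 0\<close> by (simp add: a_def unit_elements_iff)
  finally have *: "card {x \<in> nonzero_roots A a. ord x = 0} = card (residue_binomial_roots v \<gamma> (d, d'))" .
  have A: "finite A" "A \<noteq> {}" "a \<alpha> \<noteq> 0" "Max A - Min A = int \<gamma>" for \<alpha>
    using r by (auto simp: A_def a_def unit_elements_iff)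
  have "card {x \<in> nonzero_roots A a. ord x = 0} \<le> card (nonzero_roots A a)"
    by (rule card_mono[OF finite_nonzero_roots]) (use A in auto)
  also have "\<dots> \<le> nat (Max A - Min A)" by (rule card_nonzero_roots_le) (use A in auto)
  finally show ?thesis using A * by (simp add: residue_root_count_def)
qed

text \<open>A term that alone has the smallest valuation cannot be cancelled by the others.\<close>

lemma root_has_two_minimal_terms:
  assumes fin: "finite A" and nz: "\<And>\<alpha>. \<alpha> \<in> A \<Longrightarrow> a \<alpha> \<noteq> 0" and ne: "A \<noteq> {}"
    and x: "x \<in> nonzero_roots A a"
  obtains \<beta> \<beta>' where "\<beta> \<in> A" "\<beta>' \<in> A" "\<beta> < \<beta>'"
    "ord (a \<beta>) + ord x * \<beta> = ord (a \<beta>') + ord x * \<beta>'"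
    "\<And>\<alpha>. \<alpha> \<in> A \<Longrightarrow> ord (a \<beta>) + ord x * \<beta> \<le> ord (a \<alpha>) + ord x * \<alpha>"
proof -
  define h where "h \<alpha> = ord (a \<alpha>) + ord x * \<alpha>" for \<alpha>
  have x0: "x \<noteq> 0" and root: "(\<Sum>\<alpha>\<in>A. a \<alpha> * x powi \<alpha>) = 0" using x by (auto simp: nonzero_roots_def)
  have oh: "ord (a \<alpha> * x powi \<alpha>) = h \<alpha>" "a \<alpha> * x powi \<alpha> \<noteq> 0" if "\<alpha> \<in> A" for \<alpha>
    using nz[OF that] x0 by (auto simp: h_def ord_mult ord_powi power_int_eq_0_iff mult.commute)
  have "Min (h ` A) \<in> h ` A" using fin ne by (intro Min_in) auto
  then obtain \<beta> where \<beta>: "\<beta> \<in> A" "h \<beta> = Min (h ` A)" by auto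
  have min: "h \<beta> \<le> h \<alpha>" if "\<alpha> \<in> A" for \<alpha> using fin that \<beta>(2) by simp
  have "\<exists>\<beta>'\<in>A. \<beta>' \<noteq> \<beta> \<and> h \<beta>' = h \<beta>"
  proof (rule ccontr)
    assume "\<not> ?thesis"
    then have "h \<beta> + 1 \<le> h \<alpha>" if "\<alpha> \<in> A - {\<beta>}" for \<alpha> using min[of \<alpha>] that by force
    then have "(\<Sum>\<alpha>\<in>A - {\<beta>}. a \<alpha> * x powi \<alpha>) \<in> frac_ideal (h \<beta> + 1)"
      by (intro frac_ideal_sum) (auto simp: frac_ideal_def oh)
    moreover have "a \<beta> * x powi \<beta> = - (\<Sum>\<alpha>\<in>A - {\<beta>}. a \<alpha> * x powi \<alpha>)"
      using root sum.remove[OF fin \<beta>(1), of "\<lambda>\<alpha>. a \<alpha> * x powi \<alpha>"] by (simp add: eq_neg_iff_add_eq_0)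
    ultimately have "a \<beta> * x powi \<beta> \<in> frac_ideal (h \<beta> + 1)" using frac_ideal_minus by simp
    then show False using oh[OF \<beta>(1)] by (simp add: frac_ideal_def)
  qed
  then obtain \<beta>' where "\<beta>' \<in> A" "\<beta>' \<noteq> \<beta>" "h \<beta>' = h \<beta>" by blast
  then show ?thesis using that[of \<beta> \<beta>'] that[of \<beta>' \<beta>] \<beta>(1) min
    unfolding h_def by (cases "\<beta> < \<beta>'") auto
qed

end

section \<open>Roots and edges of the Newton polygon\<close>

definition ordered_pairs :: "int set \<Rightarrow> (int \<times> int) set" where
  "ordered_pairs A = {(\<beta>, \<beta>'). \<beta> \<in> A \<and> \<beta>' \<in> A \<and> \<beta> < \<beta>'}"

lemma finite_ordered_pairs: "finite A \<Longrightarrow> finite (ordered_pairs A)"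
  by (rule finite_subset[of _ "A \<times> A"]) (auto simp: ordered_pairs_def)

lemma chord_integer_slope:
  assumes ne: "\<beta> \<noteq> \<beta>'" and slope: "n \<beta> + s * \<beta> = n \<beta>' + s * \<beta>'"
  shows "chord (\<lambda>\<alpha>. real_of_int (n \<alpha>)) \<beta> \<beta>' \<alpha> = of_int (n \<beta> + s * \<beta> - s * \<alpha>)"
proof -
  have "chord (\<lambda>\<alpha>. real_of_int (n \<alpha>) + (real_of_int s * of_int \<alpha> + 0)) \<beta> \<beta>' \<alpha> =
      chord (\<lambda>\<alpha>. real_of_int (n \<alpha>)) \<beta> \<beta>' \<alpha> + (real_of_int s * of_int \<alpha> + 0)"
    by (rule chord_add_linear[OF ne])
  moreover have "chord (\<lambda>\<alpha>. real_of_int (n \<alpha>) + (real_of_int s * of_int \<alpha> + 0)) \<beta> \<beta>' \<alpha> =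
      of_int (n \<beta> + s * \<beta>)"
  proof -
    have "real_of_int (n \<beta>) + (real_of_int s * of_int \<beta> + 0) = of_int (n \<beta> + s * \<beta>)"
      "real_of_int (n \<beta>') + (real_of_int s * of_int \<beta>' + 0) = of_int (n \<beta>' + s * \<beta>')"
      by simp_all
    then show ?thesis unfolding chord_def slope[symmetric] by simp
  qed
  ultimately show ?thesis by simp
qed

lemma is_edge_integer_slope:
  assumes "\<beta> \<noteq> \<beta>'" and "n \<beta> + s * \<beta> = n \<beta>' + s * \<beta>'"
  shows "is_edge A (\<lambda>\<alpha>. real_of_int (n \<alpha>)) \<beta> \<beta>' \<longleftrightarrow>
    (\<forall>\<alpha>\<in>A. \<alpha> \<noteq> \<beta> \<longrightarrow> \<alpha> \<noteq> \<beta>' \<longrightarrow> n \<beta> + s * \<beta> < n \<alpha> + s * \<alpha>)"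
proof -
  have "n \<beta> + s * \<beta> - s * \<alpha> < n \<alpha> \<longleftrightarrow> n \<beta> + s * \<beta> < n \<alpha> + s * \<alpha>" for \<alpha> by linarith
  then show ?thesis
    unfolding is_edge_def chord_integer_slope[of \<beta> \<beta>' n s, OF assms] of_int_less_iff by auto
qed

context complete_discretely_valued_field
begin

definition first_digit :: "'a \<Rightarrow> 'a set" where
  "first_digit x = residue (x * \<pi> powi (- ord x))"

text \<open>Roots are sorted by the two terms of smallest valuation, which form an edge whose slope is
the negative of \<open>ord x\<close>; in particular this slope is integral. The edge is determined by the
slope, because its end points are exactly the exponents where \<open>ord (a \<alpha>) + ord x * \<alpha>\<close> is
minimal, so the classes are disjoint, and each of them is counted over the residue field.\<close>

lemma card_nonzero_roots_generic:
  fixes a :: "int \<Rightarrow> 'a"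
  defines "w \<equiv> \<lambda>\<alpha>. real_of_int (ord (a \<alpha>))"
  assumes fin: "finite A" and nz: "\<And>\<alpha>. \<alpha> \<in> A \<Longrightarrow> a \<alpha> \<noteq> 0" and ne: "A \<noteq> {}"
    and gen: "generic A w"
    and unit: "\<And>\<beta> \<beta>'. (\<beta>, \<beta>') \<in> ordered_pairs A \<Longrightarrow> of_nat (nat (\<beta>' - \<beta>)) \<in> unit_elements"
  shows "card (nonzero_roots A a) = (\<Sum>(\<beta>, \<beta>') \<in> ordered_pairs A.
     if is_edge A w \<beta> \<beta>' \<and> \<beta>' - \<beta> dvd ord (a \<beta>') - ord (a \<beta>)
     then card (residue_binomial_roots v (nat (\<beta>' - \<beta>)) (first_digit (a \<beta>'), first_digit (a \<beta>))) else 0)"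
proof -
  define E where "E = {p \<in> ordered_pairs A. is_edge A w (fst p) (snd p) \<and>
      snd p - fst p dvd ord (a (snd p)) - ord (a (fst p))}"
  define slope where "slope p = - ((ord (a (snd p)) - ord (a (fst p))) div (snd p - fst p))" for p
  define R where "R p = {x \<in> nonzero_roots A a. ord x = slope p}" for p
  have finE: "finite E" unfolding E_def using finite_ordered_pairs[OF fin] by simp
  have E: "fst p \<in> A" "snd p \<in> A" "fst p < snd p"
      "ord (a (fst p)) + slope p * fst p = ord (a (snd p)) + slope p * snd p"
    "\<And>\<alpha>. \<alpha> \<in> A \<Longrightarrow> \<alpha> \<noteq> fst p \<Longrightarrow> \<alpha> \<noteq> snd p \<Longrightarrow> ord (a (fst p)) + slope p * fst p < ord (a \<alpha>) + slope p * \<alpha>"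
    if "p \<in> E" for p
  proof -
    obtain \<beta> \<beta>' where p: "p = (\<beta>, \<beta>')" by force
    have q: "\<beta> \<in> A" "\<beta>' \<in> A" "\<beta> < \<beta>'" "is_edge A w \<beta> \<beta>'" "\<beta>' - \<beta> dvd ord (a \<beta>') - ord (a \<beta>)"
      using that by (auto simp: p E_def ordered_pairs_def)
    have "ord (a \<beta>') - ord (a \<beta>) = - slope p * (\<beta>' - \<beta>)" using q(5) by (simp add: slope_def p)
    then have eq: "ord (a \<beta>) + slope p * \<beta> = ord (a \<beta>') + slope p * \<beta>'" by (simp add: algebra_simps)
    show "fst p \<in> A" "snd p \<in> A" "fst p < snd p"
        "ord (a (fst p)) + slope p * fst p = ord (a (snd p)) + slope p * snd p"
      using q eq by (auto simp: p)
    show "\<And>\<alpha>. \<alpha> \<in> A \<Longrightarrow> \<alpha> \<noteq> fst p \<Longrightarrow> \<alpha> \<noteq> snd p \<Longrightarrow> ord (a (fst p)) + slope p * fst p < ord (a \<alpha>) + slope p * \<alpha>"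
      using is_edge_integer_slope[of \<beta> \<beta>' "\<lambda>\<alpha>. ord (a \<alpha>)" "slope p" A] q eq unfolding w_def
          by (auto simp: p)
  qed
  have cover: "nonzero_roots A a = (\<Union>p\<in>E. R p)"
  proof (intro equalityI subsetI)
    fix x assume x: "x \<in> nonzero_roots A a"
    obtain \<beta> \<beta>' where b: "\<beta> \<in> A" "\<beta>' \<in> A" "\<beta> < \<beta>'"
      "ord (a \<beta>) + ord x * \<beta> = ord (a \<beta>') + ord x * \<beta>'"
      "\<And>\<alpha>. \<alpha> \<in> A \<Longrightarrow> ord (a \<beta>) + ord x * \<beta> \<le> ord (a \<alpha>) + ord x * \<alpha>"
      using root_has_two_minimal_terms[OF fin nz ne x] by metis
    have "ord (a \<beta>) + ord x * \<beta> \<noteq> ord (a \<alpha>) + ord x * \<alpha>" if "\<alpha> \<in> A" "\<alpha> \<noteq> \<beta>" "\<alpha> \<noteq> \<beta>'" for \<alpha>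
    proof -
      have "chord w \<beta> \<beta>' \<alpha> \<noteq> w \<alpha>" using gen b that unfolding generic_def by auto
      moreover have "chord w \<beta> \<beta>' \<alpha> = of_int (ord (a \<beta>) + ord x * \<beta> - ord x * \<alpha>)"
        unfolding w_def using b(3,4) by (intro chord_integer_slope) auto
      ultimately have "ord (a \<beta>) + ord x * \<beta> - ord x * \<alpha> \<noteq> ord (a \<alpha>)" by (metis w_def)
      then show ?thesis by linarith
    qed
    then have "is_edge A w \<beta> \<beta>'"
      unfolding w_def using b by (subst is_edge_integer_slope[where s =
          "ord x"]) (auto simp: order.order_iff_strict)
    moreover have diff: "ord (a \<beta>') - ord (a \<beta>) = (- ord x) * (\<beta>' - \<beta>)" using b(4)
        by (simp add: algebra_simps)
    ultimately have "(\<beta>, \<beta>') \<in> E" using b by (auto simp: E_def ordered_pairs_def)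
    moreover have "(- ord x) * (\<beta>' - \<beta>) div (\<beta>' - \<beta>) = - ord x"
      by (rule nonzero_mult_div_cancel_right) (use b(3) in simp)
    then have "slope (\<beta>, \<beta>') = ord x" unfolding slope_def fst_conv snd_conv diff by simp
    ultimately show "x \<in> (\<Union>p\<in>E. R p)" using x by (force simp: R_def)
  qed (auto simp: R_def)
  have disj: "p = q" if p: "p \<in> E" and q: "q \<in> E" and s: "slope p = slope q" for p q
  proof -
    let ?h = "\<lambda>\<alpha>. ord (a \<alpha>) + slope p * \<alpha>"
    have "{fst p', snd p'} = {\<alpha> \<in> A. \<forall>\<alpha>'\<in>A. ?h \<alpha> \<le> ?h \<alpha>'}" if p': "p' \<in> E" "slope p' = slope p" for p'
    proof -
      note e = E[OF p'(1), unfolded p'(2)]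
      have "?h (fst p') \<le> ?h \<alpha>'" if "\<alpha>' \<in> A" for \<alpha>'
        using e(4) e(5)[OF that] by (cases "\<alpha>' = fst p' \<or> \<alpha>' = snd p'") auto
      moreover have "\<alpha> = fst p' \<or> \<alpha> = snd p'" if "\<alpha> \<in> A" "?h \<alpha> \<le> ?h (fst p')" for \<alpha>
        using e(5)[OF that(1)] that(2) by linarith
      ultimately show ?thesis using e(1,2,4) by (intro equalityI subsetI) auto
    qed
    from this[OF p refl] this[OF q s[symmetric]] have "{fst p, snd p} = {fst q, snd q}" by simp
    then show ?thesis using E(3)[OF p] E(3)[OF q] by (auto simp: doubleton_eq_iff prod_eq_iff)
  qed
  have "card (nonzero_roots A a) = (\<Sum>p\<in>E. card (R p))"
    unfolding cover
  proof (rule card_UN_disjoint[OF finE])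
    show "\<forall>p\<in>E. finite (R p)" unfolding R_def using finite_nonzero_roots[OF fin ne nz] by simp
    show "\<forall>p\<in>E. \<forall>q\<in>E. p \<noteq> q \<longrightarrow> R p \<inter> R q = {}" using disj by (auto simp: R_def)
  qed
  also have "\<dots> = (\<Sum>p\<in>E. card (residue_binomial_roots v (nat (snd p - fst p)) (first_digit (a (snd p)),
      first_digit (a (fst p)))))"
  proof (rule sum.cong[OF refl])
    fix p assume p: "p \<in> E"
    then have "of_nat (nat (snd p - fst p)) \<in> unit_elements" using unit by (auto simp: E_def)
    from card_roots_of_ord[OF fin E(1-3)[OF p] nz refl E(4)[OF p, symmetric] E(5)[OF p] this]
    show "card (R p) = card (residue_binomial_roots v (nat (snd p - fst p)) (first_digit (a (snd p)),
        first_digit (a (fst p))))"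
      unfolding R_def first_digit_def .
  qed
  also have "\<dots> = (\<Sum>(\<beta>, \<beta>') \<in> ordered_pairs A.
     if is_edge A w \<beta> \<beta>' \<and> \<beta>' - \<beta> dvd ord (a \<beta>') - ord (a \<beta>)
     then card (residue_binomial_roots v (nat (\<beta>' - \<beta>)) (first_digit (a \<beta>'), first_digit (a \<beta>))) else 0)"
    using finite_ordered_pairs[OF fin] unfolding E_def
    by (intro sum.mono_neutral_cong_left) (auto split: if_splits)
  finally show ?thesis .
qed

lemma element_of_properties:
  fixes n :: int
  assumes \<Delta>: "digit_representatives v \<Delta>" and d: "d \<in> Units (residue_field v)" and e: "e \<in> one_units v"
  defines "x \<equiv> element_of v \<pi> \<Delta> (step * of_int n, d, e)"
  shows "x \<noteq> 0" "ord x = n" "first_digit x = d"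
proof -
  define r where "r = (THE r. r \<in> \<Delta> \<inter> d)"
  have "\<exists>!r. r \<in> \<Delta> \<inter> d" using \<Delta> d by (simp add: digit_representatives_def)
  then have "r \<in> \<Delta> \<inter> d" unfolding r_def by (rule theI')
  then have r: "r \<in> d" "r \<in> unit_elements"
    using \<Delta> by (auto simp: digit_representatives_def carrier_valuation_ring valuation_ideal_eq
        unit_elements_def)
  obtain y where y: "d = residue y" "y \<in> unit_elements" using d by (auto simp: Units_residue_field)
  have dr: "d = residue r" using r(1) unfolding y residue_eq_iff
      by (simp add: residue_eq) (metis frac_ideal_minus minus_diff_eq)
  obtain m where m: "e = 1 + m" "m \<in> frac_ideal 1" using e by (auto simp: one_units_def valuation_ideal_eq)
  have e1: "e \<in> unit_elements" by (rule unit_elements_cong[of 1]) (use m in \<open>auto simp: unit_elements_iff\<close>)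
  have re: "r * e \<in> unit_elements" using r e1 by (simp add: unit_elements_mult)
  have x: "x = \<pi> powi n * (r * e)"
    unfolding x_def element_of_def prod.case r_def[symmetric] step_def[symmetric] using step_pos by simp
  show x0: "x \<noteq> 0" and ox: "ord x = n"
    using re pi_nonzero by (auto simp: x unit_elements_iff ord_mult ord_powi power_int_eq_0_iff)
  have "first_digit x = residue (r * e)"
    unfolding first_digit_def ox using pi_nonzero by (simp add: x power_int_minus field_simps)
  also have "\<dots> = residue r"
    unfolding residue_eq_iff using frac_ideal_0_mult[OF unit_elements_frac_ideal[OF r(2)] m(2)]
        by (simp add: m algebra_simps)
  finally show "first_digit x = d" using dr by simp
qed

end

section \<open>Independence of heights and digits\<close>

text \<open>Conditioned on the heights being \<open>m\<close>, an event of probability \<open>1 / card V ^ card A\<close>, the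
pair of digits at \<open>\<beta>'\<close> and \<open>\<beta>\<close> is distributed according to \<open>D1 \<Otimes>\<^sub>M D1\<close>: on rectangles the event
is a box in the product space, and rectangles determine the law.\<close>

lemma integral_fixed_heights:
  fixes V :: "real set" and D1 :: "'b measure" and D2 :: "'c measure"
    and \<psi> :: "'b \<times> 'b \<Rightarrow> real" and m :: "'i \<Rightarrow> real"
  assumes fin: "finite A" and mem: "\<beta> \<in> A" "\<beta>' \<in> A" and ne: "\<beta> \<noteq> \<beta>'"
    and V: "finite V" "V \<noteq> {}" and D1: "prob_space D1" and D2: "prob_space D2"
    and m: "\<And>\<alpha>. \<alpha> \<in> A \<Longrightarrow> m \<alpha> \<in> V"
    and \<psi>: "\<psi> \<in> borel_measurable (D1 \<Otimes>\<^sub>M D1)"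
  defines "P \<equiv> \<Pi>\<^sub>M \<alpha>\<in>A. uniform_count_measure V \<Otimes>\<^sub>M (D1 \<Otimes>\<^sub>M D2)"
  shows "(\<integral>f. of_bool (\<forall>\<alpha>\<in>A. fst (f \<alpha>) = m \<alpha>) * \<psi> (fst (snd (f \<beta>')), fst (snd (f \<beta>))) \<partial>P) =
    (\<integral>p. \<psi> p \<partial>(D1 \<Otimes>\<^sub>M D1)) / real (card V) ^ card A"
proof -
  interpret D1: prob_space D1 by fact
  interpret D2: prob_space D2 by fact
  interpret DD: pair_prob_space D1 D2 by standard
  let ?U = "uniform_count_measure V"
  interpret U: prob_space ?U by (rule prob_space_uniform_count_measure[OF V])
  interpret L: pair_prob_space ?U "D1 \<Otimes>\<^sub>M D2" by standard
  let ?L = "?U \<Otimes>\<^sub>M (D1 \<Otimes>\<^sub>M D2)"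
  interpret product_sigma_finite "\<lambda>_::'i. ?L" by standard
  define c where "c = real (card V) ^ card A"
  have cV: "card V > 0" using V by (simp add: card_gt_0_iff)
  have c: "c > 0" using cV by (simp add: c_def)
  let ?E = "\<lambda>f. \<forall>\<alpha>\<in>A. fst (f \<alpha>) = m \<alpha>"
  let ?T = "\<lambda>f. (fst (snd (f \<beta>')), fst (snd (f \<beta>)))"
  have compm: "(\<lambda>f. f \<alpha>) \<in> P \<rightarrow>\<^sub>M ?L" if "\<alpha> \<in> A" for \<alpha>
    unfolding P_def using that by (rule measurable_component_singleton)
  have Tm: "?T \<in> P \<rightarrow>\<^sub>M D1 \<Otimes>\<^sub>M D1"
    using compm[OF mem(1)] compm[OF mem(2)] by measurable
  have boxset: "(\<Pi>\<^sub>E \<alpha>\<in>A. {m \<alpha>} \<times> (X \<alpha> \<times> space D2)) \<in> sets P" if "\<And>\<alpha>. X \<alpha> \<in> sets D1" for X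
    unfolding P_def using fin m that V
        by (intro sets_PiM_I_finite pair_measureI) (auto simp: sets_uniform_count_measure)
  have spaceP: "space P = (\<Pi>\<^sub>E \<alpha>\<in>A. V \<times> (space D1 \<times> space D2))"
    by (simp add: P_def space_PiM space_pair_measure space_uniform_count_measure)
  have Eset: "{f \<in> space P. ?E f} \<in> sets P"
  proof -
    have "{f \<in> space P. ?E f} = (\<Pi>\<^sub>E \<alpha>\<in>A. {m \<alpha>} \<times> (space D1 \<times> space D2))"
      unfolding spaceP using m by (auto simp: PiE_iff mem_Times_iff extensional_def)
    then show ?thesis using boxset[of "\<lambda>_. space D1"] by simp
  qed
  define g where "g f = c * of_bool (?E f)" for f :: "'i \<Rightarrow> real \<times> 'b \<times> 'c"
  have gm: "g \<in> borel_measurable P"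
  proof -
    have "Measurable.pred P ?E" using Eset by (simp add: pred_def)
    then show ?thesis unfolding g_def[abs_def] of_bool_def by measurable
  qed
  have g0: "g f \<ge> 0" for f using c by (simp add: g_def)
  \<comment> \<open>The conditional law of the pair of digits.\<close>
  define M where "M = distr (density P (\<lambda>f. ennreal (g f))) (D1 \<Otimes>\<^sub>M D1) ?T"
  have "D1 \<Otimes>\<^sub>M D1 = M"
  proof (rule pair_measure_eqI)
    show "sigma_finite_measure D1" "sigma_finite_measure D1" by unfold_locales
    show "sets (D1 \<Otimes>\<^sub>M D1) = sets M" by (simp add: M_def)
    fix X Y assume XY: "X \<in> sets D1" "Y \<in> sets D1"
    define W where "W \<alpha> = (if \<alpha> = \<beta>' then X else if \<alpha> = \<beta> then Y else space D1)" for \<alpha>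
    have W: "W \<alpha> \<in> sets D1" for \<alpha> using XY by (simp add: W_def)
    let ?B = "(\<Pi>\<^sub>E \<alpha>\<in>A. {m \<alpha>} \<times> (W \<alpha> \<times> space D2))"
    have Tset: "?T -` (X \<times> Y) \<inter> space P \<in> sets P" using XY Tm by (intro measurable_sets) auto
    have "emeasure M (X \<times> Y) = emeasure (density P (\<lambda>f. ennreal (g f))) (?T -` (X \<times> Y) \<inter> space P)"
      unfolding M_def using Tm XY by (subst emeasure_distr) auto
    also have "\<dots> = (\<integral>\<^sup>+f. ennreal (g f) * indicator (?T -` (X \<times> Y) \<inter> space P) f \<partial>P)"
      using gm Tset by (intro emeasure_density) auto
    also have "\<dots> = (\<integral>\<^sup>+f. ennreal c * indicator ?B f \<partial>P)"
    proof (rule nn_integral_cong)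
      fix f assume f: "f \<in> space P"
      have "f \<in> ?B \<longleftrightarrow> ?E f \<and> ?T f \<in> X \<times> Y"
      proof
        assume "f \<in> ?B"
        then have *: "f \<alpha> \<in> {m \<alpha>} \<times> (W \<alpha> \<times> space D2)" if "\<alpha> \<in> A" for \<alpha> using that by auto
        show "?E f \<and> ?T f \<in> X \<times> Y"
          using * *[OF mem(1)] *[OF mem(2)] ne by (force simp: W_def mem_Times_iff)
      next
        assume a: "?E f \<and> ?T f \<in> X \<times> Y"
        have "f \<alpha> \<in> {m \<alpha>} \<times> (W \<alpha> \<times> space D2)" if "\<alpha> \<in> A" for \<alpha>
          using a f that unfolding spaceP by (auto simp: W_def mem_Times_iff PiE_iff)
        then show "f \<in> ?B" using f unfolding spaceP by (auto simp: PiE_iff extensional_def)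
      qed
      then show "ennreal (g f) * indicator (?T -` (X \<times> Y) \<inter> space P) f = ennreal c * indicator ?B f"
        using f by (simp add: g_def indicator_def)
    qed
    also have "\<dots> = ennreal c * emeasure P ?B" using boxset[OF W] by (simp add: nn_integral_cmult_indicator)
    also have "emeasure P ?B = (\<Prod>\<alpha>\<in>A. emeasure ?L ({m \<alpha>} \<times> (W \<alpha> \<times> space D2)))"
      unfolding P_def using fin m W by (intro emeasure_PiM pair_measureI) (auto simp:
          sets_uniform_count_measure)
    also have "\<dots> = (\<Prod>\<alpha>\<in>A. ennreal (1 / card V) * emeasure D1 (W \<alpha>))"
    proof (rule prod.cong[OF refl])
      fix \<alpha> assume "\<alpha> \<in> A"
      have "emeasure ?L ({m \<alpha>} \<times> (W \<alpha> \<times> space D2)) =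
          emeasure ?U {m \<alpha>} * emeasure (D1 \<Otimes>\<^sub>M D2) (W \<alpha> \<times> space D2)"
        using m[OF \<open>\<alpha> \<in> A\<close>] W
            by (intro DD.emeasure_pair_measure_Times) (auto simp: sets_uniform_count_measure)
      also have "emeasure (D1 \<Otimes>\<^sub>M D2) (W \<alpha> \<times> space D2) = emeasure D1 (W \<alpha>)"
        using W by (subst D2.emeasure_pair_measure_Times) (auto simp: D2.emeasure_space_1)
      also have "emeasure ?U {m \<alpha>} = ennreal (1 / card V)"
        using m[OF \<open>\<alpha> \<in> A\<close>] V by (simp add: emeasure_uniform_count_measure)
      finally show "emeasure ?L ({m \<alpha>} \<times> (W \<alpha> \<times> space D2)) = ennreal (1 / card V) * emeasure D1 (W \<alpha>)" .
    qed
    also have "\<dots> = ennreal (1 / card V) ^ card A * (\<Prod>\<alpha>\<in>A. emeasure D1 (W \<alpha>))"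
      by (simp add: prod.distrib)
    also have "(\<Prod>\<alpha>\<in>A. emeasure D1 (W \<alpha>)) = emeasure D1 X * emeasure D1 Y"
    proof -
      have "(\<Prod>\<alpha>\<in>A. emeasure D1 (W \<alpha>)) = (\<Prod>\<alpha>\<in>{\<beta>, \<beta>'}. emeasure D1 (W \<alpha>))"
        using fin mem by (intro prod.mono_neutral_right) (auto simp: W_def D1.emeasure_space_1)
      then show ?thesis using ne by (simp add: W_def mult.commute)
    qed
    also have "ennreal c * (ennreal (1 / card V) ^ card A * (emeasure D1 X * emeasure D1 Y)) =
        emeasure D1 X * emeasure D1 Y"
    proof -
      have "ennreal c * ennreal (1 / card V) ^ card A = ennreal (c * (1 / card V) ^ card A)"
        using c by (simp add: ennreal_power ennreal_mult)
      also have "c * (1 / card V) ^ card A = 1" using cV by (simp add: c_def power_divide)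
      finally show ?thesis by (simp add: mult.assoc[symmetric])
    qed
    finally show "emeasure D1 X * emeasure D1 Y = emeasure M (X \<times> Y)" by simp
  qed
  then have "(\<integral>p. \<psi> p \<partial>(D1 \<Otimes>\<^sub>M D1)) = (\<integral>p. \<psi> p \<partial>M)" by (rule arg_cong)
  also have "\<dots> = (\<integral>f. \<psi> (?T f) \<partial>density P (\<lambda>f. ennreal (g f)))"
    unfolding M_def using Tm \<psi> by (intro integral_distr) auto
  also have "\<dots> = (\<integral>f. g f * \<psi> (?T f) \<partial>P)"
    using gm g0 measurable_compose[OF Tm \<psi>] by (subst integral_density) auto
  also have "\<dots> = (\<integral>f. c * (of_bool (?E f) * \<psi> (?T f)) \<partial>P)"
    by (simp only: g_def mult.assoc)
  also have "\<dots> = c * (\<integral>f. of_bool (?E f) * \<psi> (?T f) \<partial>P)" by simp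
  finally show ?thesis using c by (simp add: c_def)
qed

lemma measurable_pred_fixed_heights:
  fixes V :: "real set" and m :: "'i \<Rightarrow> real"
  assumes fin: "finite A" and m: "\<And>\<alpha>. \<alpha> \<in> A \<Longrightarrow> m \<alpha> \<in> V"
  shows "Measurable.pred (\<Pi>\<^sub>M \<alpha>\<in>A. uniform_count_measure V \<Otimes>\<^sub>M D) (\<lambda>f. \<forall>\<alpha>\<in>A. fst (f \<alpha>) = m \<alpha>)"
proof (intro pred_intros_finite fin)
  fix \<alpha> assume \<alpha>: "\<alpha> \<in> A"
  let ?P = "\<Pi>\<^sub>M \<alpha>\<in>A. uniform_count_measure V \<Otimes>\<^sub>M D"
  have "(\<lambda>f. fst (f \<alpha>)) \<in> ?P \<rightarrow>\<^sub>M uniform_count_measure V"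
    using measurable_compose[OF measurable_component_singleton[OF \<alpha>] measurable_fst] .
  then have "(\<lambda>f. fst (f \<alpha>)) -` {m \<alpha>} \<inter> space ?P \<in> sets ?P"
    using m[OF \<alpha>] by (intro measurable_sets) (auto simp: sets_uniform_count_measure)
  moreover have "(\<lambda>f. fst (f \<alpha>)) -` {m \<alpha>} \<inter> space ?P = {f \<in> space ?P. fst (f \<alpha>) = m \<alpha>}" by auto
  ultimately show "Measurable.pred ?P (\<lambda>f. fst (f \<alpha>) = m \<alpha>)" by (simp add: pred_def)
qed

text \<open>There are finitely many height vectors, so an event that depends on the heights alone is a
finite disjoint union of events on which the heights are fixed.\<close>

lemma integral_height_event:
  fixes V :: "real set" and D1 :: "'b measure" and D2 :: "'c measure"
    and \<psi> :: "'b \<times> 'b \<Rightarrow> real" and Q :: "('i \<Rightarrow> real) \<Rightarrow> bool"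
  assumes fin: "finite A" and mem: "\<beta> \<in> A" "\<beta>' \<in> A" and ne: "\<beta> \<noteq> \<beta>'"
    and V: "finite V" "V \<noteq> {}" and D1: "prob_space D1" and D2: "prob_space D2"
    and \<psi>: "\<psi> \<in> borel_measurable (D1 \<Otimes>\<^sub>M D1)"
    and bound: "\<And>p. p \<in> space (D1 \<Otimes>\<^sub>M D1) \<Longrightarrow> \<bar>\<psi> p\<bar> \<le> C"
  defines "P \<equiv> \<Pi>\<^sub>M \<alpha>\<in>A. uniform_count_measure V \<Otimes>\<^sub>M (D1 \<Otimes>\<^sub>M D2)"
  defines "I \<equiv> \<lambda>f. of_bool (Q (\<lambda>\<alpha>\<in>A. fst (f \<alpha>))) * \<psi> (fst (snd (f \<beta>')), fst (snd (f \<beta>)))"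
  shows "integrable P I"
    and "(\<integral>f. I f \<partial>P) = real (card {m \<in> A \<rightarrow>\<^sub>E V. Q m}) / real (card V) ^ card A * (\<integral>p. \<psi> p \<partial>(D1 \<Otimes>\<^sub>M D1))"
proof -
  interpret D1: prob_space D1 by fact
  interpret D2: prob_space D2 by fact
  interpret DD: pair_prob_space D1 D2 by standard
  interpret U: prob_space "uniform_count_measure V" by (rule prob_space_uniform_count_measure[OF V])
  interpret L: pair_prob_space "uniform_count_measure V" "D1 \<Otimes>\<^sub>M D2" by standard
  interpret P: prob_space P unfolding P_def by (rule prob_space_PiM) (rule L.prob_space_axioms)
  define S where "S = {m \<in> A \<rightarrow>\<^sub>E V. Q m}"
  have finS: "finite S" unfolding S_def using finite_PiE[OF fin, of "\<lambda>_. V"] V by simp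
  let ?\<psi> = "\<lambda>f. \<psi> (fst (snd (f \<beta>')), fst (snd (f \<beta>)))"
  define J where "J m f = of_bool (\<forall>\<alpha>\<in>A. fst (f \<alpha>) = m \<alpha>) * ?\<psi> f" for m and f :: "'i \<Rightarrow> real \<times> 'b \<times> 'c"
  have spaceP: "space P = (\<Pi>\<^sub>E \<alpha>\<in>A. V \<times> (space D1 \<times> space D2))"
    by (simp add: P_def space_PiM space_pair_measure space_uniform_count_measure)
  have I_eq: "I f = (\<Sum>m\<in>S. J m f)" if f: "f \<in> space P" for f
  proof -
    let ?h = "\<lambda>\<alpha>\<in>A. fst (f \<alpha>)"
    have h: "?h \<in> A \<rightarrow>\<^sub>E V" using f unfolding spaceP by (auto simp: PiE_iff mem_Times_iff)
    have "(\<forall>\<alpha>\<in>A. fst (f \<alpha>) = m \<alpha>) \<longleftrightarrow> m = ?h" if "m \<in> S" for m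
      using that by (auto simp: S_def fun_eq_iff PiE_def extensional_def)
    then have "(\<Sum>m\<in>S. J m f) = (\<Sum>m\<in>S. if m = ?h then ?\<psi> f else 0)"
      unfolding J_def by (intro sum.cong refl) auto
    also have "\<dots> = I f" using finS h by (auto simp: I_def S_def)
    finally show ?thesis by simp
  qed
  have compm: "(\<lambda>f. f \<alpha>) \<in> P \<rightarrow>\<^sub>M uniform_count_measure V \<Otimes>\<^sub>M (D1 \<Otimes>\<^sub>M D2)" if "\<alpha> \<in> A" for \<alpha>
    unfolding P_def using that by (rule measurable_component_singleton)
  have Tm: "(\<lambda>f. (fst (snd (f \<beta>')), fst (snd (f \<beta>)))) \<in> P \<rightarrow>\<^sub>M D1 \<Otimes>\<^sub>M D1"
    using compm[OF mem(1)] compm[OF mem(2)] by measurable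
  have Jint: "integrable P (J m)" if "m \<in> S" for m
  proof (rule P.integrable_const_bound[where B = C])
    have "Measurable.pred P (\<lambda>f. \<forall>\<alpha>\<in>A. fst (f \<alpha>) = m \<alpha>)"
      unfolding P_def using that by (intro measurable_pred_fixed_heights fin) (auto simp: S_def)
    then show "J m \<in> borel_measurable P"
      unfolding J_def[abs_def] of_bool_def using measurable_compose[OF Tm \<psi>] by measurable
    show "AE f in P. norm (J m f) \<le> C"
    proof (rule AE_I2)
      fix f assume "f \<in> space P"
      then have "\<bar>?\<psi> f\<bar> \<le> C" using measurable_space[OF Tm] by (intro bound) auto
      then show "norm (J m f) \<le> C" by (auto simp: J_def abs_mult)
    qed
  qed
  have Iint: "integrable P (\<lambda>f. \<Sum>m\<in>S. J m f)" using Jint by auto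
  then show "integrable P I" by (subst Bochner_Integration.integrable_cong[OF refl I_eq])
  have "(\<integral>f. I f \<partial>P) = (\<integral>f. (\<Sum>m\<in>S. J m f) \<partial>P)" by (rule Bochner_Integration.integral_cong[OF refl I_eq])
  also have "\<dots> = (\<Sum>m\<in>S. \<integral>f. J m f \<partial>P)" using Jint by (intro Bochner_Integration.integral_sum)
  also have "\<dots> = (\<Sum>m\<in>S. (\<integral>p. \<psi> p \<partial>(D1 \<Otimes>\<^sub>M D1)) / real (card V) ^ card A)"
    unfolding J_def P_def
    by (intro sum.cong refl integral_fixed_heights fin mem ne V D1 D2 \<psi>) (auto simp: S_def)
  finally show "(\<integral>f. I f \<partial>P) =
      real (card {m \<in> A \<rightarrow>\<^sub>E V. Q m}) / real (card V) ^ card A * (\<integral>p. \<psi> p \<partial>(D1 \<Otimes>\<^sub>M D1))"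
    by (simp add: S_def)
qed

context complete_discretely_valued_field
begin

section \<open>The expected number of roots\<close>

lemma valuations_upto_eq:
  assumes "M > 0"
  shows "valuations_upto v \<pi> M = (\<lambda>n. step * of_int n) ` {- int (nat \<lfloor>M / step\<rfloor>)..int (nat \<lfloor>M / step\<rfloor>)}"
proof -
  have N: "int (nat \<lfloor>M / step\<rfloor>) = \<lfloor>M / step\<rfloor>" using assms step_pos by simp
  have "- M \<le> step * of_int n \<and> step * of_int n \<le> M \<longleftrightarrow> - \<lfloor>M / step\<rfloor> \<le> n \<and> n \<le> \<lfloor>M / step\<rfloor>" for n
  proof -
    have "step * of_int n \<le> M \<longleftrightarrow> n \<le> \<lfloor>M / step\<rfloor>" unfolding le_floor_iff using step_pos
        by (simp add: field_simps)
    moreover have "- M \<le> step * of_int n \<longleftrightarrow> - n \<le> \<lfloor>M / step\<rfloor>"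
      unfolding le_floor_iff using step_pos by (simp add: field_simps) linarith
    ultimately show ?thesis by linarith
  qed
  then show ?thesis unfolding valuations_upto_def step_def[symmetric] N by auto
qed

lemma card_valuations_upto:
  assumes "M > 0"
  shows "card (valuations_upto v \<pi> M) = 2 * nat \<lfloor>M / step\<rfloor> + 1"
proof -
  have "inj_on (\<lambda>n. step * real_of_int n) X" for X using step_pos by (auto simp: inj_on_def)
  moreover have "card {- int N..int N} = 2 * N + 1" for N by (simp add: nat_add_distrib nat_mult_distrib)
  ultimately show ?thesis unfolding valuations_upto_eq[OF assms] by (simp only: card_image)
qed

lemma card_height_vectors:
  assumes "M > 0"
  shows "card {m \<in> A \<rightarrow>\<^sub>E valuations_upto v \<pi> M. Q m} =
    card {n \<in> height_box A (nat \<lfloor>M / step\<rfloor>). Q (\<lambda>\<alpha>\<in>A. step * of_int (n \<alpha>))}"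
proof -
  have "bij_betw (\<lambda>n. \<lambda>\<alpha>\<in>A. step * real_of_int (n \<alpha>)) {n \<in> height_box A (nat \<lfloor>M / step\<rfloor>). Q (\<lambda>\<alpha>\<in>A. step
      * of_int (n \<alpha>))}
     {m \<in> A \<rightarrow>\<^sub>E valuations_upto v \<pi> M. Q m}"
  proof (rule bij_betw_byWitness[where f' = "\<lambda>m. \<lambda>\<alpha>\<in>A. \<lfloor>m \<alpha> / step\<rfloor>"])
    let ?S = "{n \<in> height_box A (nat \<lfloor>M / step\<rfloor>). Q (\<lambda>\<alpha>\<in>A. step * of_int (n \<alpha>))}"
    let ?T = "{m \<in> A \<rightarrow>\<^sub>E valuations_upto v \<pi> M. Q m}"
    have inv: "(\<lambda>\<alpha>\<in>A. step * real_of_int ((\<lambda>\<alpha>\<in>A. \<lfloor>m \<alpha> / step\<rfloor>) \<alpha>)) = m"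
        "(\<lambda>\<alpha>\<in>A. \<lfloor>m \<alpha> / step\<rfloor>) \<in> height_box A (nat \<lfloor>M / step\<rfloor>)"
      if "m \<in> ?T" for m
    proof -
      have "\<exists>n\<in>{- int (nat \<lfloor>M / step\<rfloor>)..int (nat \<lfloor>M / step\<rfloor>)}. m \<alpha> = step * of_int n" if "\<alpha> \<in> A" for \<alpha>
      proof -
        have "m \<alpha> \<in> valuations_upto v \<pi> M" using \<open>m \<in> ?T\<close> that by blast
        then show ?thesis unfolding valuations_upto_eq[OF assms] by blast
      qed
      then have *: "m \<alpha> = step * of_int \<lfloor>m \<alpha> / step\<rfloor>"
          "\<lfloor>m \<alpha> / step\<rfloor> \<in> {- int (nat \<lfloor>M / step\<rfloor>)..int (nat \<lfloor>M / step\<rfloor>)}"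
        if "\<alpha> \<in> A" for \<alpha> using that step_pos by force+
      show "(\<lambda>\<alpha>\<in>A. step * real_of_int ((\<lambda>\<alpha>\<in>A. \<lfloor>m \<alpha> / step\<rfloor>) \<alpha>)) = m"
      proof
        fix \<alpha>
        show "(\<lambda>\<alpha>\<in>A. step * real_of_int ((\<lambda>\<alpha>\<in>A. \<lfloor>m \<alpha> / step\<rfloor>) \<alpha>)) \<alpha> = m \<alpha>"
        proof (cases "\<alpha> \<in> A")
          case True
          then show ?thesis using *(1)[OF True] by simp
        next
          case False
          then show ?thesis using \<open>m \<in> ?T\<close> by (auto simp: PiE_def extensional_def)
        qed
      qed
      show "(\<lambda>\<alpha>\<in>A. \<lfloor>m \<alpha> / step\<rfloor>) \<in> height_box A (nat \<lfloor>M / step\<rfloor>)"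
        unfolding height_box_def using *(2) by (auto simp: PiE_iff)
    qed
    show "\<forall>n\<in>?S. (\<lambda>\<alpha>\<in>A. \<lfloor>(\<lambda>\<alpha>\<in>A. step * real_of_int (n \<alpha>)) \<alpha> / step\<rfloor>) = n"
      using step_pos by (auto simp: height_box_def PiE_def extensional_def fun_eq_iff)
    show "\<forall>m\<in>?T. (\<lambda>\<alpha>\<in>A. step * real_of_int ((\<lambda>\<alpha>\<in>A. \<lfloor>m \<alpha> / step\<rfloor>) \<alpha>)) = m" using inv(1) by blast
    show "(\<lambda>n. \<lambda>\<alpha>\<in>A. step * real_of_int (n \<alpha>)) ` ?S \<subseteq> ?T"
      unfolding valuations_upto_eq[OF assms] by (auto simp: height_box_def PiE_iff)
    show "(\<lambda>m. \<lambda>\<alpha>\<in>A. \<lfloor>m \<alpha> / step\<rfloor>) ` ?T \<subseteq> ?S" using inv by auto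
  qed
  then show ?thesis by (rule bij_betw_same_card[symmetric])
qed

text \<open>The divisibility says that the slope of the edge lies in the value group, so that elements
of valuation equal to minus the slope exist. The heights that occur are multiples of \<open>step\<close>, for
which the floor is exact.\<close>

definition hits_edge :: "int set \<Rightarrow> (int \<Rightarrow> real) \<Rightarrow> int \<times> int \<Rightarrow> bool" where
  "hits_edge A m p \<longleftrightarrow> is_edge A m (fst p) (snd p) \<and>
      snd p - fst p dvd \<lfloor>m (snd p) / step\<rfloor> - \<lfloor>m (fst p) / step\<rfloor>"

lemma hits_edge_scaled:
  assumes "p \<in> ordered_pairs A"
  shows "hits_edge A (\<lambda>\<alpha>\<in>A. step * of_int (n \<alpha>)) p \<longleftrightarrow>
    is_edge A (\<lambda>\<alpha>. of_int (n \<alpha>)) (fst p) (snd p) \<and> snd p - fst p dvd n (snd p) - n (fst p)"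
proof -
  have mem: "fst p \<in> A" "snd p \<in> A" using assms by (auto simp: ordered_pairs_def)
  have "is_edge A (\<lambda>\<alpha>\<in>A. step * of_int (n \<alpha>)) (fst p) (snd p) \<longleftrightarrow>
      is_edge A (\<lambda>\<alpha>. step * of_int (n \<alpha>) + 0) (fst p) (snd p)"
    by (rule is_edge_cong[OF mem]) simp
  then show ?thesis unfolding hits_edge_def is_edge_affine[OF step_pos] using mem step_pos by simp
qed

lemma generic_scaled: "generic A (\<lambda>\<alpha>\<in>A. step * of_int (n \<alpha>)) \<longleftrightarrow> generic A (\<lambda>\<alpha>. of_int (n \<alpha>))"
proof -
  have "generic A (\<lambda>\<alpha>\<in>A. step * of_int (n \<alpha>)) \<longleftrightarrow> generic A (\<lambda>\<alpha>. step * of_int (n \<alpha>) + 0)"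
    by (rule generic_cong) simp
  then show ?thesis unfolding generic_affine[OF step_pos] .
qed

text \<open>For heights in general position the root count equals the sum \<open>G\<close> of the contributions of
the edges, whose expectation factors by independence. Otherwise both counts lie between 0 and a
bound that depends on \<open>A\<close> alone, so the error is at most a constant times the probability that
the heights are not in general position.\<close>

lemma expected_roots_approx:
  fixes A :: "int set" and D1 :: "'a set measure" and D2 :: "'a measure"
  assumes \<Delta>: "digit_representatives v \<Delta>" and fin: "finite A" and ne: "ordered_pairs A \<noteq> {}"
    and unit: "\<And>\<beta> \<beta>'. (\<beta>, \<beta>') \<in> ordered_pairs A \<Longrightarrow> of_nat (nat (\<beta>' - \<beta>)) \<in> unit_elements"
    and D1: "prob_space D1" "space D1 = Units (residue_field v)"
    and D2: "prob_space D2" "space D2 = one_units v"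
    and M: "M > 0"
    and count_meas: "root_count v \<pi> \<Delta> A \<in> borel_measurable (polynomial_law v \<pi> A D1 D2 M)"
    and res_meas: "\<And>\<alpha> \<beta>. (\<alpha>, \<beta>) \<in> ordered_pairs A \<Longrightarrow>
           residue_root_count v (nat (\<beta> - \<alpha>)) \<in> borel_measurable (D1 \<Otimes>\<^sub>M D1)"
  defines "N \<equiv> nat \<lfloor>M / step\<rfloor>"
  shows "\<bar>expected_roots v \<pi> \<Delta> A D1 D2 M -
     (\<Sum>p\<in>ordered_pairs A. real (card {n \<in> height_box A N. is_edge A (\<lambda>\<alpha>. of_int (n \<alpha>)) (fst p) (snd p) \<and>
          snd p - fst p dvd n (snd p) - n (fst p)}) / (2 * real N + 1) ^ card A * expected_residue_roots
              v (nat (snd p - fst p)) D1)\<bar>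
    \<le> (real_of_int (Max A - Min A) + (\<Sum>p\<in>ordered_pairs A. real_of_int (snd p - fst p))) *
       (real (card {n \<in> height_box A N. \<not> generic A (\<lambda>\<alpha>. of_int (n \<alpha>))}) / (2 * real N + 1) ^ card A)"
proof -
  define V where "V = valuations_upto v \<pi> M"
  define P where "P = (\<Pi>\<^sub>M \<alpha>\<in>A. uniform_count_measure V \<Otimes>\<^sub>M (D1 \<Otimes>\<^sub>M D2))"
  have P_law: "polynomial_law v \<pi> A D1 D2 M = P"
    by (simp add: polynomial_law_def coefficient_law_def P_def V_def)
  have V_eq: "V = (\<lambda>n. step * of_int n) ` {- int N..int N}" unfolding V_def N_def
      by (rule valuations_upto_eq[OF M])
  have V: "finite V" "V \<noteq> {}" unfolding V_eq by auto
  have cardV: "real (card V) = 2 * real N + 1" unfolding V_def N_def card_valuations_upto[OF M] by simp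
  interpret D1: prob_space D1 by fact
  interpret D2: prob_space D2 by fact
  interpret DD: pair_prob_space D1 D2 by standard
  interpret U: prob_space "uniform_count_measure V" by (rule prob_space_uniform_count_measure[OF V])
  interpret L: pair_prob_space "uniform_count_measure V" "D1 \<Otimes>\<^sub>M D2" by standard
  interpret P: prob_space P unfolding P_def by (rule prob_space_PiM) (rule L.prob_space_axioms)
  have A_ne: "A \<noteq> {}" using ne by (auto simp: ordered_pairs_def)
  define H where "H f = (\<lambda>\<alpha>\<in>A. fst (f \<alpha>))" for f :: "int \<Rightarrow> real \<times> 'a set \<times> 'a"
  define rc where "rc p f = residue_root_count v (nat (snd p - fst p)) (fst (snd (f (snd p))),
      fst (snd (f (fst p))))"
    for p and f :: "int \<Rightarrow> real \<times> 'a set \<times> 'a"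
  define G where "G f = (\<Sum>p\<in>ordered_pairs A. of_bool (hits_edge A (H f) p) * rc p f)" for f
  define C where "C = real_of_int (Max A - Min A) + (\<Sum>p\<in>ordered_pairs A. real_of_int (snd p - fst p))"
  have pair: "fst p \<in> A" "snd p \<in> A" "fst p < snd p" "fst p \<noteq> snd p" if "p \<in> ordered_pairs A" for p
    using that by (auto simp: ordered_pairs_def)
  have res_bound: "\<bar>residue_root_count v (nat (snd p - fst p)) q\<bar> \<le> real_of_int (snd p - fst p)"
    if "p \<in> ordered_pairs A" "q \<in> Units (residue_field v) \<times> Units (residue_field v)" for p q
  proof -
    have "residue_root_count v (nat (snd p - fst p)) (fst q, snd q) \<le> real (nat (snd p - fst p))"
      using pair[OF that(1)] that unit[of "fst p" "snd p"] by (intro residue_binomial_root_count_le) auto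
    then show ?thesis using pair(3)[OF that(1)] by (simp add: residue_root_count_def)
  qed
  have spaceP: "f \<in> space P \<Longrightarrow> \<alpha> \<in> A \<Longrightarrow> f \<alpha> \<in> V \<times> (Units (residue_field v) \<times> one_units v)" for f \<alpha>
    by (auto simp: P_def space_PiM space_pair_measure space_uniform_count_measure D1(2) D2(2) PiE_iff)
  have coeffs: "element_of v \<pi> \<Delta> (f \<alpha>) \<noteq> 0" "ord (element_of v \<pi> \<Delta> (f \<alpha>)) = \<lfloor>fst (f \<alpha>) / step\<rfloor>"
      "first_digit (element_of v \<pi> \<Delta> (f \<alpha>)) = fst (snd (f \<alpha>))"
          "step * of_int \<lfloor>fst (f \<alpha>) / step\<rfloor> = fst (f \<alpha>)"
    if "f \<in> space P" "\<alpha> \<in> A" for f \<alpha>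
  proof -
    note f_mem = spaceP[OF that]
    obtain n d e where f: "f \<alpha> = (step * of_int n, d, e)" "d \<in> Units (residue_field v)" "e \<in> one_units v"
      using f_mem unfolding V_eq by (cases "f \<alpha>") auto
    have n: "\<lfloor>fst (f \<alpha>) / step\<rfloor> = n" using step_pos by (simp add: f(1))
    from element_of_properties[OF \<Delta> f(2,3), of n]
    show "element_of v \<pi> \<Delta> (f \<alpha>) \<noteq> 0" "ord (element_of v \<pi> \<Delta> (f \<alpha>)) = \<lfloor>fst (f \<alpha>) / step\<rfloor>"
      "first_digit (element_of v \<pi> \<Delta> (f \<alpha>)) = fst (snd (f \<alpha>))"
          "step * of_int \<lfloor>fst (f \<alpha>) / step\<rfloor> = fst (f \<alpha>)"
      unfolding n by (simp_all add: f(1))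
  qed
  have count_eq: "root_count v \<pi> \<Delta> A f = G f" if f: "f \<in> space P" and gen: "generic A (H f)" for f
  proof -
    define a where "a \<alpha> = element_of v \<pi> \<Delta> (f \<alpha>)" for \<alpha>
    define w where "w \<alpha> = real_of_int (ord (a \<alpha>))" for \<alpha>
    have a: "a \<alpha> \<noteq> 0" "ord (a \<alpha>) = \<lfloor>H f \<alpha> / step\<rfloor>" "first_digit (a \<alpha>) = fst (snd (f \<alpha>))"
        "H f \<alpha> = step * w \<alpha> + 0"
      if "\<alpha> \<in> A" for \<alpha>
      using coeffs[OF f that] that by (auto simp: a_def H_def w_def)
    have gw: "generic A w" using gen generic_cong[of A "H f"
        "\<lambda>\<alpha>. step * w \<alpha> + 0"] a(4) generic_affine[OF step_pos] by blast
    have ew: "is_edge A w (fst p) (snd p) \<longleftrightarrow> is_edge A (H f) (fst p) (snd p)" if "p \<in> ordered_pairs A" for p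
      using is_edge_cong[OF pair(1,2)[OF that], of "H f"
          "\<lambda>\<alpha>. step * w \<alpha> + 0"] a(4) is_edge_affine[OF step_pos] by blast
    have "card (nonzero_roots A a) = (\<Sum>(\<beta>, \<beta>') \<in> ordered_pairs A.
       if is_edge A w \<beta> \<beta>' \<and> \<beta>' - \<beta> dvd ord (a \<beta>') - ord (a \<beta>)
       then card (residue_binomial_roots v (nat (\<beta>' - \<beta>)) (first_digit (a \<beta>'), first_digit (a \<beta>))) else 0)"
      unfolding w_def
      by (rule card_nonzero_roots_generic[OF fin a(1) A_ne gw[unfolded w_def[abs_def]] unit])
    also have "real \<dots> = G f"
      unfolding G_def of_nat_sum
    proof (rule sum.cong[OF refl])
      fix p assume p: "p \<in> ordered_pairs A"
      then show "real (case p of (\<beta>, \<beta>') \<Rightarrow> if is_edge A w \<beta> \<beta>' \<and> \<beta>' - \<beta> dvd ord (a \<beta>') - ord (a \<beta>)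
         then card (residue_binomial_roots v (nat (\<beta>' - \<beta>)) (first_digit (a \<beta>'),
             first_digit (a \<beta>))) else 0) =
         of_bool (hits_edge A (H f) p) * rc p f"
        using ew[OF p] a pair[OF p] by (auto simp: case_prod_beta hits_edge_def rc_def
            residue_root_count_def)
    qed
    finally show ?thesis by (simp add: root_count_def a_def[abs_def])
  qed
  have count_bound: "0 \<le> root_count v \<pi> \<Delta> A f" "root_count v \<pi> \<Delta> A f \<le> real_of_int (Max A - Min A)"
      if f: "f \<in> space P" for f
  proof -
    show "0 \<le> root_count v \<pi> \<Delta> A f" by (simp add: root_count_def)
    have "Min A \<le> Max A" using fin A_ne by simp
    have "card (nonzero_roots A (\<lambda>\<alpha>. element_of v \<pi> \<Delta> (f \<alpha>))) \<le> nat (Max A - Min A)"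
      by (rule card_nonzero_roots_le[OF fin A_ne coeffs(1)[OF f]])
    then show "root_count v \<pi> \<Delta> A f \<le> real_of_int (Max A - Min A)"
      using \<open>Min A \<le> Max A\<close> unfolding root_count_def by linarith
  qed
  have G_bound: "0 \<le> G f" "G f \<le> (\<Sum>p\<in>ordered_pairs A. real_of_int (snd p - fst p))" if f: "f \<in> space P"
      for f
  proof -
    have r: "\<bar>rc p f\<bar> \<le> real_of_int (snd p - fst p)" "0 \<le> rc p f" if "p \<in> ordered_pairs A" for p
    proof -
      have "(fst (snd (f (snd p))), fst (snd (f (fst p)))) \<in> Units (residue_field v) \<times> Units
          (residue_field v)"
        using spaceP[OF f] pair(1,2)[OF that] by (auto simp: mem_Times_iff)
      then show "\<bar>rc p f\<bar> \<le> real_of_int (snd p - fst p)" unfolding rc_def by (rule res_bound[OF that])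
      show "0 \<le> rc p f" by (simp add: rc_def residue_root_count_def)
    qed
    show "0 \<le> G f" unfolding G_def using r by (intro sum_nonneg) auto
    show "G f \<le> (\<Sum>p\<in>ordered_pairs A. real_of_int (snd p - fst p))"
      unfolding G_def using r by (intro sum_mono) (auto simp: of_bool_def abs_le_iff less_imp_le pair)
  qed
  have edge_term: "integrable P (\<lambda>f. of_bool (hits_edge A (H f) p) * rc p f)"
    "(\<integral>f. of_bool (hits_edge A (H f) p) * rc p f \<partial>P) =
      real (card {n \<in> height_box A N. is_edge A (\<lambda>\<alpha>. of_int (n \<alpha>)) (fst p) (snd p) \<and>
          snd p - fst p dvd n (snd p) - n (fst p)}) / (2 * real N + 1) ^ card A * expected_residue_roots
              v (nat (snd p - fst p)) D1"
    if p: "p \<in> ordered_pairs A" for p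
  proof -
    have m: "residue_root_count v (nat (snd p - fst p)) \<in> borel_measurable (D1 \<Otimes>\<^sub>M D1)"
      using res_meas[of "fst p" "snd p"] p by simp
    have b: "\<bar>residue_root_count v (nat (snd p - fst p)) q\<bar> \<le> real_of_int (snd p - fst p)" if
        "q \<in> space (D1 \<Otimes>\<^sub>M D1)" for q
      using res_bound[OF p] that by (simp add: space_pair_measure D1(2))
    note ev = integral_height_event[OF fin pair(1,2,4)[OF p] V D1(1) D2(1) m b, where Q =
        "\<lambda>m. hits_edge A m p", folded P_def H_def rc_def]
    show "integrable P (\<lambda>f. of_bool (hits_edge A (H f) p) * rc p f)" by (rule ev(1))
    have "(\<integral>f. of_bool (hits_edge A (H f) p) * rc p f \<partial>P) =
      real (card {m \<in> A \<rightarrow>\<^sub>E V. hits_edge A m p}) / real (card V) ^ card A * expected_residue_roots v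
          (nat (snd p - fst p)) D1"
      unfolding expected_residue_roots_def by (rule ev(2))
    then show "(\<integral>f. of_bool (hits_edge A (H f) p) * rc p f \<partial>P) =
      real (card {n \<in> height_box A N. is_edge A (\<lambda>\<alpha>. of_int (n \<alpha>)) (fst p) (snd p) \<and>
          snd p - fst p dvd n (snd p) - n (fst p)}) / (2 * real N + 1) ^ card A * expected_residue_roots
              v (nat (snd p - fst p)) D1"
      unfolding cardV unfolding V_def card_height_vectors[OF M] N_def[symmetric] hits_edge_scaled[OF p] .
  qed
  obtain p0 where p0: "p0 \<in> ordered_pairs A" using ne by blast
  note nongen = integral_height_event[OF fin pair(1,2,4)[OF p0] V D1(1) D2(1), of "\<lambda>_. 1" 1, where Q =
      "\<lambda>m. \<not> generic A m", folded P_def H_def, simplified]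
  have nongen_int: "(\<integral>f. of_bool (\<not> generic A (H f)) \<partial>P) =
      real (card {n \<in> height_box A N. \<not> generic A (\<lambda>\<alpha>. of_int (n \<alpha>))}) / (2 * real N + 1) ^ card A"
  proof -
    interpret D11: pair_prob_space D1 D1 by standard
    have "(\<integral>f. of_bool (\<not> generic A (H f)) \<partial>P) =
        real (card {m \<in> A \<rightarrow>\<^sub>E V. \<not> generic A m}) / real (card V) ^ card A"
      using nongen(2) D11.prob_space by simp
    then show ?thesis unfolding cardV
        unfolding V_def card_height_vectors[OF M] N_def[symmetric] generic_scaled .
  qed
  have count_int: "integrable P (root_count v \<pi> \<Delta> A)"
    using count_meas count_bound unfolding P_law
    by (intro P.integrable_const_bound[where B = "real_of_int (Max A - Min A)"] AE_I2) auto
  have G_int: "integrable P G" unfolding G_def[abs_def] using edge_term(1)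
      by (intro Bochner_Integration.integrable_sum)
  have close: "\<bar>root_count v \<pi> \<Delta> A f - G f\<bar> \<le> C * of_bool (\<not> generic A (H f))" if "f \<in> space P" for f
    using count_eq[OF that] count_bound[OF that] G_bound[OF that] by (cases
        "generic A (H f)") (auto simp: C_def)
  have "\<bar>(\<integral>f. root_count v \<pi> \<Delta> A f \<partial>P) - (\<integral>f. G f \<partial>P)\<bar> = \<bar>\<integral>f. (root_count v \<pi> \<Delta> A f - G f) \<partial>P\<bar>"
    using count_int G_int by simp
  also have "\<dots> \<le> (\<integral>f. \<bar>root_count v \<pi> \<Delta> A f - G f\<bar> \<partial>P)"
    by (rule integral_abs_bound)
  also have "\<dots> \<le> (\<integral>f. C * of_bool (\<not> generic A (H f)) \<partial>P)"
    using count_int G_int nongen(1) close by (intro integral_mono) auto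
  also have "\<dots> = C * (real (card {n \<in> height_box A N. \<not> generic A (\<lambda>\<alpha>. of_int (n \<alpha>))}) / (2 * real N +
      1) ^ card A)"
    using nongen_int by simp
  finally have main: "\<bar>(\<integral>f. root_count v \<pi> \<Delta> A f \<partial>P) - (\<integral>f. G f \<partial>P)\<bar> \<le>
      C * (real (card {n \<in> height_box A N. \<not> generic A (\<lambda>\<alpha>. of_int (n \<alpha>))}) / (2 * real N + 1) ^ card A)" .
  have "(\<integral>f. G f \<partial>P) =
      (\<Sum>p\<in>ordered_pairs A. real (card {n \<in> height_box A N. is_edge A (\<lambda>\<alpha>. of_int (n \<alpha>)) (fst p) (snd p) \<and>
          snd p - fst p dvd n (snd p) - n (fst p)}) / (2 * real N + 1) ^ card A * expected_residue_roots
              v (nat (snd p - fst p)) D1)"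
    unfolding G_def using edge_term by (subst Bochner_Integration.integral_sum) (auto intro!: sum.cong)
  with main show ?thesis unfolding expected_roots_def P_law C_def by simp
qed

end

theorem theorem6p2:
  fixes v :: "'a::field \<Rightarrow> ereal" and \<pi> :: 'a and \<Delta> :: "'a set" and A :: "int set"
    and D1 :: "'a set measure" and D2 :: "'a measure"
  assumes "discrete_valuation v" and "complete_valuation v"
    and "valuation_ideal v = PIdl\<^bsub>valuation_ring v\<^esub> \<pi>"
    and "\<pi> \<in> carrier (valuation_ring v)"
    and "digit_representatives v \<Delta>"
    and "finite A" and "card A \<ge> 2"
    and "residue_char v = 0 \<or>
         (\<forall>\<alpha>\<in>A. \<forall>\<beta>\<in>A. \<alpha> \<noteq> \<beta> \<longrightarrow> coprime (int (residue_char v)) (\<alpha> - \<beta>))"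
    and "prob_space D1" and "space D1 = Units (residue_field v)"
    and "prob_space D2" and "space D2 = one_units v"
    and "\<And>M. M > 0 \<Longrightarrow>
           root_count v \<pi> \<Delta> A \<in> borel_measurable (polynomial_law v \<pi> A D1 D2 M)"
    and "\<And>\<alpha> \<beta>. \<alpha> \<in> A \<Longrightarrow> \<beta> \<in> A \<Longrightarrow> \<alpha> < \<beta> \<Longrightarrow>
           residue_root_count v (nat (\<beta> - \<alpha>)) \<in> borel_measurable (D1 \<Otimes>\<^sub>M D1)"
  shows "((\<lambda>M. expected_roots v \<pi> \<Delta> A D1 D2 M) \<longlongrightarrow>
          (\<Sum>B | {Min A, Max A} \<subseteq> B \<and> B \<subseteq> A. lower_hull_prob B A * edge_sum v D1 B)) at_top"
proof -
  interpret complete_discretely_valued_field v \<pi>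
    using assms(1-4) by unfold_locales
  have A_ne: "A \<noteq> {}" using assms(7) by auto
  have "ordered_pairs A \<noteq> {}"
  proof -
    have "\<not> (\<forall>x\<in>A. \<forall>y\<in>A. x = y)" using assms(7) card_le_Suc0_iff_eq[OF assms(6)] by auto
    then obtain x y where "x \<in> A" "y \<in> A" "x < y" by (metis linorder_neqE)
    then show ?thesis by (auto simp: ordered_pairs_def)
  qed
  have unit: "of_nat (nat (\<beta>' - \<beta>)) \<in> unit_elements" if "(\<beta>, \<beta>') \<in> ordered_pairs A" for \<beta> \<beta>'
  proof (rule coprime_residue_char_unit)
    have p: "\<beta> \<in> A" "\<beta>' \<in> A" "\<beta> < \<beta>'" using that by (auto simp: ordered_pairs_def)
    then show "nat (\<beta>' - \<beta>) > 0" by simp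
    have "coprime (int (residue_char v)) (int (nat (\<beta>' - \<beta>)))" if "residue_char v \<noteq> 0"
      using assms(8) p that by auto
    then show "residue_char v = 0 \<or> coprime (residue_char v) (nat (\<beta>' - \<beta>))"
      unfolding coprime_int_iff by blast
  qed
  define K where "K N = (2 * real N + 1) ^ card A" for N
  define S where "S N = (\<Sum>p\<in>ordered_pairs A. real (card {n \<in> height_box A N. is_edge A (\<lambda>\<alpha>. of_int (n
      \<alpha>)) (fst p) (snd p) \<and>
          snd p - fst p dvd n (snd p) - n (fst p)}) / K N * expected_residue_roots v (nat (snd p - fst
              p)) D1)" for N
  define C where "C = real_of_int (Max A - Min A) + (\<Sum>p\<in>ordered_pairs A. real_of_int (snd p - fst p))"
  define bad where "bad N = real (card {n \<in> height_box A N. \<not> generic A (\<lambda>\<alpha>. of_int (n \<alpha>))}) / K N" for N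
  define \<nu> where "\<nu> M = nat \<lfloor>M / step\<rfloor>" for M
  let ?R = "\<Sum>B | {Min A, Max A} \<subseteq> B \<and> B \<subseteq> A. lower_hull_prob B A * edge_sum v D1 B"
  have \<nu>: "filterlim \<nu> sequentially at_top"
  proof -
    have "filterlim (\<lambda>M. M / step) at_top at_top"
      using filterlim_tendsto_pos_mult_at_top[OF tendsto_const[of
          "1 / step"] _ filterlim_ident] step_pos by simp
    then show ?thesis unfolding \<nu>_def
      by (intro filterlim_compose[OF filterlim_nat_sequentially filterlim_compose[OF
          filterlim_floor_sequentially]])
  qed
  \<comment> \<open>Along \<open>\<nu> M\<close> the main term \<open>S\<close> has the asserted limit and the error term \<open>bad\<close> vanishes.\<close>
  have S_lim: "S \<longlonglongrightarrow> ?R"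
  proof -
    have "S \<longlonglongrightarrow> (\<Sum>p\<in>ordered_pairs A. edge_volume A (fst p) (snd p) / of_int (snd p - fst p) *
        expected_residue_roots v (nat (snd p - fst p)) D1)"
      unfolding S_def K_def
      by (intro tendsto_sum tendsto_mult tendsto_const edge_lattice_count_tendsto assms(6)) (auto simp:
          ordered_pairs_def)
    also have "(\<Sum>p\<in>ordered_pairs A. edge_volume A (fst p) (snd p) / of_int (snd p - fst p) *
        expected_residue_roots v (nat (snd p - fst p)) D1) = ?R"
      unfolding edge_sum_lower_hull_average[OF assms(6) A_ne] ordered_pairs_def
      by (intro sum.cong) (auto simp: algebra_simps)
    finally show ?thesis .
  qed
  have bad_lim: "bad \<longlonglongrightarrow> 0"
  proof -
    obtain p where "p \<in> ordered_pairs A" using \<open>ordered_pairs A \<noteq> {}\<close> by blast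
    then have "fst p \<in> A" "snd p \<in> A" "fst p < snd p" by (auto simp: ordered_pairs_def)
    from nongeneric_lattice_count_tendsto[OF assms(6) this] show ?thesis unfolding bad_def[abs_def] K_def .
  qed
  have approx: "\<bar>expected_roots v \<pi> \<Delta> A D1 D2 M - S (\<nu> M)\<bar> \<le> C * bad (\<nu> M)" if "M > 0" for M
    unfolding S_def C_def bad_def K_def \<nu>_def
    by (rule expected_roots_approx[OF assms(5,6) \<open>ordered_pairs A \<noteq> {}\<close> unit assms(9-12) that
        assms(13)[OF that]])
      (use assms(14) in \<open>auto simp: ordered_pairs_def\<close>)
  have "((\<lambda>M. expected_roots v \<pi> \<Delta> A D1 D2 M - S (\<nu> M)) \<longlongrightarrow> 0) at_top"
  proof (rule Lim_null_comparison)
    show "\<forall>\<^sub>F M in at_top. norm (expected_roots v \<pi> \<Delta> A D1 D2 M - S (\<nu> M)) \<le> C * bad (\<nu> M)"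
      using eventually_gt_at_top[of 0] by eventually_elim (use approx in simp)
    show "((\<lambda>M. C * bad (\<nu> M)) \<longlongrightarrow> 0) at_top"
      using tendsto_mult[OF tendsto_const[of C] filterlim_compose[OF bad_lim \<nu>]] by simp
  qed
  from tendsto_add[OF this filterlim_compose[OF S_lim \<nu>]] show ?thesis by simp
qed

end
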